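(* Let $\Omega\subset\mathbb{R}^n$, $n\ge 2$, be an open bounded domain with Lipschitz boundary, let $p\ge 2$ be fixed, and let $\sigma_1,\sigma_2:\overline\Omega\times[0,+\infty)\to\mathbb{R}$ both satisfy hypotheses (H1)–(H5) listed in the context, with this $p$. If $\sigma_1(x,E)\le\sigma_2(x,E)$ for a.e. $x\in\overline\Omega$ and all $E>0$, then $$\langle\overline\Lambda_{\sigma_1}(f),f\rangle\le\langle\overline\Lambda_{\sigma_2}(f),f\rangle\qquad\forall f\in X_\diamond,$$ where $\overline\Lambda_{\sigma_i}$ is the Average Dirichlet-to-Neumann operator associated with $\sigma_i$, $i=1,2$.
   Context: Hypotheses on $\sigma:\overline\Omega\times[0,+\infty)\to\mathbb{R}$, for fixed $p\ge2$: (H1) $x\mapsto\sigma(x,E)$ is measurable on $\overline\Omega$ for every $E\ge0$. (H2) $E\in(0,+\infty)\mapsto\sigma(x,E)E$ is strictly increasing for a.e. $x\in\overline\Omega$. (H3) $E\mapsto\sigma(x,E)$ is continuous on $[0,+\infty)$ for a.e. $x\in\overline\Omega$. (H4) There exist positive constants $\overline\sigma\ge\underline\sigma$ and $E_0>0$ such that $\underline\sigma\,(E/E_0)^{p-2}\le\sigma(x,E)\le\overline\sigma\max\{1,(E/E_0)^{p-2}\}$ for a.e. $x\in\overline\Omega$ and all $E>0$. (H5) There exists $c>0$ such that $(\sigma(x,|\mathbf{E}_2|)\mathbf{E}_2-\sigma(x,|\mathbf{E}_1|)\mathbf{E}_1)\cdot(\mathbf{E}_2-\mathbf{E}_1)\ge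 c|\mathbf{E}_2-\mathbf{E}_1|^p$ for a.e. $x\in\overline\Omega$ and all $\mathbf{E}_1,\mathbf{E}_2\in\mathbb{R}^n$. (The constants may depend on $\sigma$.) Boundary data: $W^{1,p}_0(\Omega)$ is the closure of $C^1_0(\Omega)$ in the $W^{1,p}$-norm. $X=W^{1,p}(\Omega)/W^{1,p}_0(\Omega)$ is the trace space, and $X_\diamond$ is the set of elements of $X$ whose trace has zero average on $\partial\Omega$ with respect to the $(n-1)$-dimensional Hausdorff measure; $X_\diamond'$ is its dual. One writes $f\in X_\diamond$ also for a representative $f\in W^{1,p}(\Omega)$ of a class, and $u|_{\partial\Omega}=f$ means $u-f\in W^{1,p}_0(\Omega)$. Dirichlet Energy: $\mathbb{F}_\sigma(u)=\int_\Omega Q_\sigma(x,|\nabla u(x)|)\,dx$ for $u\in W^{1,p}(\Omega)$, with $Q_\sigma(x,E)=\int_0^E\sigma(x,\xi)\xi\,d\xi$. For $f\in X_\diamond$, $u^f$ (depending on $\sigma$) denotes the unique minimizer of $\mathbb{F}_\sigma$ over $\{u\in W^{1,p}(\Omega): u|_{\partial\Omega}=f\}$, equivalently the weak solution of $\operatorname{div}(\sigma(x,|\nabla u|)\nabla u)=0$ in $\Omega$, $u=f$ on $\partial\Omega$. Dirichlet-to-Neumann (DtN) operator $\Lambda_\sigma:X_\diamond\to X_\diamond'$: $\Lambda_\sigma(f)=\sigma(x,|\nabla u^f|)\,\partial_n u^f|_{\partial\Omega}$, i.e. $\langle\Lambda_\sigma(f),\varphi\rangle=\int_{\partial\Omega}\varphi\,\sigma(x,|\nabla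 u^f|)\,\partial_n u^f\,dS$, understood in the weak sense as $\langle\Lambda_\sigma(f),\varphi\rangle=\int_\Omega\sigma(x,|\nabla u^f(x)|)\nabla u^f(x)\cdot\nabla\varphi(x)\,dx$ (independent of the representative of $\varphi$). Average DtN operator $\overline\Lambda_\sigma:X_\diamond\to X_\diamond'$: $\langle\overline\Lambda_\sigma(f),\varphi\rangle=\int_0^1\langle\Lambda_\sigma(\alpha f),\varphi\rangle\,d\alpha$ for all $\varphi\in X_\diamond$. *)

theory Defs
  imports "HOL-Analysis.Analysis"
begin

section \<open>Domains with Lipschitz boundary\<close>

definition domain :: "'a::euclidean_space set \<Rightarrow> bool" where
  "domain \<Omega> \<longleftrightarrow> open \<Omega> \<and> connected \<Omega> \<and> \<Omega> \<noteq> {}"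

text \<open>Near each boundary point, after a choice of a unit direction \<open>e\<close>, the set is the strict
  epigraph of a Lipschitz function \<open>\<gamma>\<close> on the hyperplane orthogonal to \<open>e\<close>;
  \<open>y - (y \<bullet> e) *\<^sub>R e\<close> is the orthogonal projection of \<open>y\<close> to that hyperplane.\<close>

definition lipschitz_boundary :: "'a::euclidean_space set \<Rightarrow> bool" where
  "lipschitz_boundary \<Omega> \<longleftrightarrow>
    (\<forall>z\<in>frontier \<Omega>. \<exists>U e L \<gamma>. open U \<and> z \<in> U \<and> norm e = 1 \<and>
       L-lipschitz_on {v. v \<bullet> e = 0} \<gamma> \<and>
       \<Omega> \<inter> U = {y \<in> U. \<gamma> (y - (y \<bullet> e) *\<^sub>R e) < y \<bullet> e})"

section \<open>Sobolev spaces\<close>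

definition Lp_fun :: "'b measure \<Rightarrow> real \<Rightarrow> ('b \<Rightarrow> 'c::euclidean_space) \<Rightarrow> bool" where
  "Lp_fun M p f \<longleftrightarrow> f \<in> borel_measurable M \<and> integrable M (\<lambda>x. norm (f x) powr p)"

definition C1_with_gradient :: "('a::euclidean_space \<Rightarrow> real) \<Rightarrow> ('a \<Rightarrow> 'a) \<Rightarrow> bool" where
  "C1_with_gradient \<phi> G \<longleftrightarrow> continuous_on UNIV G \<and> (\<forall>x. GDERIV \<phi> x :> G x)"

definition compactly_supported_in :: "'a::euclidean_space set \<Rightarrow> ('a \<Rightarrow> real) \<Rightarrow> bool" where
  "compactly_supported_in \<Omega> \<phi> \<longleftrightarrow>
     compact (closure {x. \<phi> x \<noteq> 0}) \<and> closure {x. \<phi> x \<noteq> 0} \<subseteq> \<Omega>"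

definition C1_0 :: "'a::euclidean_space set \<Rightarrow> ('a \<Rightarrow> real) set" where
  "C1_0 \<Omega> = {\<phi>. (\<exists>G. C1_with_gradient \<phi> G) \<and> compactly_supported_in \<Omega> \<phi>}"

definition locally_integrable_on :: "('a::euclidean_space \<Rightarrow> 'c::euclidean_space) \<Rightarrow> 'a set \<Rightarrow> bool" where
  "locally_integrable_on f \<Omega> \<longleftrightarrow> (\<forall>K. compact K \<and> K \<subseteq> \<Omega> \<longrightarrow> integrable (lebesgue_on K) f)"

definition is_weak_gradient :: "'a::euclidean_space set \<Rightarrow> ('a \<Rightarrow> real) \<Rightarrow> ('a \<Rightarrow> 'a) \<Rightarrow> bool" where
  "is_weak_gradient \<Omega> u g \<longleftrightarrow>
     locally_integrable_on u \<Omega> \<and> locally_integrable_on g \<Omega> \<and>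
     (\<forall>\<phi> G. C1_with_gradient \<phi> G \<and> compactly_supported_in \<Omega> \<phi> \<longrightarrow>
        (LINT x|lebesgue_on \<Omega>. u x *\<^sub>R G x) = - (LINT x|lebesgue_on \<Omega>. \<phi> x *\<^sub>R g x))"

text \<open>Weak gradients are unique up to null sets; every use below is under an integral, so the
  choice of a version does not matter.\<close>

definition weak_gradient :: "'a::euclidean_space set \<Rightarrow> ('a \<Rightarrow> real) \<Rightarrow> 'a \<Rightarrow> 'a" where
  "weak_gradient \<Omega> u = (SOME g. is_weak_gradient \<Omega> u g)"

text \<open>Elements of \<open>W1p\<close> are functions rather than almost-everywhere classes. Functions that vanish
  almost everywhere belong to \<open>W1p_0\<close>, so the quotient \<open>trace_space\<close> is the same either way.\<close>

definition W1p :: "'a::euclidean_space set \<Rightarrow> real \<Rightarrow> ('a \<Rightarrow> real) set" where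
  "W1p \<Omega> p = {u. Lp_fun (lebesgue_on \<Omega>) p u \<and>
                 (\<exists>g. is_weak_gradient \<Omega> u g \<and> Lp_fun (lebesgue_on \<Omega>) p g)}"

definition W1p_norm :: "'a::euclidean_space set \<Rightarrow> real \<Rightarrow> ('a \<Rightarrow> real) \<Rightarrow> real" where
  "W1p_norm \<Omega> p u = ((LINT x|lebesgue_on \<Omega>. \<bar>u x\<bar> powr p) +
                     (LINT x|lebesgue_on \<Omega>. norm (weak_gradient \<Omega> u x) powr p)) powr (1 / p)"

definition W1p_0 :: "'a::euclidean_space set \<Rightarrow> real \<Rightarrow> ('a \<Rightarrow> real) set" where
  "W1p_0 \<Omega> p = {u \<in> W1p \<Omega> p. \<forall>\<epsilon>>0. \<exists>\<phi>\<in>C1_0 \<Omega>. W1p_norm \<Omega> p (\<lambda>x. u x - \<phi> x) < \<epsilon>}"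

section \<open>The trace space and its mean-free part\<close>

definition same_trace :: "'a::euclidean_space set \<Rightarrow> real \<Rightarrow> (('a \<Rightarrow> real) \<times> ('a \<Rightarrow> real)) set" where
  "same_trace \<Omega> p = {(u, v). u \<in> W1p \<Omega> p \<and> v \<in> W1p \<Omega> p \<and> (\<lambda>x. u x - v x) \<in> W1p_0 \<Omega> p}"

definition trace_space :: "'a::euclidean_space set \<Rightarrow> real \<Rightarrow> ('a \<Rightarrow> real) set set" where
  "trace_space \<Omega> p = W1p \<Omega> p // same_trace \<Omega> p"

definition trace_scale :: "'a::euclidean_space set \<Rightarrow> real \<Rightarrow> real \<Rightarrow> ('a \<Rightarrow> real) set \<Rightarrow> ('a \<Rightarrow> real) set" where
  "trace_scale \<Omega> p \<alpha> f = (\<Union>u\<in>f. same_trace \<Omega> p `` {\<lambda>x. \<alpha> * u x})"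

text \<open>The factor \<open>unit_ball_vol s / 2 powr s\<close> is the usual normalisation, for which the
  \<open>(n - 1)\<close>-dimensional measure agrees with surface area. Coverings are by bounded sets
  because \<open>diameter\<close> is meaningful only for these.\<close>

definition hausdorff_pre :: "real \<Rightarrow> real \<Rightarrow> 'a::euclidean_space set \<Rightarrow> ennreal" where
  "hausdorff_pre \<delta> s A =
     (INF C \<in> {C :: nat \<Rightarrow> 'a set. A \<subseteq> (\<Union>i. C i) \<and> (\<forall>i. bounded (C i) \<and> diameter (C i) \<le> \<delta>)}.
        \<Sum>i. ennreal (unit_ball_vol s * (diameter (C i) / 2) powr s))"

definition hausdorff_outer :: "real \<Rightarrow> 'a::euclidean_space set \<Rightarrow> ennreal" where
  "hausdorff_outer s A = (SUP \<delta>\<in>{0<..}. hausdorff_pre \<delta> s A)"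

text \<open>A metric outer measure, hence countably additive on Borel sets.\<close>

definition hausdorff_measure :: "real \<Rightarrow> 'a::euclidean_space measure" where
  "hausdorff_measure s = measure_of UNIV (sets borel) (hausdorff_outer s)"

definition surface_measure :: "'a::euclidean_space set \<Rightarrow> 'a measure" where
  "surface_measure \<Omega> = restrict_space (hausdorff_measure (real DIM('a) - 1)) (frontier \<Omega>)"

text \<open>The trace operator on a bounded Lipschitz domain is the continuous extension to \<open>W1p\<close> of
  the restriction to the boundary of functions that are \<open>C\<^sup>1\<close> up to the boundary; these are dense.\<close>

definition is_trace :: "'a::euclidean_space set \<Rightarrow> real \<Rightarrow> ('a \<Rightarrow> real) \<Rightarrow> ('a \<Rightarrow> real) \<Rightarrow> bool" where
  "is_trace \<Omega> p u g \<longleftrightarrow> Lp_fun (surface_measure \<Omega>) p g \<and>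
     (\<exists>v :: nat \<Rightarrow> 'a \<Rightarrow> real.
        (\<forall>k. \<exists>G. C1_with_gradient (v k) G) \<and>
        (\<lambda>k. W1p_norm \<Omega> p (\<lambda>x. u x - v k x)) \<longlonglongrightarrow> 0 \<and>
        (\<lambda>k. LINT x|surface_measure \<Omega>. \<bar>g x - v k x\<bar> powr p) \<longlonglongrightarrow> 0)"

text \<open>All members of a class have the same trace.\<close>

definition X_diamond :: "'a::euclidean_space set \<Rightarrow> real \<Rightarrow> ('a \<Rightarrow> real) set set" where
  "X_diamond \<Omega> p = {f \<in> trace_space \<Omega> p.
      \<exists>u\<in>f. \<exists>g. is_trace \<Omega> p u g \<and> (LINT x|surface_measure \<Omega>. g x) = 0}"

section \<open>Admissible conductivities\<close>

text \<open>The values of \<open>\<sigma> x E\<close> for \<open>x\<close> outside the closure of \<open>\<Omega>\<close> or for \<open>E < 0\<close> are irrelevant.\<close>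

definition H1 :: "'a::euclidean_space set \<Rightarrow> ('a \<Rightarrow> real \<Rightarrow> real) \<Rightarrow> bool" where
  "H1 \<Omega> \<sigma> \<longleftrightarrow> (\<forall>E\<ge>0. (\<lambda>x. \<sigma> x E) \<in> borel_measurable (lebesgue_on (closure \<Omega>)))"

definition H2 :: "'a::euclidean_space set \<Rightarrow> ('a \<Rightarrow> real \<Rightarrow> real) \<Rightarrow> bool" where
  "H2 \<Omega> \<sigma> \<longleftrightarrow> (AE x in lebesgue_on (closure \<Omega>). strict_mono_on {0<..} (\<lambda>E. \<sigma> x E * E))"

definition H3 :: "'a::euclidean_space set \<Rightarrow> ('a \<Rightarrow> real \<Rightarrow> real) \<Rightarrow> bool" where
  "H3 \<Omega> \<sigma> \<longleftrightarrow> (AE x in lebesgue_on (closure \<Omega>). continuous_on {0..} (\<sigma> x))"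

definition H4 :: "'a::euclidean_space set \<Rightarrow> real \<Rightarrow> ('a \<Rightarrow> real \<Rightarrow> real) \<Rightarrow> bool" where
  "H4 \<Omega> p \<sigma> \<longleftrightarrow>
     (\<exists>\<sigma>lo \<sigma>hi E0. 0 < \<sigma>lo \<and> \<sigma>lo \<le> \<sigma>hi \<and> 0 < E0 \<and>
        (AE x in lebesgue_on (closure \<Omega>). \<forall>E>0.
            \<sigma>lo * (E / E0) powr (p - 2) \<le> \<sigma> x E \<and>
            \<sigma> x E \<le> \<sigma>hi * max 1 ((E / E0) powr (p - 2))))"

definition H5 :: "'a::euclidean_space set \<Rightarrow> real \<Rightarrow> ('a \<Rightarrow> real \<Rightarrow> real) \<Rightarrow> bool" where
  "H5 \<Omega> p \<sigma> \<longleftrightarrow>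
     (\<exists>c>0. AE x in lebesgue_on (closure \<Omega>). \<forall>E1 E2 :: 'a.
        c * norm (E2 - E1) powr p \<le>
          (\<sigma> x (norm E2) *\<^sub>R E2 - \<sigma> x (norm E1) *\<^sub>R E1) \<bullet> (E2 - E1))"

definition admissible :: "'a::euclidean_space set \<Rightarrow> real \<Rightarrow> ('a \<Rightarrow> real \<Rightarrow> real) \<Rightarrow> bool" where
  "admissible \<Omega> p \<sigma> \<longleftrightarrow> H1 \<Omega> \<sigma> \<and> H2 \<Omega> \<sigma> \<and> H3 \<Omega> \<sigma> \<and> H4 \<Omega> p \<sigma> \<and> H5 \<Omega> p \<sigma>"

section \<open>Dirichlet energy and the Dirichlet-to-Neumann operators\<close>

definition Q_density :: "('a::euclidean_space \<Rightarrow> real \<Rightarrow> real) \<Rightarrow> 'a \<Rightarrow> real \<Rightarrow> real" where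
  "Q_density \<sigma> x E = integral {0..E} (\<lambda>\<xi>. \<sigma> x \<xi> * \<xi>)"

definition dirichlet_energy :: "'a::euclidean_space set \<Rightarrow> ('a \<Rightarrow> real \<Rightarrow> real) \<Rightarrow> ('a \<Rightarrow> real) \<Rightarrow> real" where
  "dirichlet_energy \<Omega> \<sigma> u = (LINT x|lebesgue_on \<Omega>. Q_density \<sigma> x (norm (weak_gradient \<Omega> u x)))"

text \<open>A class \<open>f\<close> in the trace space is itself the set of all Sobolev functions with boundary
  value \<open>f\<close>. The minimizer over it is unique only up to null sets, hence \<open>SOME\<close> and not
  \<open>THE\<close>.\<close>

definition minimizer :: "'a::euclidean_space set \<Rightarrow> ('a \<Rightarrow> real \<Rightarrow> real) \<Rightarrow> ('a \<Rightarrow> real) set \<Rightarrow> 'a \<Rightarrow> real" where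
  "minimizer \<Omega> \<sigma> f =
     (SOME u. u \<in> f \<and> (\<forall>v\<in>f. dirichlet_energy \<Omega> \<sigma> u \<le> dirichlet_energy \<Omega> \<sigma> v))"

text \<open>\<open>DtN \<Omega> \<sigma> f \<phi>\<close> and \<open>avg_DtN \<Omega> p \<sigma> f \<phi>\<close> are the duality pairings of the images of \<open>f\<close>
  with \<open>\<phi>\<close>. The weak form does not depend on the representative of the class \<open>\<phi>\<close>.\<close>

definition DtN :: "'a::euclidean_space set \<Rightarrow> ('a \<Rightarrow> real \<Rightarrow> real)
    \<Rightarrow> ('a \<Rightarrow> real) set \<Rightarrow> ('a \<Rightarrow> real) set \<Rightarrow> real" where
  "DtN \<Omega> \<sigma> f \<phi> =
     (let Du = weak_gradient \<Omega> (minimizer \<Omega> \<sigma> f); D\<phi> = weak_gradient \<Omega> (SOME w. w \<in> \<phi>)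
      in LINT x|lebesgue_on \<Omega>. \<sigma> x (norm (Du x)) * (Du x \<bullet> D\<phi> x))"

definition avg_DtN :: "'a::euclidean_space set \<Rightarrow> real \<Rightarrow> ('a \<Rightarrow> real \<Rightarrow> real)
    \<Rightarrow> ('a \<Rightarrow> real) set \<Rightarrow> ('a \<Rightarrow> real) set \<Rightarrow> real" where
  "avg_DtN \<Omega> p \<sigma> f \<phi> = (LBINT \<alpha>:{0..1}. DtN \<Omega> \<sigma> (trace_scale \<Omega> p \<alpha> f) \<phi>)"

end

theory Submission
  imports Defs
begin

text \<open>Write \<open>A x a = \<sigma> x (norm a) *\<^sub>R a\<close> for the flux and \<open>E \<alpha>\<close> for the least Dirichlet energy among
the functions with boundary value \<open>\<alpha> f\<close>, attained at \<open>u\<^sub>\<alpha>\<close>. The average Dirichlet-to-Neumann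
operator recovers this minimum: \<open>\<langle>avg f, f\<rangle> = E 1\<close>. The reason is that \<open>d \<alpha> = \<langle>DtN (\<alpha> f), f\<rangle>\<close> is a
subgradient of \<open>E\<close> at \<open>\<alpha>\<close>. Convexity of the energy density gives
\<open>E \<alpha> + \<integral> A (\<nabla>u\<^sub>\<alpha>) \<bullet> (\<nabla>u\<^sub>\<beta> - \<nabla>u\<^sub>\<alpha>) \<le> E \<beta>\<close>, and because \<open>u\<^sub>\<beta> - u\<^sub>\<alpha> - (\<beta> - \<alpha>) f\<close> vanishes on the boundary, the
Euler-Lagrange equation of \<open>u\<^sub>\<alpha>\<close> turns the integral into \<open>(\<beta> - \<alpha>) d \<alpha>\<close>. A function with a subgradient at
every point is the integral of that subgradient, which is monotone (\<open>integral_subgradient_eq\<close>), and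
\<open>E 0 = 0\<close>. This is \<open>avg_DtN_eq_energy\<close>. If
\<open>\<sigma>1 \<le> \<sigma>2\<close>, then the energy densities are ordered in the same way, and the minimizer for \<open>\<sigma>2\<close> is a
competitor in the problem for \<open>\<sigma>1\<close>, so the minima are ordered.

The identity needs the minimizers to exist (\<open>exists_minimizer\<close>). The monotonicity hypothesis on the
flux makes the energy density uniformly convex with modulus \<open>norm (b - a) powr p\<close>
(\<open>radial_strongly_convex\<close>). Hence the gradients along a minimizing sequence form a Cauchy sequence
in \<open>L\<^sup>p\<close>: the energy of a midpoint is never below the infimum. By the Poincare inequality the space
\<open>W1p_0\<close> is complete for the gradient seminorm (\<open>W1p_0_complete\<close>), so the sequence converges
strongly to a competitor, and the subgradient inequality gives lower semicontinuity.

All of this presupposes that the gradient that \<open>weak_gradient\<close> picks by \<open>SOME\<close> is determined up to null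
sets (\<open>is_weak_gradient_unique\<close>). To see this one tests with \<open>C\<^sup>1\<close> functions that approximate the
indicator of a box, and boxes generate the Borel sets.\<close>

section \<open>Calculus of continuously differentiable functions\<close>

lemma C1_with_gradient_continuous:
  assumes "C1_with_gradient \<phi> G" shows "continuous_on UNIV \<phi>"
  using assms unfolding C1_with_gradient_def gderiv_def
  by (meson differentiableI differentiable_imp_continuous_on differentiable_on_def
      differentiable_at_imp_differentiable_on)

lemma C1_with_gradient_mult:
  assumes "C1_with_gradient \<phi> G" "C1_with_gradient \<psi> H"
  shows "C1_with_gradient (\<lambda>x. \<phi> x * \<psi> x) (\<lambda>x. \<phi> x *\<^sub>R H x + \<psi> x *\<^sub>R G x)"
  using assms C1_with_gradient_continuous[OF assms(1)] C1_with_gradient_continuous[OF assms(2)]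
  unfolding C1_with_gradient_def by (auto intro!: continuous_intros GDERIV_mult)

lemma C1_with_gradient_compose:
  assumes "C1_with_gradient \<phi> G"
    and "\<And>x. (s has_real_derivative s' (\<phi> x)) (at (\<phi> x))" "continuous_on (range \<phi>) s'"
  shows "C1_with_gradient (\<lambda>x. s (\<phi> x)) (\<lambda>x. s' (\<phi> x) *\<^sub>R G x)"
proof -
  have "GDERIV (\<lambda>x. s (\<phi> x)) x :> s' (\<phi> x) *\<^sub>R G x" for x
    using assms(1,2) by (intro GDERIV_DERIV_compose) (auto simp: C1_with_gradient_def)
  moreover have "continuous_on UNIV (\<lambda>x. s' (\<phi> x))"
    by (rule continuous_on_compose2[OF assms(3) C1_with_gradient_continuous[OF assms(1)]]) auto
  ultimately show ?thesis
    using assms(1) unfolding C1_with_gradient_def by (auto intro!: continuous_intros)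
qed

text \<open>Off its closed support the function vanishes on a whole neighbourhood of the point.\<close>

lemma gradient_eq_0_outside_support:
  assumes "C1_with_gradient \<phi> G" "x \<notin> closure {x. \<phi> x \<noteq> 0}"
  shows "G x = 0"
proof -
  have "(\<phi> has_derivative (\<lambda>h. h \<bullet> G x)) (at x)"
    using assms(1) by (simp add: C1_with_gradient_def gderiv_def)
  moreover have "(\<phi> has_derivative (\<lambda>h. 0)) (at x)"
  proof (rule has_derivative_transform_within_open[OF has_derivative_const[of "0::real"]])
    show "open (- closure {x. \<phi> x \<noteq> 0})" by (intro open_Compl closed_closure)
    show "x \<in> - closure {x. \<phi> x \<noteq> 0}" using assms(2) by simp
    show "0 = \<phi> y" if "y \<in> - closure {x. \<phi> x \<noteq> 0}" for y
    proof -
      have "y \<notin> {x. \<phi> x \<noteq> 0}" using that closure_subset[of "{x. \<phi> x \<noteq> 0}"] by blast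
      then show ?thesis by simp
    qed
  qed
  ultimately have "(\<lambda>h. h \<bullet> G x) = (\<lambda>h. 0)" by (rule has_derivative_unique)
  then have "G x \<bullet> G x = 0" by metis
  then show ?thesis by simp
qed

lemma compact_support_bounded:
  fixes \<phi> :: "'a::euclidean_space \<Rightarrow> real"
  assumes "C1_with_gradient \<phi> G" "compact (closure {x. \<phi> x \<noteq> 0})"
  obtains B where "B \<ge> 0" "\<And>x. \<bar>\<phi> x\<bar> \<le> B" "\<And>x. norm (G x) \<le> B"
proof -
  let ?K = "closure {x. \<phi> x \<noteq> 0}"
  have "continuous_on ?K \<phi>" "continuous_on ?K G"
    using C1_with_gradient_continuous[OF assms(1)] assms(1)
    by (auto simp: C1_with_gradient_def intro: continuous_on_subset)
  then have "bounded (\<phi> ` ?K)" "bounded (G ` ?K)"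
    using assms(2) compact_continuous_image compact_imp_bounded by blast+
  then obtain b1 b2 where b: "\<And>x. x \<in> ?K \<Longrightarrow> \<bar>\<phi> x\<bar> \<le> b1" "\<And>x. x \<in> ?K \<Longrightarrow> norm (G x) \<le> b2"
    unfolding bounded_iff by fastforce
  have "\<bar>\<phi> x\<bar> \<le> max 0 (max b1 b2)" for x
  proof (cases "x \<in> ?K")
    case True then show ?thesis using b(1)[of x] by linarith
  next
    case False then have "\<phi> x = 0" using closure_subset[of "{x. \<phi> x \<noteq> 0}"] by auto
    then show ?thesis by simp
  qed
  moreover have "norm (G x) \<le> max 0 (max b1 b2)" for x
    using b(2)[of x] gradient_eq_0_outside_support[OF assms(1), of x] by (cases "x \<in> ?K") fastforce+
  ultimately show ?thesis using that[of "max 0 (max b1 b2)"] by simp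
qed

text \<open>The difference quotients \<open>(\<phi> (t e + x) - \<phi> x) / t\<close> have integral zero because Lebesgue measure is
translation invariant. They converge to the directional derivative, dominated by the Lipschitz constant
on a fixed ball. All integrations by parts below come from this lemma and the product rule.\<close>

lemma integral_gradient_eq_0:
  fixes \<phi> :: "'a::euclidean_space \<Rightarrow> real"
  assumes C1: "C1_with_gradient \<phi> G" and supp: "compact (closure {x. \<phi> x \<noteq> 0})"
  shows "(LINT x|lborel. G x \<bullet> e) = 0"
proof -
  obtain B where B: "B \<ge> 0" "\<And>x. \<bar>\<phi> x\<bar> \<le> B" "\<And>x. norm (G x) \<le> B"
    using compact_support_bounded[OF assms] by metis
  obtain R where R: "\<And>x. x \<in> closure {x. \<phi> x \<noteq> 0} \<Longrightarrow> norm x \<le> R"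
    using compact_imp_bounded[OF supp] by (auto simp: bounded_iff)
  have R': "\<phi> x \<noteq> 0 \<Longrightarrow> norm x \<le> R" for x
    using R[of x] closure_subset[of "{x. \<phi> x \<noteq> 0}"] by auto
  have contG: "continuous_on UNIV G" and cont: "continuous_on UNIV \<phi>"
    and der: "\<And>x. (\<phi> has_derivative (\<lambda>h. h \<bullet> G x)) (at x)"
    using C1 C1_with_gradient_continuous[OF C1] by (auto simp: C1_with_gradient_def gderiv_def)
  have [measurable]: "\<phi> \<in> borel_measurable borel" "G \<in> borel_measurable borel"
    using cont contG by (auto intro: borel_measurable_continuous_onI)
  \<comment> \<open>A bound of the gradient is a Lipschitz constant, which dominates all difference quotients.\<close>
  have lip: "\<bar>\<phi> y - \<phi> x\<bar> \<le> B * norm (y - x)" for x y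
  proof -
    have "norm (\<phi> y - \<phi> x) \<le> B * norm (y - x)"
    proof (rule differentiable_bound[where S=UNIV and f'="\<lambda>x h. h \<bullet> G x"])
      show "onorm (\<lambda>h. h \<bullet> G z) \<le> B" for z
      proof (rule onorm_le)
        show "norm (h \<bullet> G z) \<le> B * norm h" for h
          using Cauchy_Schwarz_ineq2[of h "G z"] mult_right_mono[OF B(3)[of z], of "norm h"]
          by (simp add: mult.commute)
      qed
    qed (use der in auto)
    then show ?thesis by simp
  qed
  have int_phi: "integrable lborel \<phi>"
  proof (rule integrableI_bounded_set[where A="cball 0 R" and B=B])
    show "emeasure lborel (cball 0 R :: 'a set) < \<infinity>" by (rule emeasure_lborel_cball_finite)
    show "AE x in lborel. x \<in> cball 0 R \<longrightarrow> norm (\<phi> x) \<le> B" using B(2) by simp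
    show "AE x in lborel. x \<notin> cball 0 R \<longrightarrow> \<phi> x = 0" using R' by (intro AE_I2) force
  qed auto
  define t where "t n = inverse (real (Suc n))" for n
  have t: "0 < t n" "t n \<le> 1" for n by (auto simp: t_def field_simps)
  have t0: "t \<longlonglongrightarrow> 0" unfolding t_def by (rule LIMSEQ_inverse_real_of_nat)
  define f where "f n x = (\<phi> (t n *\<^sub>R e + x) - \<phi> x) / t n" for n x
  have shift: "integrable lborel (\<lambda>x. \<phi> (v + x))" "(LINT x|lborel. \<phi> (v + x)) = (LINT x|lborel. \<phi> x)" for v
  proof -
    have "integrable (distr lborel borel ((+) v)) \<phi>" by (simp add: lborel_distr_plus int_phi)
    then show "integrable lborel (\<lambda>x. \<phi> (v + x))" by (subst (asm) integrable_distr_eq) auto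
    have "(LINT x|lborel. \<phi> x) = (LINT x|distr lborel borel ((+) v). \<phi> x)" by (simp add: lborel_distr_plus)
    also have "\<dots> = (LINT x|lborel. \<phi> (v + x))" by (subst integral_distr) auto
    finally show "(LINT x|lborel. \<phi> (v + x)) = (LINT x|lborel. \<phi> x)" by simp
  qed
  have f0: "(LINT x|lborel. f n x) = 0" for n
    unfolding f_def using shift int_phi by simp
  have "(\<lambda>n. LINT x|lborel. f n x) \<longlonglongrightarrow> (LINT x|lborel. G x \<bullet> e)"
  proof (rule integral_dominated_convergence[where w="\<lambda>x. B * norm e * indicator (cball 0 (R + norm e)) x"])
    show "integrable lborel (\<lambda>x. B * norm e * indicator (cball (0::'a) (R + norm e)) x :: real)"
      by (intro integrable_mult_right integrable_real_indicator) (use emeasure_lborel_cball_finite[of 0 "R + norm e"] in auto)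
    show "AE x in lborel. (\<lambda>n. f n x) \<longlonglongrightarrow> G x \<bullet> e"
    proof (rule AE_I2)
      fix x
      have "((\<lambda>s. s *\<^sub>R e + x) has_derivative (\<lambda>s. s *\<^sub>R e)) (at 0)"
        by (auto intro!: derivative_eq_intros)
      from has_derivative_compose[OF this der]
      have "((\<lambda>s. \<phi> (s *\<^sub>R e + x)) has_real_derivative (G x \<bullet> e)) (at 0)"
        by (simp add: has_field_derivative_def inner_commute mult_commute_abs)
      then have lim: "((\<lambda>h. (\<phi> (h *\<^sub>R e + x) - \<phi> x) / h) \<longlongrightarrow> G x \<bullet> e) (at 0)"
        by (simp add: DERIV_def)
      have "filterlim t (at 0) sequentially"
        unfolding filterlim_at using t0 t(1) by (simp add: order_less_imp_not_eq2)
      from filterlim_compose[OF lim this] show "(\<lambda>n. f n x) \<longlonglongrightarrow> G x \<bullet> e"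
        unfolding f_def .
    qed
    show "AE x in lborel. norm (f n x) \<le> B * norm e * indicator (cball 0 (R + norm e)) x" for n
    proof (rule AE_I2)
      fix x
      have "\<bar>\<phi> (t n *\<^sub>R e + x) - \<phi> x\<bar> \<le> t n * (B * norm e)"
        using lip[of "t n *\<^sub>R e + x" x] t[of n] by (simp add: algebra_simps)
      then have 1: "norm (f n x) \<le> B * norm e" using t[of n] by (simp add: f_def field_simps)
      have "f n x = 0" if "x \<notin> cball 0 (R + norm e)"
      proof -
        have n: "norm x > R + norm e" using that by simp
        have "norm (t n *\<^sub>R e) \<le> norm e" using t[of n] by (simp add: mult_left_le_one_le)
        moreover have "norm x \<le> norm (t n *\<^sub>R e + x) + norm (t n *\<^sub>R e)"
          using norm_triangle_ineq4[of "t n *\<^sub>R e + x" "t n *\<^sub>R e"] by simp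
        ultimately have "norm (t n *\<^sub>R e + x) > R" "norm x > R"
          using n norm_ge_zero[of e] by linarith+
        then have "\<phi> (t n *\<^sub>R e + x) = 0" "\<phi> x = 0" using R' by force+
        then show ?thesis by (simp add: f_def)
      qed
      then show "norm (f n x) \<le> B * norm e * indicator (cball 0 (R + norm e)) x"
        using 1 by (auto simp: indicator_def)
    qed
  qed (auto simp: f_def)
  then show ?thesis using f0 by (simp add: LIMSEQ_const_iff)
qed

section \<open>Bump functions of boxes and uniqueness of weak gradients\<close>

lemma C1_with_gradient_prod:
  fixes f :: "'i \<Rightarrow> 'a::euclidean_space \<Rightarrow> real"
  assumes "finite I" "\<And>i. i \<in> I \<Longrightarrow> C1_with_gradient (f i) (F i)"
  shows "\<exists>G. C1_with_gradient (\<lambda>x. \<Prod>i\<in>I. f i x) G"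
  using assms
proof (induction I rule: finite_induct)
  case empty
  have "C1_with_gradient (\<lambda>x::'a. 1) (\<lambda>x. 0)"
    unfolding C1_with_gradient_def by (intro conjI allI GDERIV_const continuous_on_const)
  then show ?case unfolding prod.empty by (intro exI)
next
  case (insert i I)
  have G: "C1_with_gradient (f i) (F i)" by (rule insert.prems) simp
  have "\<exists>H. C1_with_gradient (\<lambda>x. \<Prod>i\<in>I. f i x) H"
    by (rule insert.IH) (rule insert.prems, simp)
  then obtain H where H: "C1_with_gradient (\<lambda>x. \<Prod>i\<in>I. f i x) H" by (rule exE)
  have eq: "(\<lambda>x. \<Prod>j\<in>insert i I. f j x) = (\<lambda>x. f i x * (\<Prod>j\<in>I. f j x))"
    using insert.hyps by simp
  show ?case unfolding eq by (rule exI) (rule C1_with_gradient_mult[OF G H])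
qed

text \<open>The square makes the positive part differentiable at the kink.\<close>

lemma positive_part_square_derivative:
  "((\<lambda>t::real. (max 0 t)\<^sup>2) has_real_derivative 2 * max 0 t) (at t)"
proof -
  consider "t < 0" | "t = 0" | "t > 0" by linarith
  then show ?thesis
  proof cases
    case 1
    have "((\<lambda>t::real. 0) has_real_derivative 2 * max 0 t) (at t)" using 1 by simp
    then show ?thesis
      by (rule has_field_derivative_transform_within_open[where S="{..<0}"]) (use 1 in auto)
  next
    case 2
    have "((\<lambda>h::real. (max 0 h)\<^sup>2 / h) \<longlongrightarrow> 0) (at 0)"
    proof (rule Lim_null_comparison[where g="\<lambda>h. \<bar>h\<bar>"])
      show "\<forall>\<^sub>F h in at 0. norm ((max 0 h)\<^sup>2 / h) \<le> \<bar>h::real\<bar>"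
        by (rule always_eventually) (auto simp: max_def power2_eq_square divide_simps)
      show "((\<lambda>h::real. \<bar>h\<bar>) \<longlongrightarrow> 0) (at 0)"
        by (rule tendsto_rabs_zero[OF tendsto_ident_at])
    qed
    then show ?thesis using 2 by (simp add: DERIV_def)
  next
    case 3
    have "((\<lambda>t::real. t\<^sup>2) has_real_derivative 2 * max 0 t) (at t)"
      using 3 by (auto intro!: derivative_eq_intros)
    then show ?thesis
      by (rule has_field_derivative_transform_within_open[where S="{0<..}"]) (use 3 in auto)
  qed
qed

lemma C1_positive_part_square:
  fixes v :: "'a::euclidean_space"
  shows "\<exists>G. C1_with_gradient (\<lambda>x. (max 0 (x \<bullet> v - c))\<^sup>2) G"
proof -
  have der: "((\<lambda>x. x \<bullet> v - c) has_derivative (\<lambda>h. h \<bullet> v)) (at x)" for x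
    using has_derivative_diff[OF bounded_linear_imp_has_derivative[OF bounded_linear_inner_left[of v]]
        has_derivative_const[of c]] by simp
  have C1: "C1_with_gradient (\<lambda>x. x \<bullet> v - c) (\<lambda>x. v)"
    unfolding C1_with_gradient_def gderiv_def using der continuous_on_const[of UNIV v] by blast
  have cont: "continuous_on S (\<lambda>t::real. 2 * max 0 t)" for S
    by (rule continuous_on_mult_left, rule continuous_on_max) (rule continuous_on_const, rule continuous_on_id)
  show ?thesis
    by (rule exI, rule C1_with_gradient_compose[OF C1, where s="\<lambda>t. (max 0 t)\<^sup>2"])
      (rule positive_part_square_derivative, rule cont)
qed

text \<open>One takes the product over the coordinates of \<open>((x\<^sub>i - a\<^sub>i)\<^sup>+)\<^sup>2 ((b\<^sub>i - x\<^sub>i)\<^sup>+)\<^sup>2\<close>, which is positive exactly when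
every factor is.\<close>

lemma exists_C1_positive_on_box:
  fixes a b :: "'a::euclidean_space"
  obtains P G where "C1_with_gradient P G" "\<And>x. P x \<ge> 0" "{x. P x \<noteq> 0} = box a b"
proof -
  define f where "f i x = (max 0 (x \<bullet> i - a \<bullet> i))\<^sup>2 * (max 0 (x \<bullet> (- i) - (- (b \<bullet> i))))\<^sup>2" for i x :: 'a
  have "\<exists>G. C1_with_gradient (f i) G" for i
  proof -
    obtain G H where G: "C1_with_gradient (\<lambda>x. (max 0 (x \<bullet> i - a \<bullet> i))\<^sup>2) G"
      and H: "C1_with_gradient (\<lambda>x. (max 0 (x \<bullet> (- i) - (- (b \<bullet> i))))\<^sup>2) H"
      using C1_positive_part_square[of i "a \<bullet> i"] C1_positive_part_square[of "- i" "- (b \<bullet> i)"] by blast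
    show ?thesis unfolding f_def by (rule exI) (rule C1_with_gradient_mult[OF G H])
  qed
  then obtain F where "\<And>i. C1_with_gradient (f i) (F i)" by metis
  then obtain G where "C1_with_gradient (\<lambda>x. \<Prod>i\<in>Basis. f i x) G"
    using C1_with_gradient_prod[of Basis f F] by auto
  moreover have "(\<Prod>i\<in>Basis. f i x) \<ge> 0" for x
    by (intro prod_nonneg) (auto simp: f_def)
  moreover have "f i x \<noteq> 0 \<longleftrightarrow> a \<bullet> i < x \<bullet> i \<and> x \<bullet> i < b \<bullet> i" for i x
    by (auto simp: f_def max_def)
  then have "{x. (\<Prod>i\<in>Basis. f i x) \<noteq> 0} = box a b"
    by (auto simp: box_def)
  ultimately show ?thesis using that by blast
qed

text \<open>If \<open>P\<close> is positive exactly on the open box, then the test functions \<open>n P / (1 + n P)\<close> take values in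
\<open>[0, 1]\<close> and increase to the indicator of the box.\<close>

lemma set_integral_box_eq_0:
  fixes h :: "'a::euclidean_space \<Rightarrow> real"
  assumes \<Omega>: "open \<Omega>" and loc: "locally_integrable_on h \<Omega>" and sub: "cbox a b \<subseteq> \<Omega>"
    and test: "\<And>\<phi>. \<phi> \<in> C1_0 \<Omega> \<Longrightarrow> (LINT x|lebesgue_on \<Omega>. \<phi> x * h x) = 0"
  shows "(LINT x:box a b|lebesgue. h x) = 0"
proof -
  obtain P G where P: "C1_with_gradient P G" "\<And>x. P x \<ge> 0" "{x. P x \<noteq> 0} = box a b"
    using exists_C1_positive_on_box[of a b] by metis
  have P0: "x \<notin> box a b \<Longrightarrow> P x = 0" "x \<in> box a b \<Longrightarrow> P x > 0" for x
    using P(3) P(2)[of x] by (auto simp: set_eq_iff less_le)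
  define k where "k x = indicator (cbox a b) x * h x" for x
  have "integrable (lebesgue_on (cbox a b)) h"
    using loc sub by (auto simp: locally_integrable_on_def)
  then have k: "integrable lebesgue k"
    unfolding k_def by (subst (asm) integrable_restrict_space) auto
  have [measurable]: "P \<in> borel_measurable lebesgue"
    by (intro borel_measurable_if_I measurable_completion)
      (use C1_with_gradient_continuous[OF P(1)] in \<open>simp add: borel_measurable_continuous_onI\<close>)
  define \<phi> where "\<phi> n x = real n * P x / (1 + real n * P x)" for n x
  have pos: "1 + real n * P x > 0" for n x
    using P(2)[of x] by (intro add_pos_nonneg) auto
  have C1: "\<phi> n \<in> C1_0 \<Omega>" for n
  proof -
    have "((\<lambda>t. real n * t / (1 + real n * t)) has_real_derivative real n / (1 + real n * P x)^2) (at (P x))" for x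
      using pos[of n x] by (auto intro!: derivative_eq_intros simp: power2_eq_square divide_simps algebra_simps)
    moreover have "continuous_on (range P) (\<lambda>t. real n / (1 + real n * t)^2)"
    proof (intro continuous_intros ballI)
      fix t assume "t \<in> range P"
      then obtain x where "t = P x" by auto
      then show "(1 + real n * t)^2 \<noteq> 0" using pos[of n x] by simp
    qed
    ultimately have "C1_with_gradient (\<phi> n) (\<lambda>x. (real n / (1 + real n * P x)^2) *\<^sub>R G x)"
      unfolding \<phi>_def by (intro C1_with_gradient_compose[OF P(1),
            where s="\<lambda>t. real n * t / (1 + real n * t)" and s'="\<lambda>t. real n / (1 + real n * t)^2"])
    moreover have "closure {x. \<phi> n x \<noteq> 0} \<subseteq> cbox a b"
      by (rule closure_minimal) (use P0 box_subset_cbox in \<open>force simp: \<phi>_def\<close>)+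
    moreover from this have "compact (closure {x. \<phi> n x \<noteq> 0})"
      by (meson bounded_cbox bounded_subset closed_closure compact_eq_bounded_closed)
    ultimately show ?thesis using sub by (auto simp: C1_0_def compactly_supported_in_def)
  qed
  have "(LINT x|lebesgue. \<phi> n x * k x) = 0" for n
  proof -
    have "(LINT x|lebesgue_on \<Omega>. \<phi> n x * h x) = (LINT x|lebesgue. indicator \<Omega> x *\<^sub>R (\<phi> n x * h x))"
      using \<Omega> by (subst integral_restrict_space) auto
    also have "\<dots> = (LINT x|lebesgue. \<phi> n x * k x)"
    proof (rule Bochner_Integration.integral_cong)
      fix x
      have "x \<notin> cbox a b \<Longrightarrow> \<phi> n x = 0" using P0(1)[of x] box_subset_cbox[of a b] by (auto simp: \<phi>_def)
      then show "indicator \<Omega> x *\<^sub>R (\<phi> n x * h x) = \<phi> n x * k x"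
        using sub by (auto simp: k_def indicator_def)
    qed simp
    finally show ?thesis using test[OF C1] by simp
  qed
  moreover have "(\<lambda>n. LINT x|lebesgue. \<phi> n x * k x) \<longlonglongrightarrow> (LINT x|lebesgue. indicator (box a b) x *\<^sub>R h x)"
  proof (rule integral_dominated_convergence[where w="\<lambda>x. \<bar>k x\<bar>"])
    have [simp, measurable]: "k \<in> borel_measurable lebesgue" by (rule borel_measurable_integrable[OF k])
    have "(\<lambda>x. indicator (box a b) x *\<^sub>R h x) = (\<lambda>x. indicator (box a b) x *\<^sub>R k x)"
      using box_subset_cbox[of a b] by (auto simp: k_def indicator_def fun_eq_iff)
    moreover have "(\<lambda>x. indicator (box a b) x *\<^sub>R k x) \<in> borel_measurable lebesgue"
      by (intro borel_measurable_scaleR borel_measurable_indicator) auto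
    ultimately show "(\<lambda>x. indicator (box a b) x *\<^sub>R h x) \<in> borel_measurable lebesgue"
      by metis
    show "(\<lambda>x. \<phi> n x * k x) \<in> borel_measurable lebesgue" for n unfolding \<phi>_def by measurable
    show "AE x in lebesgue. (\<lambda>n. \<phi> n x * k x) \<longlonglongrightarrow> indicator (box a b) x *\<^sub>R h x"
    proof (rule AE_I2)
      fix x
      show "(\<lambda>n. \<phi> n x * k x) \<longlonglongrightarrow> indicator (box a b) x *\<^sub>R h x"
      proof (cases "x \<in> box a b")
        case True
        have "(\<lambda>n. 1 - 1 / (1 + real n * P x)) \<longlonglongrightarrow> 1 - 0"
          using P0(2)[OF True]
          by (intro tendsto_intros tendsto_divide_0[OF tendsto_const] filterlim_at_top_imp_at_infinity
              filterlim_tendsto_add_at_top[OF tendsto_const]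
              filterlim_at_top_mult_tendsto_pos[OF tendsto_const _ filterlim_real_sequentially])
        moreover have "1 - 1 / (1 + real n * P x) = \<phi> n x" for n
          using pos[of n x] by (simp add: \<phi>_def divide_simps)
        ultimately have "(\<lambda>n. \<phi> n x) \<longlonglongrightarrow> 1" by simp
        from tendsto_mult_right[OF this, of "k x"] show ?thesis
          using True box_subset_cbox[of a b] by (auto simp: k_def)
      next
        case False then show ?thesis using P0(1) by (simp add: \<phi>_def)
      qed
    qed
    show "AE x in lebesgue. norm (\<phi> n x * k x) \<le> \<bar>k x\<bar>" for n
    proof (rule AE_I2)
      fix x
      have "\<bar>\<phi> n x\<bar> \<le> 1" using pos[of n x] P(2)[of x] by (simp add: \<phi>_def divide_simps)
      then show "norm (\<phi> n x * k x) \<le> \<bar>k x\<bar>" by (simp add: abs_mult mult_left_le_one_le)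
    qed
  qed (use k in auto)
  ultimately show ?thesis by (simp add: LIMSEQ_const_iff set_lebesgue_integral_def)
qed

text \<open>The fundamental lemma of the calculus of variations. Inside a box with closure in \<open>\<Omega>\<close>, the sets over
which \<open>h\<close> integrates to zero form a Dynkin system containing all boxes, so they include every Borel
set, in particular those where \<open>h\<close> is positive or negative. Countably many rational boxes cover \<open>\<Omega>\<close>.\<close>

lemma weakly_zero_imp_AE_zero_real:
  fixes h :: "'a::euclidean_space \<Rightarrow> real"
  assumes \<Omega>: "open \<Omega>" and loc: "locally_integrable_on h \<Omega>"
    and test: "\<And>\<phi>. \<phi> \<in> C1_0 \<Omega> \<Longrightarrow> (LINT x|lebesgue_on \<Omega>. \<phi> x * h x) = 0"
  shows "AE x in lebesgue_on \<Omega>. h x = 0"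
proof -
  have on_box: "AE x in lebesgue. x \<in> box c d \<longrightarrow> h x = 0" if sub: "cbox c d \<subseteq> \<Omega>" for c d
  proof -
    define k where "k x = indicator (box c d) x * h x" for x
    have "integrable (lebesgue_on (cbox c d)) h"
      using loc sub by (auto simp: locally_integrable_on_def)
    then have k0: "set_integrable lebesgue (cbox c d) h"
      by (subst (asm) integrable_restrict_space) (auto simp: set_integrable_def)
    have "set_integrable lebesgue (box c d) h"
      by (rule set_integrable_subset[OF k0]) (auto simp: box_subset_cbox)
    then have k: "integrable lebesgue k"
      by (simp add: k_def[abs_def] set_integrable_def)
    have k_set: "set_integrable lebesgue A k" if "A \<in> sets borel" for A
      using integrable_mult_indicator[OF _ k, of A] that by (simp add: set_integrable_def)
    have whole: "(LINT x:UNIV|lebesgue. k x) = 0"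
      using set_integral_box_eq_0[OF assms(1,2) sub test]
      by (simp add: set_lebesgue_integral_def k_def)
    have set0: "(LINT x:A|lebesgue. k x) = 0" if A: "A \<in> sets borel" for A
    proof -
      have "Int_stable (range (\<lambda>(a, b). box a b :: 'a set))"
        by (auto simp: Int_stable_def box_Int_box)
      moreover have "(range (\<lambda>(a, b). box a b)) \<subseteq> Pow (UNIV :: 'a set)"
        by auto
      moreover have "A \<in> sigma_sets UNIV (range (\<lambda>(a, b). box a b))"
        using A unfolding borel_eq_box by simp
      ultimately show ?thesis
      proof (induction rule: sigma_sets_induct_disjoint)
        case (basic A)
        then obtain a b where A: "A = box a b" by auto
        obtain a' b' where ab: "box a b \<inter> box c d = box a' b'" by (rule that) (rule box_Int_box)
        have "(LINT x:box a' b'|lebesgue. h x) = 0"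
        proof (cases "box a' b' = {}")
          case False
          then have "cbox a' b' = closure (box a' b')" by simp
          also have "\<dots> \<subseteq> cbox c d"
            by (rule closure_minimal) (use ab box_subset_cbox[of c d] in auto)
          finally show ?thesis using set_integral_box_eq_0[OF assms(1,2) _ test] sub by blast
        qed (simp add: set_lebesgue_integral_def)
        moreover have "(LINT x:A|lebesgue. k x) = (LINT x:box a' b'|lebesgue. h x)"
          unfolding set_lebesgue_integral_def k_def ab[symmetric] A
          by (rule Bochner_Integration.integral_cong) (auto simp: indicator_def)
        ultimately show ?case by simp
      next
        case empty then show ?case by (simp add: set_lebesgue_integral_def)
      next
        case (compl A)
        then have A: "A \<in> sets borel" by (simp add: borel_eq_box)
        have "(LINT x:UNIV|lebesgue. k x) = (LINT x:A|lebesgue. k x) + (LINT x:UNIV - A|lebesgue. k x)"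
          using A by (subst set_integral_Un[symmetric]) (auto intro!: k_set)
        then show ?case using compl whole by simp
      next
        case (union F)
        then have F: "\<And>i. F i \<in> sets borel" by (simp add: borel_eq_box subset_eq)
        have "(LINT x:(\<Union>i. F i)|lebesgue. k x) = (\<Sum>i. LINT x:F i|lebesgue. k x)"
        proof (rule lebesgue_integral_countable_add)
          show "F i \<inter> F j = {}" if "i \<noteq> j" for i j
            using union(1) that by (auto simp: disjoint_family_on_def)
          have "(\<Union>i. F i) \<in> sets borel" using F by auto
          then show "set_integrable lebesgue (\<Union>i. F i) k" by (rule k_set)
        qed (use F in auto)
        then show ?case using union by simp
      qed
    qed
    \<comment> \<open>The sign sets of a Lebesgue measurable function need not be Borel sets; those of a Borel version are.\<close>
    obtain k' where k'm[measurable]: "k' \<in> borel_measurable lborel" and k': "AE x in lborel. k x = k' x"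
      using completion_ex_borel_measurable_real[of k lborel] k by auto
    have kk': "AE x in lebesgue. k x = k' x" using k' by (rule AE_completion)
    have k'l: "k' \<in> borel_measurable lebesgue" by (rule measurable_completion) simp
    have k'i: "integrable lebesgue k'"
      using integrable_cong_AE[OF _ k'l kk'] k by auto
    have k'0: "(LINT x:A|lebesgue. k' x) = 0" if "A \<in> sets borel" for A
    proof -
      have "(LINT x:A|lebesgue. k' x) = (LINT x:A|lebesgue. k x)"
        unfolding set_lebesgue_integral_def
        using kk' that by (intro integral_cong_AE borel_measurable_scaleR borel_measurable_indicator k'l
            borel_measurable_integrable[OF k]) auto
      then show ?thesis using set0[OF that] by simp
    qed
    have "(LINT x|lebesgue. \<bar>k' x\<bar>) = (LINT x|lebesgue. indicator {x. k' x > 0} x *\<^sub>R k' x - indicator {x. k' x < 0} x *\<^sub>R k' x)"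
      by (rule Bochner_Integration.integral_cong) (auto simp: indicator_def)
    also have "\<dots> = 0"
    proof (subst Bochner_Integration.integral_diff)
      have [measurable]: "{x. k' x > 0} \<in> sets borel" "{x. k' x < 0} \<in> sets borel"
        using k'm by auto
      show "integrable lebesgue (\<lambda>x. indicator {x. k' x > 0} x *\<^sub>R k' x)" "integrable lebesgue (\<lambda>x. indicator {x. k' x < 0} x *\<^sub>R k' x)"
        by (rule integrable_mult_indicator[OF _ k'i], simp)+
      show "(LINT x|lebesgue. indicator {x. k' x > 0} x *\<^sub>R k' x) - (LINT x|lebesgue. indicator {x. k' x < 0} x *\<^sub>R k' x) = 0"
        using k'0 by (simp add: set_lebesgue_integral_def)
    qed
    finally have "AE x in lebesgue. k' x = 0"
      using k'i by (subst (asm) integral_nonneg_eq_0_iff_AE) auto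
    with kk' show ?thesis by eventually_elim (auto simp: k_def)
  qed
  define a' where "a' = (\<lambda>f :: 'a \<Rightarrow> real \<times> real. (\<Sum>(i::'a)\<in>Basis. fst (f i) *\<^sub>R i))"
  define b' where "b' = (\<lambda>f :: 'a \<Rightarrow> real \<times> real. (\<Sum>(i::'a)\<in>Basis. snd (f i) *\<^sub>R i))"
  define I where "I = {f\<in>Basis \<rightarrow>\<^sub>E \<rat> \<times> \<rat>. cbox (a' f) (b' f) \<subseteq> \<Omega>}"
  have "countable I"
    unfolding I_def by (rule countable_subset[of _ "Basis \<rightarrow>\<^sub>E \<rat> \<times> \<rat>"])
      (auto intro!: countable_PiE countable_rat)
  then have "AE x in lebesgue. \<forall>f\<in>I. x \<in> box (a' f) (b' f) \<longrightarrow> h x = 0"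
    by (subst AE_ball_countable) (auto simp: I_def intro!: on_box)
  moreover have "\<exists>f\<in>I. x \<in> box (a' f) (b' f)" if x: "x \<in> \<Omega>" for x
  proof -
    obtain e where e: "e > 0" "ball x e \<subseteq> \<Omega>" using \<Omega> x openE by blast
    \<comment> \<open>The smaller radius leaves room for the closure of the rational box.\<close>
    obtain e2 where e2: "e2 > 0" "e2 < e" using e(1) dense by blast
    obtain a b where ab: "\<forall>i\<in>Basis. a \<bullet> i \<in> \<rat> \<and> b \<bullet> i \<in> \<rat>" "x \<in> box a b" "box a b \<subseteq> ball x e2"
      using rational_boxes[OF e2(1), of x] by metis
    have "cbox a b = closure (box a b)" using ab(2) by (metis closure_box empty_iff)
    also have "\<dots> \<subseteq> cball x e2" by (rule closure_minimal) (use ab(3) in auto)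
    finally have "cbox a b \<subseteq> \<Omega>" using e2 e(2) by force
    define f where "f = (\<lambda>i\<in>Basis. (a \<bullet> i, b \<bullet> i))"
    have "a' f = a" "b' f = b"
      by (auto simp: a'_def b'_def f_def euclidean_representation)
    then show ?thesis
      using ab \<open>cbox a b \<subseteq> \<Omega>\<close> by (intro bexI[of _ f]) (auto simp: I_def f_def)
  qed
  ultimately have "AE x in lebesgue. x \<in> \<Omega> \<longrightarrow> h x = 0"
    by (auto elim!: eventually_mono)
  then show ?thesis using \<Omega> by (subst AE_restrict_space_iff) auto
qed

lemma test_function_integrable:
  fixes h :: "'a::euclidean_space \<Rightarrow> 'c::euclidean_space" and \<psi> :: "'a \<Rightarrow> real"
  assumes \<Omega>: "open \<Omega>" and loc: "locally_integrable_on h \<Omega>"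
    and K: "compact K" "K \<subseteq> \<Omega>" "\<And>x. x \<notin> K \<Longrightarrow> \<psi> x = 0"
    and \<psi>: "continuous_on UNIV \<psi>" "\<And>x. \<bar>\<psi> x\<bar> \<le> B"
  shows "integrable (lebesgue_on \<Omega>) (\<lambda>x. \<psi> x *\<^sub>R h x)"
proof -
  have "integrable (lebesgue_on K) h"
    using loc K by (auto simp: locally_integrable_on_def)
  then have hK: "integrable lebesgue (\<lambda>x. indicator K x *\<^sub>R h x)"
    using compact_imp_closed[OF K(1)] by (subst (asm) integrable_restrict_space) auto
  have \<psi>m: "\<psi> \<in> borel_measurable lebesgue"
    by (rule measurable_completion) (simp add: borel_measurable_continuous_onI[OF \<psi>(1)])
  have "integrable lebesgue (\<lambda>x. \<psi> x *\<^sub>R (indicator K x *\<^sub>R h x))"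
  proof (rule Bochner_Integration.integrable_bound[where f="\<lambda>x. B *\<^sub>R (indicator K x *\<^sub>R h x)"])
    have "norm (\<psi> x *\<^sub>R (indicator K x *\<^sub>R h x)) \<le> norm (B *\<^sub>R (indicator K x *\<^sub>R h x))" for x
      unfolding norm_scaleR using \<psi>(2)[of x] by (intro mult_right_mono) auto
    then show "AE x in lebesgue. norm (\<psi> x *\<^sub>R (indicator K x *\<^sub>R h x)) \<le> norm (B *\<^sub>R (indicator K x *\<^sub>R h x))"
      by simp
    show "integrable lebesgue (\<lambda>x. B *\<^sub>R (indicator K x *\<^sub>R h x))"
      using hK by (rule integrable_scaleR_right)
    show "(\<lambda>x. \<psi> x *\<^sub>R (indicator K x *\<^sub>R h x)) \<in> borel_measurable lebesgue"
      using \<psi>m borel_measurable_integrable[OF hK] by (rule borel_measurable_scaleR)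
  qed
  also have "(\<lambda>x. \<psi> x *\<^sub>R (indicator K x *\<^sub>R h x)) = (\<lambda>x. indicator \<Omega> x *\<^sub>R (\<psi> x *\<^sub>R h x))"
    using K by (auto simp: indicator_def fun_eq_iff)
  finally show ?thesis using \<Omega> by (subst integrable_restrict_space) auto
qed

lemma is_weak_gradient_unique:
  fixes u :: "'a::euclidean_space \<Rightarrow> real"
  assumes \<Omega>: "open \<Omega>" and g: "is_weak_gradient \<Omega> u g" and g': "is_weak_gradient \<Omega> u g'"
  shows "AE x in lebesgue_on \<Omega>. g x = g' x"
proof -
  have "AE x in lebesgue_on \<Omega>. (g x - g' x) \<bullet> i = 0" for i
  proof (rule weakly_zero_imp_AE_zero_real[OF \<Omega>])
    have lg: "locally_integrable_on g \<Omega>" "locally_integrable_on g' \<Omega>"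
      using g g' by (auto simp: is_weak_gradient_def)
    then show "locally_integrable_on (\<lambda>x. (g x - g' x) \<bullet> i) \<Omega>"
      by (auto simp: locally_integrable_on_def)
    fix \<phi> assume "\<phi> \<in> C1_0 \<Omega>"
    then obtain G where G: "C1_with_gradient \<phi> G" and supp: "compactly_supported_in \<Omega> \<phi>"
      by (auto simp: C1_0_def)
    obtain B where B: "\<And>x. \<bar>\<phi> x\<bar> \<le> B"
      using compact_support_bounded[OF G] supp unfolding compactly_supported_in_def by metis
    have out: "\<phi> x = 0" if "x \<notin> closure {x. \<phi> x \<noteq> 0}" for x
      using that closure_subset[of "{x. \<phi> x \<noteq> 0}"] by blast
    have K: "compact (closure {x. \<phi> x \<noteq> 0})" "closure {x. \<phi> x \<noteq> 0} \<subseteq> \<Omega>"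
      using supp by (simp_all only: compactly_supported_in_def)
    note intI = test_function_integrable[OF \<Omega> _ K out C1_with_gradient_continuous[OF G] B]
    have int1: "integrable (lebesgue_on \<Omega>) (\<lambda>x. \<phi> x *\<^sub>R g x)"
      by (rule intI[OF lg(1)])
    have int2: "integrable (lebesgue_on \<Omega>) (\<lambda>x. \<phi> x *\<^sub>R g' x)"
      by (rule intI[OF lg(2)])
    have "(LINT x|lebesgue_on \<Omega>. \<phi> x *\<^sub>R g x) = (LINT x|lebesgue_on \<Omega>. \<phi> x *\<^sub>R g' x)"
    proof -
      have "(LINT x|lebesgue_on \<Omega>. u x *\<^sub>R G x) = - (LINT x|lebesgue_on \<Omega>. \<phi> x *\<^sub>R g x)"
        "(LINT x|lebesgue_on \<Omega>. u x *\<^sub>R G x) = - (LINT x|lebesgue_on \<Omega>. \<phi> x *\<^sub>R g' x)"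
        using g g' G supp unfolding is_weak_gradient_def by blast+
      then show ?thesis by simp
    qed
    then have "(LINT x|lebesgue_on \<Omega>. \<phi> x *\<^sub>R g x - \<phi> x *\<^sub>R g' x) = 0"
      using Bochner_Integration.integral_diff[OF int1 int2] by simp
    moreover have "(LINT x|lebesgue_on \<Omega>. (\<phi> x *\<^sub>R g x - \<phi> x *\<^sub>R g' x) \<bullet> i)
        = (LINT x|lebesgue_on \<Omega>. \<phi> x *\<^sub>R g x - \<phi> x *\<^sub>R g' x) \<bullet> i"
      by (rule integral_inner_left) (rule Bochner_Integration.integrable_diff[OF int1 int2])
    ultimately have "(LINT x|lebesgue_on \<Omega>. (\<phi> x *\<^sub>R g x - \<phi> x *\<^sub>R g' x) \<bullet> i) = 0"
      by simp
    moreover have "(\<lambda>x. \<phi> x * ((g x - g' x) \<bullet> i)) = (\<lambda>x. (\<phi> x *\<^sub>R g x - \<phi> x *\<^sub>R g' x) \<bullet> i)"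
      by (simp only: scaleR_diff_right[symmetric] inner_scaleR_left)
    ultimately show "(LINT x|lebesgue_on \<Omega>. \<phi> x * ((g x - g' x) \<bullet> i)) = 0"
      by (simp only:)
  qed
  then have "AE x in lebesgue_on \<Omega>. \<forall>i\<in>Basis. (g x - g' x) \<bullet> i = 0"
    by (subst AE_ball_countable) (auto intro: countable_finite)
  then show ?thesis
    by eventually_elim (metis euclidean_all_zero_iff right_minus_eq)
qed

section \<open>Powers and completeness of Lebesgue spaces\<close>

text \<open>A weighted Young inequality with simple rather than optimal constants: one compares \<open>t\<close> with \<open>\<epsilon> s\<close>. All
estimates of products of powers below rest on it.\<close>

lemma Young_powr:
  fixes s t :: real
  assumes "0 \<le> s" "0 \<le> t" "\<epsilon> > 0" "p \<ge> 1"
  shows "s powr (p - 1) * t \<le> \<epsilon> * s powr p + \<epsilon> powr (1 - p) * t powr p"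
proof (cases "t \<le> \<epsilon> * s")
  case True
  have "s powr (p - 1) * t \<le> s powr (p - 1) * (\<epsilon> * s)"
    using True by (intro mult_left_mono) auto
  also have "\<dots> = \<epsilon> * s powr p"
    using assms powr_mult_base[of s "p - 1"] by (simp add: algebra_simps)
  finally show ?thesis using assms by (simp add: add_increasing2)
next
  case False
  then have "\<epsilon> * s < t" by simp
  moreover have "0 \<le> \<epsilon> * s" using assms by simp
  ultimately have "t > 0" by linarith
  with \<open>\<epsilon> * s < t\<close> have s: "s \<le> t / \<epsilon>" "t > 0" using assms by (auto simp: field_simps)
  have "s powr (p - 1) * t \<le> (t / \<epsilon>) powr (p - 1) * t"
    using s assms by (intro mult_right_mono powr_mono2) auto
  also have "\<dots> = \<epsilon> powr (1 - p) * t powr p"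
    using assms s powr_mult_base[of t "p - 1"] powr_minus[of \<epsilon> "p - 1"]
    by (simp add: powr_divide field_simps)
  finally show ?thesis using assms by (simp add: add_increasing)
qed

text \<open>A quasi-triangle inequality for \<open>p\<close>-th powers. The factor \<open>2 powr p\<close> is harmless because only smallness and
finiteness of the integrals of \<open>p\<close>-th powers matter below.\<close>

lemma norm_add_powr_le:
  fixes a b :: "'a::real_normed_vector"
  assumes "p \<ge> 0"
  shows "norm (a + b) powr p \<le> 2 powr p * (norm a powr p + norm b powr p)"
proof -
  have "norm (a + b) \<le> 2 * max (norm a) (norm b)"
    using norm_triangle_ineq[of a b] by linarith
  then have "norm (a + b) powr p \<le> (2 * max (norm a) (norm b)) powr p"
    using assms by (intro powr_mono2) auto
  also have "\<dots> = 2 powr p * max (norm a) (norm b) powr p"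
    by (rule powr_mult) 
  also have "\<dots> \<le> 2 powr p * (norm a powr p + norm b powr p)"
    by (intro mult_left_mono) (auto simp: max_def)
  finally show ?thesis .
qed

lemma Lp_fun_measurable: "Lp_fun M p f \<Longrightarrow> f \<in> borel_measurable M"
  by (simp add: Lp_fun_def)

lemma Lp_fun_integrable_powr: "Lp_fun M p f \<Longrightarrow> integrable M (\<lambda>x. norm (f x) powr p)"
  by (simp add: Lp_fun_def)

lemma Lp_fun_scaleR:
  assumes "Lp_fun M p f" shows "Lp_fun M p (\<lambda>x. c *\<^sub>R f x)"
  using assms by (auto simp: Lp_fun_def powr_mult)

lemma Lp_fun_add:
  assumes "Lp_fun M p f" "Lp_fun M p g" "p \<ge> 0"
  shows "Lp_fun M p (\<lambda>x. f x + g x)"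
proof -
  have [measurable]: "f \<in> borel_measurable M" "g \<in> borel_measurable M"
    using assms by (auto simp: Lp_fun_def)
  have "integrable M (\<lambda>x. norm (f x + g x) powr p)"
  proof (rule Bochner_Integration.integrable_bound)
    show "integrable M (\<lambda>x. 2 powr p * (norm (f x) powr p + norm (g x) powr p))"
      using assms by (auto simp: Lp_fun_def)
    show "AE x in M. norm (norm (f x + g x) powr p) \<le> norm (2 powr p * (norm (f x) powr p + norm (g x) powr p))"
      using norm_add_powr_le[OF assms(3)] by (intro AE_I2) simp
  qed measurable
  then show ?thesis by (simp add: Lp_fun_def)
qed

lemma Lp_fun_diff:
  assumes "Lp_fun M p f" "Lp_fun M p g" "p \<ge> 0"
  shows "Lp_fun M p (\<lambda>x. f x - g x)"
  using Lp_fun_add[OF assms(1) Lp_fun_scaleR[OF assms(2), of "-1"] assms(3)] by simp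

lemma Lp_fun_cong_AE:
  assumes "Lp_fun M p f" "g \<in> borel_measurable M" "AE x in M. f x = g x"
  shows "Lp_fun M p g"
proof -
  have [measurable]: "f \<in> borel_measurable M" "g \<in> borel_measurable M"
    using assms by (auto simp: Lp_fun_def)
  have "integrable M (\<lambda>x. norm (f x) powr p) \<longleftrightarrow> integrable M (\<lambda>x. norm (g x) powr p)"
    by (rule integrable_cong_AE) (use assms(3) in auto)
  then show ?thesis using assms by (simp add: Lp_fun_def)
qed

lemma integral_powr_add_le:
  assumes "Lp_fun M p f" "Lp_fun M p g" "p \<ge> 0"
  shows "(LINT x|M. norm (f x + g x) powr p) \<le>
    2 powr p * ((LINT x|M. norm (f x) powr p) + (LINT x|M. norm (g x) powr p))"
proof -
  have "(LINT x|M. norm (f x + g x) powr p) \<le> (LINT x|M. 2 powr p * (norm (f x) powr p + norm (g x) powr p))"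
    using Lp_fun_add[OF assms] assms norm_add_powr_le[OF assms(3)]
    by (intro integral_mono) (auto simp: Lp_fun_def)
  also have "\<dots> = 2 powr p * ((LINT x|M. norm (f x) powr p) + (LINT x|M. norm (g x) powr p))"
    using assms by (simp add: Lp_fun_def)
  finally show ?thesis .
qed

lemma (in finite_measure) Lp_fun_integrable:
  assumes f: "Lp_fun M p f" and "p \<ge> 1"
  shows "integrable M f"
proof (rule Bochner_Integration.integrable_bound)
  show "integrable M (\<lambda>x. 1 + norm (f x) powr p)" using f by (auto simp: Lp_fun_def)
  show "AE x in M. norm (f x) \<le> norm (1 + norm (f x) powr p)"
    using Young_powr[of 1 "norm (f x)" 1 p for x] assms(2) by (intro AE_I2) simp
qed (use f in \<open>simp add: Lp_fun_def\<close>)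

text \<open>For given \<open>\<delta>\<close> the first summand is small on a finite measure space, and the second one becomes small
with the \<open>p\<close>-th power integral.\<close>

lemma (in finite_measure) L1_le_Lp:
  assumes f: "Lp_fun M p f" and "p \<ge> 1" "\<delta> > 0"
  shows "(LINT x|M. norm (f x)) \<le> \<delta> * measure M (space M) + \<delta> powr (1 - p) * (LINT x|M. norm (f x) powr p)"
proof -
  have "(LINT x|M. norm (f x)) \<le> (LINT x|M. \<delta> + \<delta> powr (1 - p) * norm (f x) powr p)"
    using f Lp_fun_integrable[OF f assms(2)] Young_powr[of 1 "norm (f x)" \<delta> p for x] assms
    by (intro integral_mono) (auto simp: Lp_fun_def)
  also have "\<dots> = \<delta> * measure M (space M) + \<delta> powr (1 - p) * (LINT x|M. norm (f x) powr p)"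
    using f by (subst Bochner_Integration.integral_add) (auto simp: Lp_fun_def)
  finally show ?thesis .
qed

lemma (in finite_measure) L1_tendsto_0_if_Lp:
  assumes f: "\<And>n. Lp_fun M p (f n)" and p: "p \<ge> 1"
    and lim: "(\<lambda>n. LINT x|M. norm (f n x) powr p) \<longlonglongrightarrow> 0"
  shows "(\<lambda>n. LINT x|M. norm (f n x)) \<longlonglongrightarrow> 0"
proof (rule LIMSEQ_I)
  fix e :: real assume "e > 0"
  \<comment> \<open>This makes the first summand of the bound by the \<open>p\<close>-th power at most \<open>e / 2\<close>; adding \<open>1\<close> covers the null measure.\<close>
  define \<delta> where "\<delta> = e / (2 * (measure M (space M) + 1))"
  have \<delta>: "\<delta> > 0" using \<open>e > 0\<close> by (auto simp: \<delta>_def intro!: divide_pos_pos add_nonneg_pos)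
  have d1: "\<delta> * measure M (space M) \<le> e / 2"
  proof -
    have "\<delta> * measure M (space M) \<le> \<delta> * (measure M (space M) + 1)" using \<delta> by simp
    also have "\<dots> = e / 2"
      using add_nonneg_pos[OF measure_nonneg[of M "space M"] zero_less_one] by (simp add: \<delta>_def field_simps)
    finally show ?thesis .
  qed
  have "(\<lambda>n. \<delta> powr (1 - p) * (LINT x|M. norm (f n x) powr p)) \<longlonglongrightarrow> 0"
    using tendsto_mult_right[OF lim, of "\<delta> powr (1 - p)"] by (simp add: mult.commute)
  from LIMSEQ_D[OF this, of "e/2"] \<open>e > 0\<close> obtain N where
    N: "\<And>n. n \<ge> N \<Longrightarrow> norm (\<delta> powr (1 - p) * (LINT x|M. norm (f n x) powr p) - 0) < e / 2"
    by auto
  show "\<exists>no. \<forall>n\<ge>no. norm ((LINT x|M. norm (f n x)) - 0) < e"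
  proof (intro exI allI impI)
    fix n assume "n \<ge> N"
    have "0 \<le> (LINT x|M. norm (f n x))" by simp
    moreover note N[OF \<open>n \<ge> N\<close>] L1_le_Lp[OF f[of n] p \<delta>] d1
    ultimately show "norm ((LINT x|M. norm (f n x)) - 0) < e"
      by (simp only: real_norm_def diff_zero)
  qed
qed

lemma Fatou_real:
  fixes h :: "nat \<Rightarrow> 'a \<Rightarrow> real"
  assumes int: "\<And>i. integrable M (h i)" and nn: "\<And>i x. h i x \<ge> 0"
    and bound: "\<And>i. i \<ge> N \<Longrightarrow> (LINT x|M. h i x) \<le> C"
    and lim: "AE x in M. (\<lambda>i. h i x) \<longlonglongrightarrow> g x" and g[measurable]: "g \<in> borel_measurable M" and g0: "\<And>x. g x \<ge> 0"
  shows "integrable M g" "(LINT x|M. g x) \<le> C"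
proof -
  have "0 \<le> (LINT x|M. h N x)" using nn by simp
  then have C: "C \<ge> 0" using bound[of N] by simp
  have "(\<integral>\<^sup>+x. ennreal (g x) \<partial>M) = (\<integral>\<^sup>+x. liminf (\<lambda>i. ennreal (h i x)) \<partial>M)"
  proof (rule nn_integral_cong_AE)
    show "AE x in M. ennreal (g x) = liminf (\<lambda>i. ennreal (h i x))"
      using lim
    proof eventually_elim
      case (elim x)
      then have "(\<lambda>i. ennreal (h i x)) \<longlonglongrightarrow> ennreal (g x)" by (rule tendsto_ennrealI)
      then show ?case by (simp add: lim_imp_Liminf)
    qed
  qed
  also have "\<dots> \<le> liminf (\<lambda>i. \<integral>\<^sup>+x. ennreal (h i x) \<partial>M)"
    by (rule nn_integral_liminf) (use int in auto)
  also have "\<dots> \<le> ennreal C"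
  proof (rule Liminf_le)
    show "\<forall>\<^sub>F i in sequentially. (\<integral>\<^sup>+x. ennreal (h i x) \<partial>M) \<le> ennreal C"
      using eventually_ge_at_top[of N]
    proof eventually_elim
      case (elim i)
      have "(\<integral>\<^sup>+x. ennreal (h i x) \<partial>M) = ennreal (LINT x|M. h i x)"
        by (rule nn_integral_eq_integral[OF int]) (simp add: nn)
      then show ?case using bound[OF elim] by (simp add: ennreal_leI)
    qed
  qed simp
  finally have le: "(\<integral>\<^sup>+x. ennreal (g x) \<partial>M) \<le> ennreal C" .
  show i: "integrable M g"
    by (rule integrableI_nonneg) (use g0 le in \<open>auto simp: le_less_trans\<close>)
  have "ennreal (LINT x|M. g x) \<le> ennreal C"
    using nn_integral_eq_integral[OF i] g0 le by simp
  then show "(LINT x|M. g x) \<le> C" using C by (simp add: ennreal_le_iff)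
qed

text \<open>On a finite measure space an \<open>L\<^sup>p\<close>-Cauchy sequence is Cauchy in \<open>L\<^sup>1\<close>, hence a subsequence converges
almost everywhere, and the lemma of Fatou upgrades this to convergence in \<open>L\<^sup>p\<close>.\<close>

lemma (in finite_measure) Lp_complete:
  fixes f :: "nat \<Rightarrow> 'a \<Rightarrow> 'b::euclidean_space"
  assumes f: "\<And>n. Lp_fun M p (f n)" and p: "p \<ge> 1"
    and cauchy: "\<And>e. e > 0 \<Longrightarrow> \<exists>N. \<forall>m\<ge>N. \<forall>n\<ge>N. (LINT x|M. norm (f m x - f n x) powr p) \<le> e"
  shows "\<exists>g. Lp_fun M p g \<and> (\<lambda>n. LINT x|M. norm (f n x - g x) powr p) \<longlonglongrightarrow> 0"
proof -
  have p0: "p \<ge> 0" using p by simp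
  have fd: "Lp_fun M p (\<lambda>x. f m x - f n x)" for m n using f p by (intro Lp_fun_diff) auto
  have fm[measurable]: "f n \<in> borel_measurable M" for n using f[of n] by (simp add: Lp_fun_def)
  have L1: "\<exists>N. \<forall>i\<ge>N. \<forall>j\<ge>N. (LINT x|M. norm (f i x - f j x)) < e" if "e > 0" for e
  proof -
    define \<delta> where "\<delta> = e / (2 * (measure M (space M) + 1))"
    have mpos: "measure M (space M) + 1 > 0" by (simp add: add_nonneg_pos)
    have \<delta>: "\<delta> > 0" using \<open>e > 0\<close> mpos by (simp add: \<delta>_def)
    have d1: "\<delta> * measure M (space M) \<le> e / 2"
      using mpos that by (simp add: \<delta>_def field_simps)
    define e' where "e' = e / 4 / \<delta> powr (1 - p)"
    have "e' > 0" using that \<delta> by (simp add: e'_def)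
    then obtain N where N: "\<And>m n. m \<ge> N \<Longrightarrow> n \<ge> N \<Longrightarrow> (LINT x|M. norm (f m x - f n x) powr p) \<le> e'"
      using cauchy by blast
    have "(LINT x|M. norm (f i x - f j x)) < e" if ij: "i \<ge> N" "j \<ge> N" for i j
    proof -
      have "\<delta> powr (1 - p) * (LINT x|M. norm (f i x - f j x) powr p) \<le> \<delta> powr (1 - p) * e'"
        using N[OF ij] by (intro mult_left_mono) auto
      also have "\<dots> = e / 4" using \<delta> by (simp add: e'_def)
      finally show ?thesis using L1_le_Lp[OF fd[of i j] p \<delta>] d1 \<open>e > 0\<close> by linarith
    qed
    then show ?thesis by blast
  qed
  obtain r where r: "strict_mono r" "AE x in M. Cauchy (\<lambda>i. f (r i) x)"
    using cauchy_L1_AE_cauchy_subseq[of M f] Lp_fun_integrable[OF f p] L1 by metis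
  define g where "g x = lim (\<lambda>i. f (r i) x)" for x
  have g[measurable]: "g \<in> borel_measurable M"
    unfolding g_def by (rule borel_measurable_lim_metric) simp
  have lim: "AE x in M. (\<lambda>i. f (r i) x) \<longlonglongrightarrow> g x"
    using r(2) by eventually_elim (simp add: g_def Cauchy_convergent convergent_LIMSEQ_iff[symmetric])
  \<comment> \<open>The lemma of Fatou along the subsequence, for a fixed late index \<open>n\<close>.\<close>
  have main: "integrable M (\<lambda>x. norm (f n x - g x) powr p) \<and> (LINT x|M. norm (f n x - g x) powr p) \<le> e"
    if N: "\<forall>m\<ge>N. \<forall>n\<ge>N. (LINT x|M. norm (f m x - f n x) powr p) \<le> e" and n: "n \<ge> N" for n N e
  proof -
    have b: "(LINT x|M. norm (f n x - f (r i) x) powr p) \<le> e" if "i \<ge> N" for i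
      using N n that seq_suble[OF r(1), of i] by (meson le_trans)
    have l: "AE x in M. (\<lambda>i. norm (f n x - f (r i) x) powr p) \<longlonglongrightarrow> norm (f n x - g x) powr p"
      using lim by eventually_elim (use p in \<open>auto intro!: tendsto_intros tendsto_powr'\<close>)
    have i: "integrable M (\<lambda>x. norm (f n x - f (r i) x) powr p)" for i
      using fd by (rule Lp_fun_integrable_powr)
    show ?thesis
      using Fatou_real[OF i _ b l] by simp
  qed
  obtain N where N: "\<forall>m\<ge>N. \<forall>n\<ge>N. (LINT x|M. norm (f m x - f n x) powr p) \<le> 1"
    using cauchy[of 1] by auto
  have "Lp_fun M p (\<lambda>x. f N x - g x)"
    using main[OF N order_refl] by (simp add: Lp_fun_def)
  from Lp_fun_diff[OF f[of N] this p0] have "Lp_fun M p g" by simp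
  moreover have "(\<lambda>n. LINT x|M. norm (f n x - g x) powr p) \<longlonglongrightarrow> 0"
  proof (rule LIMSEQ_I)
    fix e :: real assume "e > 0"
    then obtain N where N: "\<forall>m\<ge>N. \<forall>n\<ge>N. (LINT x|M. norm (f m x - f n x) powr p) \<le> e / 2"
      using cauchy[of "e / 2"] by auto
    have "norm ((LINT x|M. norm (f n x - g x) powr p) - 0) < e" if "n \<ge> N" for n
    proof -
      have "0 \<le> (LINT x|M. norm (f n x - g x) powr p)" by simp
      then show ?thesis using main[OF N that] \<open>e > 0\<close> by simp
    qed
    then show "\<exists>no. \<forall>n\<ge>no. norm ((LINT x|M. norm (f n x - g x) powr p) - 0) < e" by blast
  qed
  ultimately show ?thesis by blast
qed

section \<open>Sobolev functions on a bounded open set\<close>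

lemma complete_measure_lebesgue_on:
  assumes "S \<in> sets lebesgue" shows "complete_measure (lebesgue_on S)"
proof
  fix A B assume "B \<subseteq> A" "A \<in> null_sets (lebesgue_on S)"
  then have "B \<subseteq> S" "A \<in> null_sets lebesgue" using assms by (auto simp: null_sets_restrict_space)
  then have "B \<in> null_sets lebesgue"
    using \<open>B \<subseteq> A\<close> completion.complete2 by blast
  then show "B \<in> sets (lebesgue_on S)"
    using \<open>B \<subseteq> S\<close> by (auto simp: sets_restrict_space_iff assms)
qed

text \<open>Measurability of \<open>weak_gradient \<Omega> u\<close> is obtained from this: the chosen gradient is only known to agree
almost everywhere with a measurable one.\<close>

lemma (in complete_measure) borel_measurable_AE_cong:
  assumes g: "g \<in> borel_measurable M" and ae: "AE x in M. f x = g x"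
  shows "f \<in> borel_measurable M"
proof (rule measurableI)
  fix A :: "'b set" assume A: "A \<in> sets borel"
  have "AE x in M. x \<in> g -` A \<inter> space M \<longleftrightarrow> x \<in> f -` A \<inter> space M"
    using ae by eventually_elim simp
  then show "f -` A \<inter> space M \<in> sets M"
    by (rule in_sets_AE[OF _ measurable_sets[OF g A]]) simp
qed simp

text \<open>The derivative \<open>p \<bar>t\<bar> powr (p - 1) * sgn t\<close> is written with positive parts, which makes its
continuity at \<open>0\<close> evident.\<close>

lemma abs_powr_derivative:
  fixes p t :: real
  assumes p: "1 < p"
  shows "((\<lambda>t. \<bar>t\<bar> powr p) has_real_derivative p * (max 0 t powr (p - 1) - max 0 (- t) powr (p - 1))) (at t)"
proof -
  consider "t < 0" | "t = 0" | "t > 0" by linarith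
  then show ?thesis
  proof cases
    case 1
    have "((\<lambda>t. (- t) powr p) has_real_derivative p * (- t) powr (p - 1) * (-1)) (at t)"
      using 1 by (auto intro!: derivative_eq_intros simp: powr_diff)
    then have "((\<lambda>t. (- t) powr p) has_real_derivative p * (max 0 t powr (p - 1) - max 0 (- t) powr (p - 1))) (at t)"
      using 1 by simp
    then show ?thesis
      by (rule has_field_derivative_transform_within_open[where S="{..<0}"]) (use 1 in auto)
  next
    case 2
    have "((\<lambda>h::real. \<bar>h\<bar> powr p / h) \<longlongrightarrow> 0) (at 0)"
    proof (rule Lim_null_comparison[where g="\<lambda>h. \<bar>h\<bar> powr (p - 1)"])
      have "norm (\<bar>h\<bar> powr p / h) \<le> \<bar>h\<bar> powr (p - 1)" for h :: real
        by (cases "h = 0") (auto simp: powr_diff)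
      then show "\<forall>\<^sub>F h in at 0. norm (\<bar>h\<bar> powr p / h) \<le> \<bar>h::real\<bar> powr (p - 1)"
        by simp
      have "continuous_on UNIV (\<lambda>h::real. \<bar>h\<bar> powr (p - 1))"
        using p by (intro continuous_on_powr' continuous_intros) auto
      then have "((\<lambda>h::real. \<bar>h\<bar> powr (p - 1)) \<longlongrightarrow> \<bar>0\<bar> powr (p - 1)) (at 0)"
        unfolding continuous_on_def by blast
      then show "((\<lambda>h::real. \<bar>h\<bar> powr (p - 1)) \<longlongrightarrow> 0) (at 0)" by simp
    qed
    then show ?thesis using 2 p by (simp add: DERIV_def)
  next
    case 3
    have "((\<lambda>t. t powr p) has_real_derivative p * t powr (p - 1)) (at t)"
      using 3 by (auto intro!: derivative_eq_intros simp: powr_diff)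
    then have "((\<lambda>t. t powr p) has_real_derivative p * (max 0 t powr (p - 1) - max 0 (- t) powr (p - 1))) (at t)"
      using 3 by simp
    then show ?thesis
      by (rule has_field_derivative_transform_within_open[where S="{0<..}"]) (use 3 in auto)
  qed
qed

text \<open>Boundedness makes the measure finite and gives the Poincare inequality. Boundary values are compared
through \<open>W1p_0\<close> only.\<close>

locale sobolev_domain =
  fixes \<Omega> :: "'a::euclidean_space set" and p :: real
  assumes open_domain: "open \<Omega>" and bounded_domain: "bounded \<Omega>" and p_gt_1: "1 < p"
begin

abbreviation M :: "'a measure" where "M \<equiv> lebesgue_on \<Omega>"
abbreviation D :: "('a \<Rightarrow> real) \<Rightarrow> 'a \<Rightarrow> 'a" where "D \<equiv> weak_gradient \<Omega>"

lemma p_ge: "p \<ge> 0" "p \<ge> 1" "p > 0" using p_gt_1 by auto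

lemma domain_sets[simp]: "\<Omega> \<in> sets lebesgue"
  using open_domain by (simp add: borel_open)

sublocale finite_measure M
proof
  have "emeasure lebesgue \<Omega> < \<infinity>" using lmeasurable_open[OF bounded_domain open_domain] by (auto simp: fmeasurable_def)
  then show "emeasure M (space M) \<noteq> \<infinity>" by (simp add: emeasure_restrict_space)
qed

sublocale complete_measure M
  by (rule complete_measure_lebesgue_on) simp

lemma continuous_measurable:
  fixes f :: "'a \<Rightarrow> 'b::{metric_space, second_countable_topology}"
  assumes "continuous_on UNIV f" shows "f \<in> borel_measurable M"
  by (rule continuous_imp_measurable_on_sets_lebesgue) (use assms continuous_on_subset in auto)

lemma integrable_mult_bounded:
  fixes f :: "'a \<Rightarrow> real" and g :: "'a \<Rightarrow> 'b::euclidean_space"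
  assumes "integrable M g" "f \<in> borel_measurable M" "\<And>x. \<bar>f x\<bar> \<le> B"
  shows "integrable M (\<lambda>x. f x *\<^sub>R g x)"
proof (rule Bochner_Integration.integrable_bound)
  show "integrable M (\<lambda>x. B *\<^sub>R g x)" using assms(1) by (rule integrable_scaleR_right)
  show "(\<lambda>x. f x *\<^sub>R g x) \<in> borel_measurable M"
    using assms by (intro borel_measurable_scaleR) auto
  have "norm (f x *\<^sub>R g x) \<le> norm (B *\<^sub>R g x)" for x
    unfolding norm_scaleR using assms(3)[of x] by (intro mult_right_mono) auto
  then show "AE x in M. norm (f x *\<^sub>R g x) \<le> norm (B *\<^sub>R g x)" by simp
qed

lemma integrable_bounded_mult:
  fixes f :: "'a \<Rightarrow> real" and g :: "'a \<Rightarrow> 'b::euclidean_space"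
  assumes "integrable M f" "g \<in> borel_measurable M" "\<And>x. norm (g x) \<le> B"
  shows "integrable M (\<lambda>x. f x *\<^sub>R g x)"
proof (rule Bochner_Integration.integrable_bound)
  show "integrable M (\<lambda>x. B *\<^sub>R f x)" using assms(1) by (rule integrable_scaleR_right)
  show "(\<lambda>x. f x *\<^sub>R g x) \<in> borel_measurable M"
    using assms by (intro borel_measurable_scaleR) auto
  have "norm (f x *\<^sub>R g x) \<le> norm (B *\<^sub>R f x)" for x
  proof -
    have "\<bar>f x\<bar> * norm (g x) \<le> \<bar>f x\<bar> * \<bar>B\<bar>" using assms(3)[of x] by (intro mult_left_mono) auto
    then show ?thesis by (simp add: mult.commute abs_mult)
  qed
  then show "AE x in M. norm (f x *\<^sub>R g x) \<le> norm (B *\<^sub>R f x)" by simp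
qed

lemma integrable_locally_integrable:
  fixes f :: "'a \<Rightarrow> 'b::euclidean_space"
  assumes "integrable M f" shows "locally_integrable_on f \<Omega>"
  unfolding locally_integrable_on_def
proof (intro allI impI)
  fix K assume K: "compact K \<and> K \<subseteq> \<Omega>"
  then have Ks: "K \<in> sets lebesgue" by (simp add: borel_compact)
  have "set_integrable lebesgue \<Omega> f"
    using assms by (subst (asm) integrable_restrict_space) (auto simp: set_integrable_def)
  then have "set_integrable lebesgue K f"
    by (rule set_integrable_subset) (use K Ks in auto)
  then show "integrable (lebesgue_on K) f"
    using Ks by (subst integrable_restrict_space) (auto simp: set_integrable_def)
qed

lemma test_function_bounds:
  assumes "C1_with_gradient \<phi> G" "compactly_supported_in \<Omega> \<phi>"
  obtains B where "\<And>x. \<bar>\<phi> x\<bar> \<le> B" "\<And>x. norm (G x) \<le> B" "\<phi> \<in> borel_measurable M" "G \<in> borel_measurable M"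
proof -
  obtain B where B: "\<And>x. \<bar>\<phi> x\<bar> \<le> B" "\<And>x. norm (G x) \<le> B"
    using compact_support_bounded[OF assms(1)] assms(2) unfolding compactly_supported_in_def by metis
  moreover have "\<phi> \<in> borel_measurable M"
    using C1_with_gradient_continuous[OF assms(1)] by (rule continuous_measurable)
  moreover have "G \<in> borel_measurable M"
    using assms(1) by (intro continuous_measurable) (simp add: C1_with_gradient_def)
  ultimately show ?thesis using that by blast
qed

lemma is_weak_gradient_weak_gradient:
  assumes "is_weak_gradient \<Omega> u g"
  shows "is_weak_gradient \<Omega> u (D u)" "AE x in M. D u x = g x"
proof -
  show *: "is_weak_gradient \<Omega> u (D u)"
    unfolding weak_gradient_def by (rule someI[of "is_weak_gradient \<Omega> u", OF assms])
  show "AE x in M. D u x = g x"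
    by (rule is_weak_gradient_unique[OF open_domain * assms])
qed

lemma W1pI:
  assumes "Lp_fun M p u" "Lp_fun M p g"
    and "\<And>\<phi> G. C1_with_gradient \<phi> G \<Longrightarrow> compactly_supported_in \<Omega> \<phi> \<Longrightarrow>
        (LINT x|M. u x *\<^sub>R G x) = - (LINT x|M. \<phi> x *\<^sub>R g x)"
  shows "u \<in> W1p \<Omega> p" "AE x in M. D u x = g x"
proof -
  have "is_weak_gradient \<Omega> u g"
    unfolding is_weak_gradient_def
    using assms integrable_locally_integrable[OF Lp_fun_integrable[OF assms(1) p_ge(2)]]
      integrable_locally_integrable[OF Lp_fun_integrable[OF assms(2) p_ge(2)]] by blast
  then show "u \<in> W1p \<Omega> p" "AE x in M. D u x = g x"
    using assms(1,2) is_weak_gradient_weak_gradient unfolding W1p_def by blast+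
qed

lemma W1p_Lp:
  assumes "u \<in> W1p \<Omega> p" shows "Lp_fun M p u" "Lp_fun M p (D u)"
proof -
  show "Lp_fun M p u" using assms by (simp add: W1p_def)
  obtain g where g: "is_weak_gradient \<Omega> u g" "Lp_fun M p g" using assms by (auto simp: W1p_def)
  have ae: "AE x in M. D u x = g x" by (rule is_weak_gradient_weak_gradient(2)[OF g(1)])
  have "D u \<in> borel_measurable M"
    using Lp_fun_measurable[OF g(2)] ae by (rule borel_measurable_AE_cong)
  then show "Lp_fun M p (D u)"
    by (rule Lp_fun_cong_AE[OF g(2)]) (use ae in eventually_elim, simp)
qed

lemma W1p_integrable:
  assumes "u \<in> W1p \<Omega> p" shows "integrable M u" "integrable M (D u)"
  using Lp_fun_integrable[OF W1p_Lp(1)[OF assms] p_ge(2)] Lp_fun_integrable[OF W1p_Lp(2)[OF assms] p_ge(2)] .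

lemma W1p_by_parts:
  assumes "u \<in> W1p \<Omega> p" "C1_with_gradient \<phi> G" "compactly_supported_in \<Omega> \<phi>"
  shows "(LINT x|M. u x *\<^sub>R G x) = - (LINT x|M. \<phi> x *\<^sub>R D u x)"
proof -
  obtain g where g: "is_weak_gradient \<Omega> u g" using assms(1) by (auto simp: W1p_def)
  show ?thesis
    using is_weak_gradient_weak_gradient(1)[OF g] assms(2,3) unfolding is_weak_gradient_def by blast
qed

lemma W1p_combination:
  assumes u: "u \<in> W1p \<Omega> p" and v: "v \<in> W1p \<Omega> p"
  shows "(\<lambda>x. a * u x + b * v x) \<in> W1p \<Omega> p"
    "AE x in M. D (\<lambda>x. a * u x + b * v x) x = a *\<^sub>R D u x + b *\<^sub>R D v x"
proof -
  have 1: "Lp_fun M p (\<lambda>x. a * u x + b * v x)"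
    using Lp_fun_add[OF Lp_fun_scaleR[OF W1p_Lp(1)[OF u], of a] Lp_fun_scaleR[OF W1p_Lp(1)[OF v], of b]] p_ge
    by simp
  have 2: "Lp_fun M p (\<lambda>x. a *\<^sub>R D u x + b *\<^sub>R D v x)"
    using Lp_fun_add[OF Lp_fun_scaleR[OF W1p_Lp(2)[OF u], of a] Lp_fun_scaleR[OF W1p_Lp(2)[OF v], of b]] p_ge
    by simp
  have 3: "(LINT x|M. (a * u x + b * v x) *\<^sub>R G x) = - (LINT x|M. \<phi> x *\<^sub>R (a *\<^sub>R D u x + b *\<^sub>R D v x))"
    if G: "C1_with_gradient \<phi> G" "compactly_supported_in \<Omega> \<phi>" for \<phi> G
  proof -
    obtain B where B: "\<And>x. \<bar>\<phi> x\<bar> \<le> B" "\<And>x. norm (G x) \<le> B" "\<phi> \<in> borel_measurable M" "G \<in> borel_measurable M"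
      using test_function_bounds[OF G] by metis
    note iG = integrable_bounded_mult[OF _ B(4) B(2)] and i\<phi> = integrable_mult_bounded[OF _ B(3) B(1)]
    have "(LINT x|M. (a * u x + b * v x) *\<^sub>R G x) = (LINT x|M. a *\<^sub>R (u x *\<^sub>R G x) + b *\<^sub>R (v x *\<^sub>R G x))"
      by (simp add: scaleR_add_left)
    also have "\<dots> = a *\<^sub>R (LINT x|M. u x *\<^sub>R G x) + b *\<^sub>R (LINT x|M. v x *\<^sub>R G x)"
      using iG[OF W1p_integrable(1)[OF u]] iG[OF W1p_integrable(1)[OF v]]
      by (simp del: scaleR_scaleR)
    also have "\<dots> = - (a *\<^sub>R (LINT x|M. \<phi> x *\<^sub>R D u x) + b *\<^sub>R (LINT x|M. \<phi> x *\<^sub>R D v x))"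
      using W1p_by_parts[OF u G] W1p_by_parts[OF v G] by simp
    also have "a *\<^sub>R (LINT x|M. \<phi> x *\<^sub>R D u x) + b *\<^sub>R (LINT x|M. \<phi> x *\<^sub>R D v x)
        = (LINT x|M. a *\<^sub>R (\<phi> x *\<^sub>R D u x) + b *\<^sub>R (\<phi> x *\<^sub>R D v x))"
      using i\<phi>[OF W1p_integrable(2)[OF u]] i\<phi>[OF W1p_integrable(2)[OF v]]
      by (simp del: scaleR_scaleR)
    also have "\<dots> = (LINT x|M. \<phi> x *\<^sub>R (a *\<^sub>R D u x + b *\<^sub>R D v x))"
      by (simp add: algebra_simps)
    finally show ?thesis .
  qed
  show "(\<lambda>x. a * u x + b * v x) \<in> W1p \<Omega> p"
    "AE x in M. D (\<lambda>x. a * u x + b * v x) x = a *\<^sub>R D u x + b *\<^sub>R D v x"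
    using W1pI[OF 1 2 3] by blast+
qed

lemma W1p_scale:
  assumes "u \<in> W1p \<Omega> p"
  shows "(\<lambda>x. a * u x) \<in> W1p \<Omega> p" "AE x in M. D (\<lambda>x. a * u x) x = a *\<^sub>R D u x"
  using W1p_combination[OF assms assms, of a 0] by simp_all

lemma W1p_add:
  assumes "u \<in> W1p \<Omega> p" "v \<in> W1p \<Omega> p"
  shows "(\<lambda>x. u x + v x) \<in> W1p \<Omega> p" "AE x in M. D (\<lambda>x. u x + v x) x = D u x + D v x"
  using W1p_combination[OF assms, of 1 1] by simp_all

lemma W1p_diff:
  assumes "u \<in> W1p \<Omega> p" "v \<in> W1p \<Omega> p"
  shows "(\<lambda>x. u x - v x) \<in> W1p \<Omega> p" "AE x in M. D (\<lambda>x. u x - v x) x = D u x - D v x"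
  using W1p_combination[OF assms, of 1 "-1"] by simp_all

text \<open>Extension by zero outside \<open>\<Omega>\<close> reduces this to the whole space.\<close>

lemma integral_gradient_domain_eq_0:
  assumes "C1_with_gradient \<psi> G" "compactly_supported_in \<Omega> \<psi>"
  shows "(LINT x|M. G x \<bullet> e) = 0"
proof -
  have supp: "compact (closure {x. \<psi> x \<noteq> 0})" "closure {x. \<psi> x \<noteq> 0} \<subseteq> \<Omega>"
    using assms(2) by (simp_all only: compactly_supported_in_def)
  have "continuous_on UNIV G" using assms(1) by (simp add: C1_with_gradient_def)
  then have [measurable]: "G \<in> borel_measurable borel" by (rule borel_measurable_continuous_onI)
  have "(LINT x|M. G x \<bullet> e) = (LINT x|lebesgue. indicator \<Omega> x *\<^sub>R (G x \<bullet> e))"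
    by (subst integral_restrict_space) auto
  also have "\<dots> = (LINT x|lebesgue. G x \<bullet> e)"
  proof (rule Bochner_Integration.integral_cong)
    show "indicator \<Omega> x *\<^sub>R (G x \<bullet> e) = G x \<bullet> e" for x
    proof (cases "x \<in> \<Omega>")
      case False
      then have "G x = 0" using gradient_eq_0_outside_support[OF assms(1), of x] supp(2) by blast
      then show ?thesis by simp
    qed simp
  qed simp
  also have "\<dots> = (LINT x|lborel. G x \<bullet> e)"
    by (rule integral_completion) simp
  also have "\<dots> = 0" by (rule integral_gradient_eq_0[OF assms(1) supp(1)])
  finally show ?thesis .
qed

lemma compactly_supported_in_mult:
  assumes "compactly_supported_in \<Omega> \<phi>"
  shows "compactly_supported_in \<Omega> (\<lambda>x. \<phi> x * \<psi> x)"
proof -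
  have "closure {x. \<phi> x * \<psi> x \<noteq> 0} \<subseteq> closure {x. \<phi> x \<noteq> 0}" by (rule closure_mono) auto
  then show ?thesis
    using assms unfolding compactly_supported_in_def
    by (meson bounded_subset closed_closure compact_eq_bounded_closed order_trans)
qed

lemma compactly_supported_in_combination:
  assumes "compactly_supported_in \<Omega> \<phi>" "compactly_supported_in \<Omega> \<psi>"
  shows "compactly_supported_in \<Omega> (\<lambda>x. a * \<phi> x + b * \<psi> x)"
proof -
  have "closure {x. a * \<phi> x + b * \<psi> x \<noteq> 0} \<subseteq> closure ({x. \<phi> x \<noteq> 0} \<union> {x. \<psi> x \<noteq> 0})"
    by (rule closure_mono) auto
  then have sub: "closure {x. a * \<phi> x + b * \<psi> x \<noteq> 0} \<subseteq> closure {x. \<phi> x \<noteq> 0} \<union> closure {x. \<psi> x \<noteq> 0}"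
    by (simp add: closure_Un)
  moreover have "compact (closure {x. \<phi> x \<noteq> 0} \<union> closure {x. \<psi> x \<noteq> 0})"
    using assms unfolding compactly_supported_in_def by blast
  ultimately have "compact (closure {x. a * \<phi> x + b * \<psi> x \<noteq> 0})"
    by (meson bounded_subset closed_closure compact_eq_bounded_closed)
  then show ?thesis using assms sub unfolding compactly_supported_in_def by blast
qed

lemma C1_0_combination:
  assumes "\<phi> \<in> C1_0 \<Omega>" "\<psi> \<in> C1_0 \<Omega>" shows "(\<lambda>x. a * \<phi> x + b * \<psi> x) \<in> C1_0 \<Omega>"
proof -
  obtain G H where "C1_with_gradient \<phi> G" "C1_with_gradient \<psi> H"
    and s: "compactly_supported_in \<Omega> \<phi>" "compactly_supported_in \<Omega> \<psi>"
    using assms by (auto simp: C1_0_def)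
  then have "C1_with_gradient (\<lambda>x. a * \<phi> x + b * \<psi> x) (\<lambda>x. a *\<^sub>R G x + b *\<^sub>R H x)"
    unfolding C1_with_gradient_def gderiv_def
    by (auto intro!: continuous_intros derivative_eq_intros simp: inner_add_right)
  then show ?thesis using compactly_supported_in_combination[OF s] by (auto simp: C1_0_def)
qed

lemma bounded_Lp_fun:
  fixes f :: "'a \<Rightarrow> 'b::euclidean_space"
  assumes "f \<in> borel_measurable M" "\<And>x. norm (f x) \<le> B"
  shows "Lp_fun M p f"
proof -
  have "integrable M (\<lambda>x. norm (f x) powr p)"
  proof (rule integrable_const_bound[where B="B powr p"])
    show "AE x in M. norm (norm (f x) powr p) \<le> B powr p"
      using assms(2) p_ge by (intro AE_I2) (simp add: powr_mono2)
  qed (use assms(1) in simp)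
  then show ?thesis using assms by (simp add: Lp_fun_def)
qed

text \<open>For a test function \<open>\<psi>\<close> the product \<open>\<phi> \<psi>\<close> is again a test function, and the integral of its gradient
vanishes; this is the integration by parts required of a weak gradient.\<close>

lemma C1_0_W1p:
  assumes \<phi>: "C1_with_gradient \<phi> G" "compactly_supported_in \<Omega> \<phi>"
  shows "\<phi> \<in> W1p \<Omega> p" "AE x in M. D \<phi> x = G x"
proof -
  obtain B where B: "\<And>x. \<bar>\<phi> x\<bar> \<le> B" "\<And>x. norm (G x) \<le> B" "\<phi> \<in> borel_measurable M" "G \<in> borel_measurable M"
    using test_function_bounds[OF \<phi>] by metis
  have L: "Lp_fun M p \<phi>" "Lp_fun M p G"
    using B by (auto intro!: bounded_Lp_fun[where B=B])
  have 3: "(LINT x|M. \<phi> x *\<^sub>R H x) = - (LINT x|M. \<psi> x *\<^sub>R G x)"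
    if H: "C1_with_gradient \<psi> H" "compactly_supported_in \<Omega> \<psi>" for \<psi> H
  proof -
    obtain C where C: "\<And>x. \<bar>\<psi> x\<bar> \<le> C" "\<And>x. norm (H x) \<le> C" "\<psi> \<in> borel_measurable M" "H \<in> borel_measurable M"
      using test_function_bounds[OF H] by metis
    have i1: "integrable M (\<lambda>x. \<phi> x *\<^sub>R H x)"
      by (rule integrable_bounded_mult[OF Lp_fun_integrable[OF L(1) p_ge(2)] C(4) C(2)])
    have i2: "integrable M (\<lambda>x. \<psi> x *\<^sub>R G x)"
      by (rule integrable_mult_bounded[OF Lp_fun_integrable[OF L(2) p_ge(2)] C(3) C(1)])
    have "(LINT x|M. (\<phi> x *\<^sub>R H x + \<psi> x *\<^sub>R G x) \<bullet> e) = 0" for e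
      by (rule integral_gradient_domain_eq_0[OF C1_with_gradient_mult[OF \<phi>(1) H(1)] compactly_supported_in_mult[OF \<phi>(2)]])
    moreover have "(LINT x|M. (\<phi> x *\<^sub>R H x + \<psi> x *\<^sub>R G x) \<bullet> e) = (LINT x|M. \<phi> x *\<^sub>R H x + \<psi> x *\<^sub>R G x) \<bullet> e" for e
      by (rule integral_inner_left) (rule Bochner_Integration.integrable_add[OF i1 i2])
    ultimately have "(LINT x|M. \<phi> x *\<^sub>R H x + \<psi> x *\<^sub>R G x) \<bullet> e = 0" for e by simp
    then have "(LINT x|M. \<phi> x *\<^sub>R H x + \<psi> x *\<^sub>R G x) = 0"
      by (metis inner_eq_zero_iff)
    then show ?thesis
      using Bochner_Integration.integral_add[OF i1 i2] by (simp add: eq_neg_iff_add_eq_0)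
  qed
  show "\<phi> \<in> W1p \<Omega> p" "AE x in M. D \<phi> x = G x"
    using W1pI[OF L 3] by blast+
qed
text \<open>The \<open>p\<close>-th power of the Sobolev norm, which is easier to estimate than the norm itself.\<close>

definition W1p_power :: "('a \<Rightarrow> real) \<Rightarrow> real" where
  "W1p_power u = (LINT x|M. norm (u x) powr p) + (LINT x|M. norm (D u x) powr p)"

lemma W1p_power_nonneg: "0 \<le> W1p_power u"
  by (simp add: W1p_power_def)

lemma W1p_norm_less_iff:
  assumes "\<epsilon> > 0" shows "W1p_norm \<Omega> p u < \<epsilon> \<longleftrightarrow> W1p_power u < \<epsilon> powr p"
proof -
  have eq: "W1p_norm \<Omega> p u = W1p_power u powr (1 / p)"
    by (simp add: W1p_norm_def W1p_power_def)
  have "W1p_power u powr (1 / p) < \<epsilon> \<longleftrightarrow> (W1p_power u powr (1 / p)) powr p < \<epsilon> powr p"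
    using powr_less_mono2[of p "W1p_power u powr (1 / p)" \<epsilon>] powr_mono2[of p \<epsilon> "W1p_power u powr (1 / p)"]
      assms p_ge by (meson not_le less_imp_le powr_ge_zero)
  then show ?thesis using p_ge W1p_power_nonneg[of u] by (simp add: eq powr_powr)
qed

lemma W1p_0_iff:
  "u \<in> W1p_0 \<Omega> p \<longleftrightarrow> u \<in> W1p \<Omega> p \<and> (\<forall>\<epsilon>>0. \<exists>\<phi>\<in>C1_0 \<Omega>. W1p_power (\<lambda>x. u x - \<phi> x) < \<epsilon>)"
proof -
  have "(\<forall>\<epsilon>>0. \<exists>\<phi>\<in>C1_0 \<Omega>. W1p_norm \<Omega> p (\<lambda>x. u x - \<phi> x) < \<epsilon>) \<longleftrightarrow>
    (\<forall>\<epsilon>>0. \<exists>\<phi>\<in>C1_0 \<Omega>. W1p_power (\<lambda>x. u x - \<phi> x) < \<epsilon>)" (is "?L \<longleftrightarrow> ?R")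
  proof
    assume L: ?L
    show ?R
    proof (intro allI impI)
      fix \<epsilon> :: real assume "\<epsilon> > 0"
      then have pos: "\<epsilon> powr (1 / p) > 0" by simp
      with L obtain \<phi> where "\<phi> \<in> C1_0 \<Omega>" "W1p_norm \<Omega> p (\<lambda>x. u x - \<phi> x) < \<epsilon> powr (1 / p)" by blast
      then show "\<exists>\<phi>\<in>C1_0 \<Omega>. W1p_power (\<lambda>x. u x - \<phi> x) < \<epsilon>"
        using \<open>\<epsilon> > 0\<close> p_ge by (auto simp: W1p_norm_less_iff[OF pos] powr_powr)
    qed
  next
    assume R: ?R
    show ?L
    proof (intro allI impI)
      fix \<epsilon> :: real assume "\<epsilon> > 0"
      then have "\<epsilon> powr p > 0" by simp
      with R show "\<exists>\<phi>\<in>C1_0 \<Omega>. W1p_norm \<Omega> p (\<lambda>x. u x - \<phi> x) < \<epsilon>"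
        by (simp add: W1p_norm_less_iff[OF \<open>\<epsilon> > 0\<close>])
    qed
  qed
  then show ?thesis by (simp add: W1p_0_def)
qed

lemma integral_weak_gradient_cong:
  assumes "u \<in> W1p \<Omega> p" "g \<in> borel_measurable M" "AE x in M. D u x = g x"
  shows "(LINT x|M. norm (D u x) powr p) = (LINT x|M. norm (g x) powr p)"
proof (rule integral_cong_AE)
  show "AE x in M. norm (D u x) powr p = norm (g x) powr p" using assms(3) by eventually_elim simp
  show "(\<lambda>x. norm (D u x) powr p) \<in> borel_measurable M"
    using Lp_fun_measurable[OF W1p_Lp(2)[OF assms(1)]] by simp
qed (use assms(2) in simp)

lemma W1p_power_add:
  assumes u: "u \<in> W1p \<Omega> p" and v: "v \<in> W1p \<Omega> p"
  shows "W1p_power (\<lambda>x. u x + v x) \<le> 2 powr p * (W1p_power u + W1p_power v)"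
proof -
  note L = W1p_Lp[OF u] W1p_Lp[OF v]
  have "(LINT x|M. norm (D (\<lambda>x. u x + v x) x) powr p) = (LINT x|M. norm (D u x + D v x) powr p)"
    using W1p_add[OF u v] Lp_fun_measurable[OF L(2)] Lp_fun_measurable[OF L(4)]
    by (intro integral_weak_gradient_cong borel_measurable_add) auto
  then show ?thesis
    using integral_powr_add_le[OF L(1) L(3) p_ge(1)] integral_powr_add_le[OF L(2) L(4) p_ge(1)]
    by (simp add: W1p_power_def algebra_simps)
qed

lemma W1p_power_scale:
  assumes u: "u \<in> W1p \<Omega> p"
  shows "W1p_power (\<lambda>x. a * u x) = \<bar>a\<bar> powr p * W1p_power u"
proof -
  have "(LINT x|M. norm (D (\<lambda>x. a * u x) x) powr p) = (LINT x|M. norm (a *\<^sub>R D u x) powr p)"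
    using W1p_scale[OF u, of a] Lp_fun_measurable[OF W1p_Lp(2)[OF u]]
    by (intro integral_weak_gradient_cong borel_measurable_scaleR) auto
  then show ?thesis
    by (simp add: W1p_power_def abs_mult powr_mult algebra_simps)
qed

lemma C1_0_subset_W1p: "C1_0 \<Omega> \<subseteq> W1p \<Omega> p"
  using C1_0_W1p(1) by (auto simp: C1_0_def)

lemma W1p_0_subset: "W1p_0 \<Omega> p \<subseteq> W1p \<Omega> p"
  by (auto simp: W1p_0_def)

lemma C1_0_subset_W1p_0: "C1_0 \<Omega> \<subseteq> W1p_0 \<Omega> p"
proof
  fix \<phi> assume \<phi>: "\<phi> \<in> C1_0 \<Omega>"
  then have W: "\<phi> \<in> W1p \<Omega> p" using C1_0_subset_W1p by blast
  have "W1p_power (\<lambda>x. \<phi> x - \<phi> x) = 0"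
    using W1p_power_scale[OF W, of 0] by simp
  then show "\<phi> \<in> W1p_0 \<Omega> p" using \<phi> W unfolding W1p_0_iff by metis
qed

lemma W1p_0_closed:
  assumes u: "u \<in> W1p \<Omega> p" and approx: "\<And>\<epsilon>. \<epsilon> > 0 \<Longrightarrow> \<exists>w\<in>W1p_0 \<Omega> p. W1p_power (\<lambda>x. u x - w x) < \<epsilon>"
  shows "u \<in> W1p_0 \<Omega> p"
  unfolding W1p_0_iff
proof (intro conjI u allI impI)
  fix \<epsilon> :: real assume "\<epsilon> > 0"
  define \<delta> where "\<delta> = \<epsilon> / (2 * 2 powr p)"
  have \<delta>: "\<delta> > 0" using \<open>\<epsilon> > 0\<close> by (simp add: \<delta>_def)
  obtain w where w: "w \<in> W1p_0 \<Omega> p" "W1p_power (\<lambda>x. u x - w x) < \<delta>" using approx[OF \<delta>] by blast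
  then obtain \<phi> where \<phi>: "\<phi> \<in> C1_0 \<Omega>" "W1p_power (\<lambda>x. w x - \<phi> x) < \<delta>"
    using \<delta> by (auto simp: W1p_0_iff)
  have wW: "w \<in> W1p \<Omega> p" "\<phi> \<in> W1p \<Omega> p" using w(1) W1p_0_subset \<phi>(1) C1_0_subset_W1p by auto
  have "W1p_power (\<lambda>x. (u x - w x) + (w x - \<phi> x)) \<le> 2 powr p * (W1p_power (\<lambda>x. u x - w x) + W1p_power (\<lambda>x. w x - \<phi> x))"
    by (rule W1p_power_add[OF W1p_diff(1)[OF u wW(1)] W1p_diff(1)[OF wW]])
  also have "\<dots> < 2 powr p * (\<delta> + \<delta>)" using w(2) \<phi>(2) by (intro mult_strict_left_mono) auto
  also have "\<dots> = \<epsilon>" by (simp add: \<delta>_def)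
  finally show "\<exists>\<phi>\<in>C1_0 \<Omega>. W1p_power (\<lambda>x. u x - \<phi> x) < \<epsilon>" using \<phi>(1) by auto
qed

lemma W1p_0_combination:
  assumes u: "u \<in> W1p_0 \<Omega> p" and v: "v \<in> W1p_0 \<Omega> p"
  shows "(\<lambda>x. a * u x + b * v x) \<in> W1p_0 \<Omega> p"
proof (rule W1p_0_closed)
  have uv: "u \<in> W1p \<Omega> p" "v \<in> W1p \<Omega> p" using u v W1p_0_subset by auto
  then show "(\<lambda>x. a * u x + b * v x) \<in> W1p \<Omega> p" by (rule W1p_combination(1))
  fix \<epsilon> :: real assume "\<epsilon> > 0"
  define K where "K = 2 powr p * (\<bar>a\<bar> powr p + \<bar>b\<bar> powr p + 1)"
  have K: "K > 0" by (simp add: K_def add_nonneg_pos)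
  define \<delta> where "\<delta> = \<epsilon> / K"
  have \<delta>: "\<delta> > 0" using \<open>\<epsilon> > 0\<close> K by (simp add: \<delta>_def)
  obtain \<phi> where \<phi>: "\<phi> \<in> C1_0 \<Omega>" "W1p_power (\<lambda>x. u x - \<phi> x) < \<delta>" using u \<delta> by (auto simp: W1p_0_iff)
  obtain \<psi> where \<psi>: "\<psi> \<in> C1_0 \<Omega>" "W1p_power (\<lambda>x. v x - \<psi> x) < \<delta>" using v \<delta> by (auto simp: W1p_0_iff)
  have W: "\<phi> \<in> W1p \<Omega> p" "\<psi> \<in> W1p \<Omega> p" using \<phi> \<psi> C1_0_subset_W1p by auto
  note d1 = W1p_diff(1)[OF uv(1) W(1)] and d2 = W1p_diff(1)[OF uv(2) W(2)]
  have "W1p_power (\<lambda>x. a * (u x - \<phi> x) + b * (v x - \<psi> x)) \<le>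
      2 powr p * (W1p_power (\<lambda>x. a * (u x - \<phi> x)) + W1p_power (\<lambda>x. b * (v x - \<psi> x)))"
    by (rule W1p_power_add[OF W1p_scale(1)[OF d1] W1p_scale(1)[OF d2]])
  also have "\<dots> = 2 powr p * (\<bar>a\<bar> powr p * W1p_power (\<lambda>x. u x - \<phi> x) + \<bar>b\<bar> powr p * W1p_power (\<lambda>x. v x - \<psi> x))"
    by (simp only: W1p_power_scale[OF d1] W1p_power_scale[OF d2])
  also have "\<dots> \<le> 2 powr p * (\<bar>a\<bar> powr p * \<delta> + \<bar>b\<bar> powr p * \<delta>)"
    using \<phi>(2) \<psi>(2) by (intro mult_left_mono add_mono) auto
  also have "\<dots> < 2 powr p * (\<bar>a\<bar> powr p * \<delta> + \<bar>b\<bar> powr p * \<delta> + \<delta>)"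
    using \<delta> by (intro mult_strict_left_mono) auto
  also have "\<dots> = K * \<delta>" by (simp add: K_def algebra_simps)
  also have "\<dots> = \<epsilon>" using K by (simp add: \<delta>_def)
  finally have "W1p_power (\<lambda>x. a * (u x - \<phi> x) + b * (v x - \<psi> x)) < \<epsilon>" .
  moreover have "(\<lambda>x. a * (u x - \<phi> x) + b * (v x - \<psi> x)) = (\<lambda>x. (a * u x + b * v x) - (a * \<phi> x + b * \<psi> x))"
    by (simp add: algebra_simps)
  ultimately show "\<exists>w\<in>W1p_0 \<Omega> p. W1p_power (\<lambda>x. a * u x + b * v x - w x) < \<epsilon>"
    using C1_0_combination[OF \<phi>(1) \<psi>(1), of a b] C1_0_subset_W1p_0 by auto
qed

text \<open>Integrating the divergence of \<open>\<bar>\<phi>\<bar>\<^sup>p (x \<bullet> e) e\<close> for a unit vector \<open>e\<close> shows that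
\<open>\<integral> \<bar>\<phi>\<bar>\<^sup>p\<close> equals \<open>-\<integral> (x \<bullet> e) p \<bar>\<phi>\<bar>\<^sup>p\<^sup>-\<^sup>1 sgn \<phi> (G \<bullet> e)\<close>. The weighted Young inequality splits the right-hand
side, and its \<open>\<phi>\<close>-part is absorbed on the left.\<close>

lemma Poincare_C1_0:
  assumes R: "R > 0" "\<And>x. x \<in> \<Omega> \<Longrightarrow> norm x \<le> R"
    and \<phi>: "C1_with_gradient \<phi> G" "compactly_supported_in \<Omega> \<phi>"
  shows "(LINT x|M. norm (\<phi> x) powr p) \<le> (2 * p * R) powr p * (LINT x|M. norm (G x) powr p)"
proof -
  obtain e :: 'a where e: "e \<in> Basis" using nonempty_Basis by blast
  obtain B where B: "\<And>x. \<bar>\<phi> x\<bar> \<le> B" "\<And>x. norm (G x) \<le> B" "\<phi> \<in> borel_measurable M" "G \<in> borel_measurable M"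
    using test_function_bounds[OF \<phi>] by metis
  define s' where "s' t = p * (max 0 t powr (p - 1) - max 0 (- t) powr (p - 1))" for t
  have s'_abs: "\<bar>s' t\<bar> = p * \<bar>t\<bar> powr (p - 1)" for t
    using p_ge by (cases "t \<ge> 0") (auto simp: s'_def abs_mult)
  have contS: "continuous_on S s'" for S
    unfolding s'_def using p_gt_1 by (intro continuous_intros continuous_on_powr') auto
  have C1a: "C1_with_gradient (\<lambda>x. \<bar>\<phi> x\<bar> powr p) (\<lambda>x. s' (\<phi> x) *\<^sub>R G x)"
    by (rule C1_with_gradient_compose[OF \<phi>(1), where s="\<lambda>t. \<bar>t\<bar> powr p"])
      (use abs_powr_derivative[OF p_gt_1] contS in \<open>auto simp: s'_def[abs_def]\<close>)
  have C1b: "C1_with_gradient (\<lambda>x. x \<bullet> e) (\<lambda>x. e)"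
    unfolding C1_with_gradient_def gderiv_def
    using bounded_linear_imp_has_derivative[OF bounded_linear_inner_left[of e]] continuous_on_const by blast
  have "closure {x. \<bar>\<phi> x\<bar> powr p \<noteq> 0} = closure {x. \<phi> x \<noteq> 0}" by simp
  then have suppa: "compactly_supported_in \<Omega> (\<lambda>x. \<bar>\<phi> x\<bar> powr p)"
    using \<phi>(2) by (simp only: compactly_supported_in_def)
  \<comment> \<open>The \<open>e\<close>-component of the gradient of \<open>\<bar>\<phi>\<bar>\<^sup>p (x \<bullet> e)\<close>.\<close>
  have zero: "(LINT x|M. (\<bar>\<phi> x\<bar> powr p *\<^sub>R e + (x \<bullet> e) *\<^sub>R s' (\<phi> x) *\<^sub>R G x) \<bullet> e) = 0"
    by (rule integral_gradient_domain_eq_0[OF C1_with_gradient_mult[OF C1a C1b] compactly_supported_in_mult[OF suppa]])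
  have L: "Lp_fun M p \<phi>" "Lp_fun M p G"
    using B by (auto intro!: bounded_Lp_fun[where B=B])
  \<comment> \<open>With this weight the Young inequality produces exactly one half of the left-hand side.\<close>
  define \<delta> where "\<delta> = 1 / (2 * p * R)"
  have \<delta>: "\<delta> > 0" using R p_ge by (simp add: \<delta>_def)
  have ee: "e \<bullet> e = 1" "norm e = 1" using e by (auto simp: inner_Basis)
  define T where "T x = (x \<bullet> e) * s' (\<phi> x) * (G x \<bullet> e)" for x
  have T_bound: "\<bar>T x\<bar> \<le> p * R * (\<delta> * norm (\<phi> x) powr p + \<delta> powr (1 - p) * norm (G x) powr p)" if "x \<in> \<Omega>" for x
  proof -
    have "\<bar>x \<bullet> e\<bar> \<le> R" using Cauchy_Schwarz_ineq2[of x e] R(2)[OF that] ee by simp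
    moreover have "\<bar>G x \<bullet> e\<bar> \<le> norm (G x)" using Cauchy_Schwarz_ineq2[of "G x" e] ee by simp
    ultimately have "\<bar>T x\<bar> \<le> R * (p * \<bar>\<phi> x\<bar> powr (p - 1)) * norm (G x)"
      unfolding T_def abs_mult s'_abs using R p_ge by (intro mult_mono) auto
    also have "\<dots> = p * R * (\<bar>\<phi> x\<bar> powr (p - 1) * norm (G x))" by (simp add: algebra_simps)
    also have "\<dots> \<le> p * R * (\<delta> * \<bar>\<phi> x\<bar> powr p + \<delta> powr (1 - p) * norm (G x) powr p)"
      using R p_ge \<delta> by (intro mult_left_mono Young_powr) auto
    finally show ?thesis by simp
  qed
  have i\<phi>: "integrable M (\<lambda>x. norm (\<phi> x) powr p)" and iG: "integrable M (\<lambda>x. norm (G x) powr p)"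
    using L by (auto simp: Lp_fun_def)
  have Tm: "T \<in> borel_measurable M"
    unfolding T_def
  proof (intro borel_measurable_times borel_measurable_inner)
    show "(\<lambda>x. s' (\<phi> x)) \<in> borel_measurable M"
      using borel_measurable_continuous_onI[OF contS] B(3) by (rule measurable_compose_rev)
  qed (use B in \<open>auto intro: continuous_measurable\<close>)
  have iT: "integrable M T"
  proof (rule Bochner_Integration.integrable_bound[OF _ Tm])
    show "integrable M (\<lambda>x. p * R * (\<delta> * norm (\<phi> x) powr p + \<delta> powr (1 - p) * norm (G x) powr p))"
      using i\<phi> iG by simp
    show "AE x in M. norm (T x) \<le> norm (p * R * (\<delta> * norm (\<phi> x) powr p + \<delta> powr (1 - p) * norm (G x) powr p))"
      by (rule AE_I2) (metis T_bound abs_ge_self order_trans real_norm_def space_lebesgue_on)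
  qed
  have "(LINT x|M. norm (\<phi> x) powr p + T x) = 0"
    using zero by (simp add: inner_add_left ee T_def mult.assoc)
  then have "(LINT x|M. norm (\<phi> x) powr p) = - (LINT x|M. T x)"
    using i\<phi> iT by simp
  also have "\<dots> = (LINT x|M. - T x)" by simp
  also have "\<dots> \<le> (LINT x|M. p * R * (\<delta> * norm (\<phi> x) powr p + \<delta> powr (1 - p) * norm (G x) powr p))"
    using i\<phi> iG iT T_bound by (intro integral_mono) (auto simp: abs_le_iff)
  also have "\<dots> = p * R * \<delta> * (LINT x|M. norm (\<phi> x) powr p) + p * R * \<delta> powr (1 - p) * (LINT x|M. norm (G x) powr p)"
    using i\<phi> iG by (simp add: algebra_simps)
  also have "p * R * \<delta> = 1 / 2" using R p_ge by (simp add: \<delta>_def)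
  finally have "(LINT x|M. norm (\<phi> x) powr p) \<le> 2 * p * R * \<delta> powr (1 - p) * (LINT x|M. norm (G x) powr p)"
    by simp
  also have "2 * p * R * \<delta> powr (1 - p) = (2 * p * R) powr p"
  proof -
    have pos: "2 * p * R > 0" using R p_ge by simp
    have "\<delta> powr (1 - p) = (2 * p * R) powr (p - 1)"
      using pos by (simp add: \<delta>_def powr_divide powr_diff)
    then show ?thesis using powr_mult_base[of "2 * p * R" "p - 1"] pos by simp
  qed
  finally show ?thesis .
qed

text \<open>Both sides are continuous in the Sobolev norm, so the inequality passes from \<open>C1_0\<close> to its closure; the
crude sum bounds cost the two factors \<open>2 powr p\<close>.\<close>

proposition Poincare:
  obtains C where "C \<ge> 0" "\<And>w. w \<in> W1p_0 \<Omega> p \<Longrightarrow>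
    (LINT x|M. norm (w x) powr p) \<le> C * (LINT x|M. norm (D w x) powr p)"
proof -
  obtain R where R: "R > 0" "\<And>x. x \<in> \<Omega> \<Longrightarrow> norm x \<le> R"
    using bounded_domain unfolding bounded_pos by auto
  define c where "c = (2 * p * R) powr p"
  define C where "C = 2 powr p * 2 powr p * c"
  have "(LINT x|M. norm (w x) powr p) \<le> C * (LINT x|M. norm (D w x) powr p)" if w: "w \<in> W1p_0 \<Omega> p" for w
  proof (rule field_le_epsilon)
    fix \<epsilon> :: real assume "\<epsilon> > 0"
    define K where "K = 2 powr p * (1 + c * 2 powr p)"
    have K: "K > 0" by (auto simp: K_def c_def intro!: mult_pos_pos add_pos_nonneg)
    define \<delta> where "\<delta> = \<epsilon> / K"
    have "\<delta> > 0" using K \<open>\<epsilon> > 0\<close> by (simp add: \<delta>_def)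
    then obtain \<phi> where \<phi>: "\<phi> \<in> C1_0 \<Omega>" and small: "W1p_power (\<lambda>x. w x - \<phi> x) < \<delta>"
      using w by (auto simp: W1p_0_iff)
    obtain G where G: "C1_with_gradient \<phi> G" "compactly_supported_in \<Omega> \<phi>" using \<phi> by (auto simp: C1_0_def)
    have wW: "w \<in> W1p \<Omega> p" "\<phi> \<in> W1p \<Omega> p" using w W1p_0_subset \<phi> C1_0_subset_W1p by auto
    note d = W1p_diff[OF wW]
    note L = W1p_Lp[OF d(1)] W1p_Lp[OF wW(1)] W1p_Lp[OF wW(2)]
    have s1: "(LINT x|M. norm (w x - \<phi> x) powr p) + (LINT x|M. norm (D (\<lambda>x. w x - \<phi> x) x) powr p) < \<delta>"
      using small by (simp add: W1p_power_def)
    have "(LINT x|M. norm (w x) powr p) = (LINT x|M. norm ((w x - \<phi> x) + \<phi> x) powr p)" by simp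
    also have "\<dots> \<le> 2 powr p * ((LINT x|M. norm (w x - \<phi> x) powr p) + (LINT x|M. norm (\<phi> x) powr p))"
      by (rule integral_powr_add_le[OF L(1) L(5) p_ge(1)])
    finally have a: "(LINT x|M. norm (w x) powr p) \<le> 2 powr p * ((LINT x|M. norm (w x - \<phi> x) powr p) + (LINT x|M. norm (\<phi> x) powr p))" .
    have b: "(LINT x|M. norm (\<phi> x) powr p) \<le> c * (LINT x|M. norm (G x) powr p)"
      unfolding c_def by (rule Poincare_C1_0[OF R G])
    have Gm: "G \<in> borel_measurable M" using test_function_bounds[OF G] by metis
    have "(LINT x|M. norm (G x) powr p) = (LINT x|M. norm (D w x - D (\<lambda>x. w x - \<phi> x) x) powr p)"
    proof (rule integral_cong_AE)
      show "AE x in M. norm (G x) powr p = norm (D w x - D (\<lambda>x. w x - \<phi> x) x) powr p"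
        using C1_0_W1p(2)[OF G] d(2) by eventually_elim simp
    qed (use Gm Lp_fun_measurable[OF L(2)] Lp_fun_measurable[OF L(4)] in simp_all)
    also have "\<dots> = (LINT x|M. norm (D w x + (-1) *\<^sub>R D (\<lambda>x. w x - \<phi> x) x) powr p)" by simp
    also have "\<dots> \<le> 2 powr p * ((LINT x|M. norm (D w x) powr p) + (LINT x|M. norm ((-1) *\<^sub>R D (\<lambda>x. w x - \<phi> x) x) powr p))"
      by (rule integral_powr_add_le[OF L(4) Lp_fun_scaleR[OF L(2)] p_ge(1)])
    finally have "(LINT x|M. norm (G x) powr p) \<le>
        2 powr p * ((LINT x|M. norm (D w x) powr p) + (LINT x|M. norm (D (\<lambda>x. w x - \<phi> x) x) powr p))"
      by simp
    also have "\<dots> \<le> 2 powr p * ((LINT x|M. norm (D w x) powr p) + \<delta>)"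
    proof (intro mult_left_mono add_left_mono)
      have "0 \<le> (LINT x|M. norm (w x - \<phi> x) powr p)" by simp
      with s1 show "(LINT x|M. norm (D (\<lambda>x. w x - \<phi> x) x) powr p) \<le> \<delta>" by linarith
    qed simp
    finally have c: "(LINT x|M. norm (G x) powr p) \<le> 2 powr p * ((LINT x|M. norm (D w x) powr p) + \<delta>)" .
    have c0: "c \<ge> 0" by (simp add: c_def)
    have "0 \<le> (LINT x|M. norm (D (\<lambda>x. w x - \<phi> x) x) powr p)" by simp
    then have "(LINT x|M. norm (w x - \<phi> x) powr p) \<le> \<delta>" using s1 by linarith
    moreover have "(LINT x|M. norm (\<phi> x) powr p) \<le> c * (2 powr p * ((LINT x|M. norm (D w x) powr p) + \<delta>))"
      using b mult_left_mono[OF c c0] by linarith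
    ultimately have "2 powr p * ((LINT x|M. norm (w x - \<phi> x) powr p) + (LINT x|M. norm (\<phi> x) powr p))
      \<le> 2 powr p * (\<delta> + c * (2 powr p * ((LINT x|M. norm (D w x) powr p) + \<delta>)))"
      by (intro mult_left_mono add_mono) auto
    also have "\<dots> = C * (LINT x|M. norm (D w x) powr p) + K * \<delta>"
      by (simp add: C_def K_def algebra_simps)
    also have "K * \<delta> = \<epsilon>" using K by (simp add: \<delta>_def)
    finally show "(LINT x|M. norm (w x) powr p) \<le> C * (LINT x|M. norm (D w x) powr p) + \<epsilon>" using a by linarith
  qed
  moreover have "C \<ge> 0" by (simp add: C_def c_def)
  ultimately show ?thesis using that by blast
qed

text \<open>By the Poincare inequality the functions themselves are Cauchy in \<open>L\<^sup>p\<close>. Integration by parts against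
a fixed test function is continuous in \<open>L\<^sup>1\<close>, so the limit of the gradients is the weak gradient of the
limit.\<close>

proposition W1p_0_complete:
  assumes w: "\<And>n. w n \<in> W1p_0 \<Omega> p"
    and cauchy: "\<And>e. e > 0 \<Longrightarrow> \<exists>N. \<forall>m\<ge>N. \<forall>n\<ge>N. (LINT x|M. norm (D (w m) x - D (w n) x) powr p) \<le> e"
  obtains u where "u \<in> W1p_0 \<Omega> p" "(\<lambda>n. LINT x|M. norm (D (w n) x - D u x) powr p) \<longlonglongrightarrow> 0"
proof -
  have wW: "w n \<in> W1p \<Omega> p" for n using w W1p_0_subset by blast
  note L = W1p_Lp[OF wW]
  obtain C where C: "C \<ge> 0" "\<And>w. w \<in> W1p_0 \<Omega> p \<Longrightarrow>
    (LINT x|M. norm (w x) powr p) \<le> C * (LINT x|M. norm (D w x) powr p)"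
    using Poincare by metis
  have P: "(LINT x|M. norm (w m x - w n x) powr p) \<le> C * (LINT x|M. norm (D (w m) x - D (w n) x) powr p)" for m n
  proof -
    have "(\<lambda>x. w m x - w n x) \<in> W1p_0 \<Omega> p"
      using W1p_0_combination[OF w w, of 1 m "-1" n] by simp
    from C(2)[OF this] show ?thesis
      using W1p_diff[OF wW wW] Lp_fun_measurable[OF L(2)]
      by (subst (asm) integral_weak_gradient_cong[of _ "\<lambda>x. D (w m) x - D (w n) x"]) auto
  qed
  have cauchy0: "\<exists>N. \<forall>m\<ge>N. \<forall>n\<ge>N. (LINT x|M. norm (w m x - w n x) powr p) \<le> e" if "e > 0" for e
  proof -
    have "e / (C + 1) > 0" using C(1) that by simp
    from cauchy[OF this] obtain N where N: "\<And>m n. m \<ge> N \<Longrightarrow> n \<ge> N \<Longrightarrow> (LINT x|M. norm (D (w m) x - D (w n) x) powr p) \<le> e / (C + 1)"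
      by blast
    have "(LINT x|M. norm (w m x - w n x) powr p) \<le> e" if "m \<ge> N" "n \<ge> N" for m n
    proof -
      have "(LINT x|M. norm (w m x - w n x) powr p) \<le> C * (e / (C + 1))"
        using P[of m n] mult_left_mono[OF N[OF that] C(1)] by linarith
      also have "\<dots> \<le> e" using C(1) \<open>e > 0\<close> by (simp add: field_simps)
      finally show ?thesis .
    qed
    then show ?thesis by blast
  qed
  obtain u where u: "Lp_fun M p u" "(\<lambda>n. LINT x|M. norm (w n x - u x) powr p) \<longlonglongrightarrow> 0"
    using Lp_complete[OF L(1) p_ge(2) cauchy0] by blast
  obtain g where g: "Lp_fun M p g" "(\<lambda>n. LINT x|M. norm (D (w n) x - g x) powr p) \<longlonglongrightarrow> 0"
    using Lp_complete[OF L(2) p_ge(2) cauchy] by blast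
  have u1: "(\<lambda>n. LINT x|M. norm (w n x - u x)) \<longlonglongrightarrow> 0"
    by (rule L1_tendsto_0_if_Lp[OF Lp_fun_diff[OF L(1) u(1) p_ge(1)] p_ge(2) u(2)])
  have g1: "(\<lambda>n. LINT x|M. norm (D (w n) x - g x)) \<longlonglongrightarrow> 0"
    by (rule L1_tendsto_0_if_Lp[OF Lp_fun_diff[OF L(2) g(1) p_ge(1)] p_ge(2) g(2)])
  note iu = Lp_fun_integrable[OF u(1) p_ge(2)] and ig = Lp_fun_integrable[OF g(1) p_ge(2)]
  have parts: "(LINT x|M. u x *\<^sub>R G x) = - (LINT x|M. \<phi> x *\<^sub>R g x)"
    if G: "C1_with_gradient \<phi> G" "compactly_supported_in \<Omega> \<phi>" for \<phi> G
  proof -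
    obtain B where B: "\<And>x. \<bar>\<phi> x\<bar> \<le> B" "\<And>x. norm (G x) \<le> B" "\<phi> \<in> borel_measurable M" "G \<in> borel_measurable M"
      using test_function_bounds[OF G] by metis
    note iG = integrable_bounded_mult[OF _ B(4) B(2)] and i\<phi> = integrable_mult_bounded[OF _ B(3) B(1)]
    have l1: "(\<lambda>n. LINT x|M. w n x *\<^sub>R G x) \<longlonglongrightarrow> (LINT x|M. u x *\<^sub>R G x)"
    proof (rule LIM_zero_cancel, rule Lim_null_comparison)
      show "\<forall>\<^sub>F n in sequentially. norm ((LINT x|M. w n x *\<^sub>R G x) - (LINT x|M. u x *\<^sub>R G x)) \<le> B * (LINT x|M. norm (w n x - u x))"
      proof (rule always_eventually, rule allI)
        fix n
        note iw = W1p_integrable(1)[OF wW[of n]]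
        note id = Bochner_Integration.integrable_diff[OF iw iu]
        have "(LINT x|M. w n x *\<^sub>R G x) - (LINT x|M. u x *\<^sub>R G x) = (LINT x|M. (w n x - u x) *\<^sub>R G x)"
          unfolding scaleR_diff_left by (rule Bochner_Integration.integral_diff[OF iG[OF iw] iG[OF iu], symmetric])
        also have "norm \<dots> \<le> (LINT x|M. norm ((w n x - u x) *\<^sub>R G x))"
          by (rule integral_norm_bound)
        also have "\<dots> \<le> (LINT x|M. B * norm (w n x - u x))"
        proof (rule integral_mono)
          show "integrable M (\<lambda>x. norm ((w n x - u x) *\<^sub>R G x))" using iG[OF id] by (rule integrable_norm)
          show "integrable M (\<lambda>x. B * norm (w n x - u x))" using id by simp
          show "norm ((w n x - u x) *\<^sub>R G x) \<le> B * norm (w n x - u x)" for x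
            using mult_right_mono[OF B(2)[of x], of "\<bar>w n x - u x\<bar>"] by (simp add: mult.commute)
        qed
        finally show "norm ((LINT x|M. w n x *\<^sub>R G x) - (LINT x|M. u x *\<^sub>R G x)) \<le> B * (LINT x|M. norm (w n x - u x))"
          by simp
      qed
      show "(\<lambda>n. B * (LINT x|M. norm (w n x - u x))) \<longlonglongrightarrow> 0"
        using tendsto_mult_left[OF u1, of B] by simp
    qed
    have l2: "(\<lambda>n. LINT x|M. \<phi> x *\<^sub>R D (w n) x) \<longlonglongrightarrow> (LINT x|M. \<phi> x *\<^sub>R g x)"
    proof (rule LIM_zero_cancel, rule Lim_null_comparison)
      show "\<forall>\<^sub>F n in sequentially. norm ((LINT x|M. \<phi> x *\<^sub>R D (w n) x) - (LINT x|M. \<phi> x *\<^sub>R g x)) \<le> B * (LINT x|M. norm (D (w n) x - g x))"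
      proof (rule always_eventually, rule allI)
        fix n
        note iw = W1p_integrable(2)[OF wW[of n]]
        note id = Bochner_Integration.integrable_diff[OF iw ig]
        have "(LINT x|M. \<phi> x *\<^sub>R D (w n) x) - (LINT x|M. \<phi> x *\<^sub>R g x) = (LINT x|M. \<phi> x *\<^sub>R (D (w n) x - g x))"
          unfolding scaleR_diff_right by (rule Bochner_Integration.integral_diff[OF i\<phi>[OF iw] i\<phi>[OF ig], symmetric])
        also have "norm \<dots> \<le> (LINT x|M. norm (\<phi> x *\<^sub>R (D (w n) x - g x)))"
          by (rule integral_norm_bound)
        also have "\<dots> \<le> (LINT x|M. B * norm (D (w n) x - g x))"
        proof (rule integral_mono)
          show "integrable M (\<lambda>x. norm (\<phi> x *\<^sub>R (D (w n) x - g x)))" using i\<phi>[OF id] by (rule integrable_norm)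
          show "integrable M (\<lambda>x. B * norm (D (w n) x - g x))" using id by simp
          show "norm (\<phi> x *\<^sub>R (D (w n) x - g x)) \<le> B * norm (D (w n) x - g x)" for x
            using mult_right_mono[OF B(1)[of x], of "norm (D (w n) x - g x)"] by simp
        qed
        finally show "norm ((LINT x|M. \<phi> x *\<^sub>R D (w n) x) - (LINT x|M. \<phi> x *\<^sub>R g x)) \<le> B * (LINT x|M. norm (D (w n) x - g x))"
          by simp
      qed
      show "(\<lambda>n. B * (LINT x|M. norm (D (w n) x - g x))) \<longlonglongrightarrow> 0"
        using tendsto_mult_left[OF g1, of B] by simp
    qed
    have "(\<lambda>n. LINT x|M. w n x *\<^sub>R G x) \<longlonglongrightarrow> - (LINT x|M. \<phi> x *\<^sub>R g x)"
      using tendsto_minus[OF l2] by (simp only: W1p_by_parts[OF wW G])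
    with l1 show ?thesis by (rule LIMSEQ_unique)
  qed
  have uW: "u \<in> W1p \<Omega> p" "AE x in M. D u x = g x"
    using W1pI[OF u(1) g(1) parts] by blast+
  have Deq: "(LINT x|M. norm (D (w n) x - D u x) powr p) = (LINT x|M. norm (D (w n) x - g x) powr p)" for n
  proof (rule integral_cong_AE)
    show "AE x in M. norm (D (w n) x - D u x) powr p = norm (D (w n) x - g x) powr p"
      using uW(2) by eventually_elim simp
  qed (use Lp_fun_measurable[OF L(2)[of n]] Lp_fun_measurable[OF W1p_Lp(2)[OF uW(1)]] Lp_fun_measurable[OF g(1)] in simp_all)
  have Dlim: "(\<lambda>n. LINT x|M. norm (D (w n) x - D u x) powr p) \<longlonglongrightarrow> 0"
    using g(2) by (simp only: Deq)
  have pow: "W1p_power (\<lambda>x. u x - w n x) = (LINT x|M. norm (w n x - u x) powr p) + (LINT x|M. norm (D (w n) x - D u x) powr p)" for n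
  proof -
    have "(LINT x|M. norm (D (\<lambda>x. u x - w n x) x) powr p) = (LINT x|M. norm (D u x - D (w n) x) powr p)"
      using W1p_diff[OF uW(1) wW[of n]] Lp_fun_measurable[OF L(2)[of n]] Lp_fun_measurable[OF W1p_Lp(2)[OF uW(1)]]
      by (intro integral_weak_gradient_cong) simp_all
    then show ?thesis by (simp add: W1p_power_def norm_minus_commute abs_minus_commute)
  qed
  have powlim: "(\<lambda>n. W1p_power (\<lambda>x. u x - w n x)) \<longlonglongrightarrow> 0"
    unfolding pow using tendsto_add[OF u(2) Dlim] by simp
  have "u \<in> W1p_0 \<Omega> p"
  proof (rule W1p_0_closed[OF uW(1)])
    fix \<epsilon> :: real assume "\<epsilon> > 0"
    from order_tendstoD(2)[OF powlim this] obtain n where "W1p_power (\<lambda>x. u x - w n x) < \<epsilon>"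
      by (auto simp: eventually_sequentially)
    then show "\<exists>w\<in>W1p_0 \<Omega> p. W1p_power (\<lambda>x. u x - w x) < \<epsilon>" using w by blast
  qed
  then show ?thesis using that Dlim by blast
qed

end

section \<open>Uniformly convex energies of vector fields\<close>

text \<open>The energy of a vector field \<open>v\<close> is \<open>\<integral> Q x (v x)\<close>, where \<open>A x\<close> is a continuous subgradient of \<open>Q x\<close>,
uniformly monotone through the modulus \<open>k\<close>. Measurability is assumed for compositions because this
form is insensitive to a null set of exceptional points \<open>x\<close>. An upper bound for \<open>Q\<close> follows from the
growth of \<open>A\<close> and \<open>Q x 0 = 0\<close>.\<close>

locale convex_energy = finite_measure M
  for M :: "'a measure" +
  fixes p :: real and Q :: "'a \<Rightarrow> 'b::euclidean_space \<Rightarrow> real" and A :: "'a \<Rightarrow> 'b \<Rightarrow> 'b" and k C :: real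
  assumes exponent_gt_1: "1 < p" and k_pos: "0 < k" and C_nonneg: "0 \<le> C"
    and Q_measurable: "\<And>v. v \<in> borel_measurable M \<Longrightarrow> (\<lambda>x. Q x (v x)) \<in> borel_measurable M"
    and A_measurable: "\<And>v. v \<in> borel_measurable M \<Longrightarrow> (\<lambda>x. A x (v x)) \<in> borel_measurable M"
    and strongly_convex: "AE x in M. \<forall>a b. Q x a + A x a \<bullet> (b - a) + k * norm (b - a) powr p \<le> Q x b"
    and A_continuous: "AE x in M. continuous_on UNIV (A x)"
    and Q_nonneg: "AE x in M. \<forall>a. 0 \<le> Q x a"
    and Q_zero: "AE x in M. Q x 0 = 0"
    and A_growth: "AE x in M. \<forall>a. norm (A x a) \<le> C * (1 + norm a powr (p - 1))"
begin

lemma exponent_ge: "p \<ge> 0" "p \<ge> 1" "p > 0" using exponent_gt_1 by auto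

definition energy :: "('a \<Rightarrow> 'b) \<Rightarrow> real" where
  "energy v = (LINT x|M. Q x (v x))"

definition pairing :: "('a \<Rightarrow> 'b) \<Rightarrow> ('a \<Rightarrow> 'b) \<Rightarrow> real" where
  "pairing v h = (LINT x|M. A x (v x) \<bullet> h x)"

text \<open>For \<open>\<epsilon> = 1\<close> this gives integrability and majorants, for small \<open>\<epsilon>\<close> it gives continuity in \<open>h\<close>.\<close>

lemma pairing_bound:
  assumes "\<epsilon> > 0"
  shows "AE x in M. \<forall>a h. \<bar>A x a \<bullet> h\<bar> \<le> C * (\<epsilon> * (1 + norm a powr p) + 2 * \<epsilon> powr (1 - p) * norm h powr p)"
  using A_growth
proof eventually_elim
  case (elim x)
  show ?case
  proof (intro allI)
    fix a h
    have "\<bar>A x a \<bullet> h\<bar> \<le> norm (A x a) * norm h" by (rule Cauchy_Schwarz_ineq2)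
    also have "\<dots> \<le> C * (1 + norm a powr (p - 1)) * norm h"
      using elim by (intro mult_right_mono) auto
    also have "\<dots> = C * (norm h + norm a powr (p - 1) * norm h)" by (simp add: algebra_simps)
    also have "\<dots> \<le> C * ((\<epsilon> + \<epsilon> powr (1 - p) * norm h powr p) + (\<epsilon> * norm a powr p + \<epsilon> powr (1 - p) * norm h powr p))"
      using Young_powr[of 1 "norm h" \<epsilon> p] Young_powr[of "norm a" "norm h" \<epsilon> p] assms exponent_ge C_nonneg
      by (intro mult_left_mono add_mono) auto
    also have "\<dots> = C * (\<epsilon> * (1 + norm a powr p) + 2 * \<epsilon> powr (1 - p) * norm h powr p)"
      by (simp add: algebra_simps)
    finally show "\<bar>A x a \<bullet> h\<bar> \<le> C * (\<epsilon> * (1 + norm a powr p) + 2 * \<epsilon> powr (1 - p) * norm h powr p)" .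
  qed
qed

lemma pairing_integrable:
  assumes v: "Lp_fun M p v" and h: "Lp_fun M p h"
  shows "integrable M (\<lambda>x. A x (v x) \<bullet> h x)"
proof (rule Bochner_Integration.integrable_bound)
  show "integrable M (\<lambda>x. C * (1 * (1 + norm (v x) powr p) + 2 * 1 powr (1 - p) * norm (h x) powr p))"
    using Lp_fun_integrable_powr[OF v] Lp_fun_integrable_powr[OF h] by simp
  show "(\<lambda>x. A x (v x) \<bullet> h x) \<in> borel_measurable M"
    using A_measurable[OF Lp_fun_measurable[OF v]] Lp_fun_measurable[OF h] by simp
  show "AE x in M. norm (A x (v x) \<bullet> h x)
      \<le> norm (C * (1 * (1 + norm (v x) powr p) + 2 * 1 powr (1 - p) * norm (h x) powr p))"
    using pairing_bound[OF zero_less_one] by eventually_elim (metis abs_ge_self order_trans real_norm_def)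
qed

text \<open>The subgradient inequality from \<open>a\<close> to \<open>0\<close> reads \<open>Q x a \<le> A x a \<bullet> a\<close>.\<close>

lemma Q_integrable:
  assumes v: "Lp_fun M p v" shows "integrable M (\<lambda>x. Q x (v x))"
proof (rule Bochner_Integration.integrable_bound[OF pairing_integrable[OF v v]])
  show "(\<lambda>x. Q x (v x)) \<in> borel_measurable M" by (rule Q_measurable[OF Lp_fun_measurable[OF v]])
  show "AE x in M. norm (Q x (v x)) \<le> norm (A x (v x) \<bullet> v x)"
    using strongly_convex Q_nonneg Q_zero
  proof eventually_elim
    case (elim x)
    have "Q x (v x) + A x (v x) \<bullet> (0 - v x) + k * norm (0 - v x) powr p \<le> Q x 0" using elim(1) by blast
    moreover have "0 \<le> k * norm (0 - v x) powr p" using k_pos by simp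
    moreover have "0 \<le> Q x (v x)" using elim(2) by blast
    ultimately show ?case using elim(3) by simp
  qed
qed

lemma energy_nonneg: "0 \<le> energy v"
  unfolding energy_def by (rule integral_nonneg_AE) (use Q_nonneg in eventually_elim, blast)

lemma energy_zero: "energy (\<lambda>x. 0) = 0"
  unfolding energy_def by (rule integral_eq_zero_AE) (rule Q_zero)

lemma energy_cong:
  assumes "v \<in> borel_measurable M" "w \<in> borel_measurable M" "AE x in M. v x = w x"
  shows "energy v = energy w"
  unfolding energy_def
proof (rule integral_cong_AE)
  show "AE x in M. Q x (v x) = Q x (w x)" using assms(3) by eventually_elim simp
qed (use assms Q_measurable in auto)

lemma pairing_cong:
  assumes m: "v \<in> borel_measurable M" "w \<in> borel_measurable M" "g \<in> borel_measurable M" "h \<in> borel_measurable M"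
    and "AE x in M. v x = w x" "AE x in M. g x = h x"
  shows "pairing v g = pairing w h"
  unfolding pairing_def
proof (rule integral_cong_AE)
  show "AE x in M. A x (v x) \<bullet> g x = A x (w x) \<bullet> h x" using assms(5,6) by eventually_elim simp
qed (use A_measurable[OF m(1)] A_measurable[OF m(2)] m in simp_all)

lemma pairing_combination:
  assumes "Lp_fun M p v" "Lp_fun M p g" "Lp_fun M p h"
  shows "pairing v (\<lambda>x. a *\<^sub>R g x + b *\<^sub>R h x) = a * pairing v g + b * pairing v h"
  unfolding pairing_def inner_add_right inner_scaleR_right
  using pairing_integrable[OF assms(1,2)] pairing_integrable[OF assms(1,3)] by simp

lemma energy_strongly_convex:
  assumes v: "Lp_fun M p v" and w: "Lp_fun M p w"
  shows "energy v + pairing v (\<lambda>x. w x - v x) + k * (LINT x|M. norm (w x - v x) powr p) \<le> energy w"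
proof -
  note d = Lp_fun_diff[OF w v exponent_ge(1)]
  note i = Q_integrable[OF v] pairing_integrable[OF v d] Lp_fun_integrable_powr[OF d]
  have "energy v + pairing v (\<lambda>x. w x - v x) + k * (LINT x|M. norm (w x - v x) powr p)
      = (LINT x|M. Q x (v x) + A x (v x) \<bullet> (w x - v x) + k * norm (w x - v x) powr p)"
    using i by (simp add: energy_def pairing_def)
  also have "\<dots> \<le> energy w"
    unfolding energy_def
  proof (rule integral_mono_AE)
    show "AE x in M. Q x (v x) + A x (v x) \<bullet> (w x - v x) + k * norm (w x - v x) powr p \<le> Q x (w x)"
      using strongly_convex by eventually_elim blast
  qed (use i Q_integrable[OF w] in auto)
  finally show ?thesis .
qed

lemma energy_subgradient:
  assumes v: "Lp_fun M p v" and w: "Lp_fun M p w"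
  shows "energy v + pairing v (\<lambda>x. w x - v x) \<le> energy w"
proof -
  have "0 \<le> k * (LINT x|M. norm (w x - v x) powr p)" using k_pos by simp
  then show ?thesis using energy_strongly_convex[OF assms] by linarith
qed

text \<open>Strong convexity at the midpoint, applied towards both ends: the linear terms cancel because the two
displacements are opposite.\<close>

lemma energy_midpoint:
  assumes v: "Lp_fun M p v" and w: "Lp_fun M p w"
  shows "2 * energy (\<lambda>x. (1/2) *\<^sub>R v x + (1/2) *\<^sub>R w x) + 2 * k * (1/2) powr p * (LINT x|M. norm (v x - w x) powr p)
    \<le> energy v + energy w"
proof -
  define m where "m x = (1/2) *\<^sub>R v x + (1/2) *\<^sub>R w x" for x
  have m: "Lp_fun M p m"
    unfolding m_def by (rule Lp_fun_add[OF Lp_fun_scaleR[OF v] Lp_fun_scaleR[OF w] exponent_ge(1)])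
  have vm: "v x - m x = (1/2) *\<^sub>R (v x - w x)" and wm: "w x - m x = (-(1/2)) *\<^sub>R (v x - w x)" for x
  proof -
    have "v x = (1/2) *\<^sub>R v x + (1/2) *\<^sub>R v x" "w x = (1/2) *\<^sub>R w x + (1/2) *\<^sub>R w x"
      by (simp_all flip: scaleR_add_left)
    then show "v x - m x = (1/2) *\<^sub>R (v x - w x)" "w x - m x = (-(1/2)) *\<^sub>R (v x - w x)"
      by (simp_all add: m_def algebra_simps)
  qed
  note d = Lp_fun_diff[OF v w exponent_ge(1)]
  have pair: "pairing m (\<lambda>x. c *\<^sub>R (v x - w x)) = c * pairing m (\<lambda>x. v x - w x)" for c
    using pairing_combination[OF m d d, of c 0] by simp
  have pow: "(LINT x|M. norm (c *\<^sub>R (v x - w x)) powr p) = \<bar>c\<bar> powr p * (LINT x|M. norm (v x - w x) powr p)" for c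
    by (simp add: powr_mult)
  have "energy m + pairing m (\<lambda>x. v x - m x) + k * (LINT x|M. norm (v x - m x) powr p) \<le> energy v"
    by (rule energy_strongly_convex[OF m v])
  moreover have "energy m + pairing m (\<lambda>x. w x - m x) + k * (LINT x|M. norm (w x - m x) powr p) \<le> energy w"
    by (rule energy_strongly_convex[OF m w])
  ultimately have "2 * energy m + 2 * k * (1/2) powr p * (LINT x|M. norm (v x - w x) powr p) \<le> energy v + energy w"
    unfolding vm wm pair pow by simp
  then show ?thesis unfolding m_def[abs_def] .
qed

lemma pairing_tendsto_0:
  assumes v: "Lp_fun M p v" and h: "\<And>n. Lp_fun M p (h n)"
    and lim: "(\<lambda>n. LINT x|M. norm (h n x) powr p) \<longlonglongrightarrow> 0"
  shows "(\<lambda>n. pairing v (h n)) \<longlonglongrightarrow> 0"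
proof (rule LIMSEQ_I)
  fix e :: real assume "e > 0"
  define V where "V = C * (LINT x|M. 1 + norm (v x) powr p)"
  have V: "V \<ge> 0" using C_nonneg by (simp add: V_def)
  define \<epsilon> where "\<epsilon> = e / (2 * (V + 1))"
  have \<epsilon>: "\<epsilon> > 0" using \<open>e > 0\<close> V by (simp add: \<epsilon>_def)
  have eV: "\<epsilon> * V \<le> e / 2" using V \<open>e > 0\<close> by (simp add: \<epsilon>_def field_simps)
  have bound: "\<bar>pairing v (h n)\<bar> \<le> \<epsilon> * V + (C * 2 * \<epsilon> powr (1 - p)) * (LINT x|M. norm (h n x) powr p)" for n
  proof -
    note i = Lp_fun_integrable_powr[OF v] Lp_fun_integrable_powr[OF h[of n]]
    have "\<bar>pairing v (h n)\<bar> \<le> (LINT x|M. \<bar>A x (v x) \<bullet> h n x\<bar>)"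
      unfolding pairing_def by (rule integral_abs_bound)
    also have "\<dots> \<le> (LINT x|M. C * (\<epsilon> * (1 + norm (v x) powr p) + 2 * \<epsilon> powr (1 - p) * norm (h n x) powr p))"
    proof (rule integral_mono_AE)
      show "integrable M (\<lambda>x. \<bar>A x (v x) \<bullet> h n x\<bar>)"
        using pairing_integrable[OF v h] by (rule integrable_abs)
      show "AE x in M. \<bar>A x (v x) \<bullet> h n x\<bar> \<le> C * (\<epsilon> * (1 + norm (v x) powr p) + 2 * \<epsilon> powr (1 - p) * norm (h n x) powr p)"
        using pairing_bound[OF \<epsilon>] by eventually_elim blast
    qed (use i in simp)
    also have "\<dots> = \<epsilon> * V + (C * 2 * \<epsilon> powr (1 - p)) * (LINT x|M. norm (h n x) powr p)"
      using i by (simp add: V_def algebra_simps)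
    finally show ?thesis .
  qed
  have "(\<lambda>n. (C * 2 * \<epsilon> powr (1 - p)) * (LINT x|M. norm (h n x) powr p)) \<longlonglongrightarrow> 0"
    using tendsto_mult_left[OF lim, of "C * 2 * \<epsilon> powr (1 - p)"] by simp
  then have "\<forall>\<^sub>F n in sequentially. (C * 2 * \<epsilon> powr (1 - p)) * (LINT x|M. norm (h n x) powr p) < e / 2"
    using order_tendstoD(2) \<open>e > 0\<close> half_gt_zero by blast
  then obtain N where N: "\<And>n. n \<ge> N \<Longrightarrow> (C * 2 * \<epsilon> powr (1 - p)) * (LINT x|M. norm (h n x) powr p) < e / 2"
    by (auto simp: eventually_sequentially)
  have "norm (pairing v (h n) - 0) < e" if "n \<ge> N" for n
    using bound[of n] N[OF that] eV by simp
  then show "\<exists>no. \<forall>n\<ge>no. norm (pairing v (h n) - 0) < e" by blast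
qed

text \<open>The subgradient inequality at the limit \<open>w\<close> bounds the energies from below by \<open>energy w\<close> plus a term
that tends to zero.\<close>

lemma energy_lower_semicontinuous:
  assumes v: "\<And>n. Lp_fun M p (v n)" and w: "Lp_fun M p w"
    and lim: "(\<lambda>n. LINT x|M. norm (v n x - w x) powr p) \<longlonglongrightarrow> 0"
    and L: "(\<lambda>n. energy (v n)) \<longlonglongrightarrow> L"
  shows "energy w \<le> L"
proof (rule LIMSEQ_le)
  note d = Lp_fun_diff[OF v w exponent_ge(1)]
  show "(\<lambda>n. energy w + pairing w (\<lambda>x. v n x - w x)) \<longlonglongrightarrow> energy w"
    using tendsto_add[OF tendsto_const pairing_tendsto_0[OF w d lim], of "energy w"] by simp
  show "\<exists>N. \<forall>n\<ge>N. energy w + pairing w (\<lambda>x. v n x - w x) \<le> energy (v n)"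
    using energy_subgradient[OF w v] by blast
qed (rule L)

text \<open>The subgradient inequality at \<open>v + t h\<close>, compared with minimality of \<open>v\<close>, gives
\<open>pairing (v + t h) h \<ge> 0\<close>. By continuity of \<open>A x\<close> the inequality persists as \<open>t\<close> tends to zero.\<close>

lemma first_variation_nonneg:
  assumes v: "Lp_fun M p v" and h: "Lp_fun M p h"
    and min: "\<And>t. t > 0 \<Longrightarrow> energy v \<le> energy (\<lambda>x. v x + t *\<^sub>R h x)"
  shows "0 \<le> pairing v h"
proof -
  define t where "t n = inverse (real (Suc n))" for n
  have t: "0 < t n" "t n \<le> 1" for n by (auto simp: t_def field_simps)
  have t0: "t \<longlonglongrightarrow> 0" unfolding t_def by (rule LIMSEQ_inverse_real_of_nat)
  define vt where "vt n x = v x + t n *\<^sub>R h x" for n x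
  have vt: "Lp_fun M p (vt n)" for n
    unfolding vt_def by (rule Lp_fun_add[OF v Lp_fun_scaleR[OF h] exponent_ge(1)])
  have "0 \<le> pairing (vt n) h" for n
  proof -
    have "energy (vt n) + pairing (vt n) (\<lambda>x. v x - vt n x) \<le> energy v"
      by (rule energy_subgradient[OF vt v])
    moreover have "(\<lambda>x. v x - vt n x) = (\<lambda>x. (- t n) *\<^sub>R h x + 0 *\<^sub>R h x)" by (simp add: vt_def)
    ultimately have "energy (vt n) + (- t n) * pairing (vt n) h \<le> energy v"
      using pairing_combination[OF vt h h, of n "- t n" 0] by simp
    moreover have "energy v \<le> energy (vt n)" using min[OF t(1)[of n]] unfolding vt_def[abs_def] .
    ultimately have "0 \<le> t n * pairing (vt n) h" by simp
    then show ?thesis using t(1)[of n] by (simp add: zero_le_mult_iff)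
  qed
  moreover have "(\<lambda>n. pairing (vt n) h) \<longlonglongrightarrow> pairing v h"
    unfolding pairing_def
  proof (rule integral_dominated_convergence)
    let ?w = "\<lambda>x. C * (1 * (1 + 2 powr p * (norm (v x) powr p + norm (h x) powr p)) + 2 * 1 powr (1 - p) * norm (h x) powr p)"
    show "integrable M ?w"
      using Lp_fun_integrable_powr[OF v] Lp_fun_integrable_powr[OF h] by simp
    show "(\<lambda>x. A x (v x) \<bullet> h x) \<in> borel_measurable M" "(\<lambda>x. A x (vt n x) \<bullet> h x) \<in> borel_measurable M" for n
      using pairing_integrable[OF v h] pairing_integrable[OF vt h] by auto
    show "AE x in M. (\<lambda>n. A x (vt n x) \<bullet> h x) \<longlonglongrightarrow> A x (v x) \<bullet> h x"
      using A_continuous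
    proof eventually_elim
      case (elim x)
      have "(\<lambda>n. vt n x) \<longlonglongrightarrow> v x + 0 *\<^sub>R h x"
        unfolding vt_def by (intro tendsto_intros t0)
      then have l: "(\<lambda>n. vt n x) \<longlonglongrightarrow> v x" by simp
      have "isCont (A x) (v x)" using elim by (simp add: continuous_on_eq_continuous_at)
      from isCont_tendsto_compose[OF this l] show ?case by (rule tendsto_inner[OF _ tendsto_const])
    qed
    show "AE x in M. norm (A x (vt n x) \<bullet> h x) \<le> ?w x" for n
      using pairing_bound[OF zero_less_one]
    proof eventually_elim
      case (elim x)
      have "norm (vt n x) powr p \<le> 2 powr p * (norm (v x) powr p + norm (t n *\<^sub>R h x) powr p)"
        unfolding vt_def by (rule norm_add_powr_le[OF exponent_ge(1)])
      also have "\<dots> \<le> 2 powr p * (norm (v x) powr p + norm (h x) powr p)"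
        using t[of n] exponent_ge by (intro mult_left_mono add_left_mono powr_mono2) (auto intro: mult_left_le_one_le)
      finally have "C * (1 * (1 + norm (vt n x) powr p) + 2 * 1 powr (1 - p) * norm (h x) powr p) \<le> ?w x"
        using C_nonneg by (intro mult_left_mono add_right_mono) auto
      moreover have "\<bar>A x (vt n x) \<bullet> h x\<bar> \<le> C * (1 * (1 + norm (vt n x) powr p) + 2 * 1 powr (1 - p) * norm (h x) powr p)"
        using elim by blast
      ultimately show ?case by simp
    qed
  qed
  ultimately show ?thesis by (simp add: LIMSEQ_le_const)
qed

end

section \<open>Integration of subgradients and measurability of Caratheodory functions\<close>

text \<open>Exchanging \<open>\<alpha>\<close> and \<open>\<beta>\<close> shows that \<open>d\<close> is increasing, hence integrable. Both \<open>E\<close> and the indefinite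
integral of \<open>d\<close> have increments over \<open>[\<alpha>, \<beta>]\<close> between \<open>(\<beta> - \<alpha>) d \<alpha>\<close> and \<open>(\<beta> - \<alpha>) d \<beta>\<close>. Over \<open>n\<close> equal steps the
discrepancies therefore telescope to at most \<open>(d 1 - d 0) / n\<close>.\<close>

lemma integral_subgradient_eq:
  fixes E d :: "real \<Rightarrow> real"
  assumes sub: "\<And>\<alpha> \<beta>. \<alpha> \<in> {0..1} \<Longrightarrow> \<beta> \<in> {0..1} \<Longrightarrow> E \<alpha> + (\<beta> - \<alpha>) * d \<alpha> \<le> E \<beta>"
  shows "(LBINT \<alpha>:{0..1}. d \<alpha>) = E 1 - E 0"
proof -
  have mono: "mono_on {0..1} d"
  proof (rule mono_onI)
    fix r s :: real assume rs: "r \<in> {0..1}" "s \<in> {0..1}" "r \<le> s"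
    have "0 \<le> (s - r) * (d s - d r)" using sub[OF rs(1,2)] sub[OF rs(2,1)] by (simp add: algebra_simps)
    then show "d r \<le> d s" using rs(3) by (cases "r = s") (auto simp: zero_le_mult_iff)
  qed
  have meas: "set_borel_measurable lborel {0..1} d"
  proof -
    have "d \<in> borel_measurable (restrict_space borel {0..1})"
      by (rule borel_measurable_mono_on_fnc[OF mono])
    then show ?thesis
      by (subst (asm) borel_measurable_restrict_space_iff) (auto simp: set_borel_measurable_def)
  qed
  have int: "set_integrable lborel {0..1} d"
    unfolding set_integrable_def
  proof (rule integrableI_bounded_set[where A="{0..1}" and B="\<bar>d 0\<bar> + \<bar>d 1\<bar>"])
    show "AE x in lborel. x \<in> {0..1} \<longrightarrow> norm (indicator {0..1} x *\<^sub>R d x) \<le> \<bar>d 0\<bar> + \<bar>d 1\<bar>"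
    proof (intro AE_I2 impI)
      fix x :: real assume x: "x \<in> {0..1}"
      then have "d 0 \<le> d x" "d x \<le> d 1" using mono_onD[OF mono] by auto
      then show "norm (indicator {0..1} x *\<^sub>R d x) \<le> \<bar>d 0\<bar> + \<bar>d 1\<bar>" using x by simp
    qed
  qed (use meas in \<open>auto simp: set_borel_measurable_def\<close>)
  have HK: "d integrable_on {0..1}" "(LBINT \<alpha>:{0..1}. d \<alpha>) = integral {0..1} d"
    using set_borel_integral_eq_integral[OF int] by auto
  define F where "F \<beta> = E \<beta> - integral {0..\<beta>} d" for \<beta>
  have step: "\<bar>F \<beta> - F \<alpha>\<bar> \<le> (\<beta> - \<alpha>) * (d \<beta> - d \<alpha>)" if ab: "0 \<le> \<alpha>" "\<alpha> \<le> \<beta>" "\<beta> \<le> 1" for \<alpha> \<beta>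
  proof -
    have i: "d integrable_on {0..\<beta>}" "d integrable_on {\<alpha>..\<beta>}"
      by (rule integrable_subinterval_real[OF HK(1)], use ab in auto)+
    have "integral {0..\<alpha>} d + integral {\<alpha>..\<beta>} d = integral {0..\<beta>} d"
      by (rule Henstock_Kurzweil_Integration.integral_combine) (use ab i in auto)
    moreover have "integral {\<alpha>..\<beta>} (\<lambda>_. d \<alpha>) \<le> integral {\<alpha>..\<beta>} d"
      by (rule integral_le) (use i mono_onD[OF mono] ab in auto)
    moreover have "integral {\<alpha>..\<beta>} d \<le> integral {\<alpha>..\<beta>} (\<lambda>_. d \<beta>)"
      by (rule integral_le) (use i mono_onD[OF mono] ab in auto)
    moreover have "E \<alpha> + (\<beta> - \<alpha>) * d \<alpha> \<le> E \<beta>" "E \<beta> + (\<alpha> - \<beta>) * d \<beta> \<le> E \<alpha>"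
      using sub[of \<alpha> \<beta>] sub[of \<beta> \<alpha>] ab by auto
    ultimately show ?thesis
      using ab unfolding F_def by (simp add: abs_le_iff algebra_simps)
  qed
  have "\<bar>F 1 - F 0\<bar> \<le> (d 1 - d 0) * inverse (real (Suc n))" for n
  proof -
    define h where "h = inverse (real (Suc n))"
    have h: "0 \<le> h" "h * real (Suc n) = 1" by (auto simp: h_def)
    have le1: "h * real i \<le> 1" if "i \<le> Suc n" for i
      using mult_left_mono[OF _ h(1), of "real i" "real (Suc n)"] that h(2) by simp
    have "F 1 - F 0 = (\<Sum>i<Suc n. F (h * real (Suc i)) - F (h * real i))"
      by (subst sum_lessThan_telescope) (simp only: h(2), simp)
    also have "\<bar>\<dots>\<bar> \<le> (\<Sum>i<Suc n. \<bar>F (h * real (Suc i)) - F (h * real i)\<bar>)"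
      by (rule sum_abs)
    also have "\<dots> \<le> (\<Sum>i<Suc n. h * (d (h * real (Suc i)) - d (h * real i)))"
    proof (rule sum_mono)
      fix i assume "i \<in> {..<Suc n}"
      then have "Suc i \<le> Suc n" by simp
      then have "\<bar>F (h * real (Suc i)) - F (h * real i)\<bar> \<le> (h * real (Suc i) - h * real i) * (d (h * real (Suc i)) - d (h * real i))"
        using h(1) le1[of "Suc i"] \<open>Suc i \<le> Suc n\<close>
        by (intro step mult_nonneg_nonneg mult_left_mono) (simp_all del: of_nat_Suc add: of_nat_Suc[symmetric])
      also have "h * real (Suc i) - h * real i = h" by (simp add: algebra_simps)
      finally show "\<bar>F (h * real (Suc i)) - F (h * real i)\<bar> \<le> h * (d (h * real (Suc i)) - d (h * real i))" .
    qed
    also have "\<dots> = h * (\<Sum>i<Suc n. d (h * real (Suc i)) - d (h * real i))" by (rule sum_distrib_left[symmetric])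
    also have "(\<Sum>i<Suc n. d (h * real (Suc i)) - d (h * real i)) = d 1 - d 0"
      by (subst sum_lessThan_telescope) (simp only: h(2), simp)
    finally show ?thesis by (simp add: h_def mult.commute)
  qed
  moreover have "(\<lambda>n. (d 1 - d 0) * inverse (real (Suc n))) \<longlonglongrightarrow> (d 1 - d 0) * 0"
    by (intro tendsto_intros LIMSEQ_inverse_real_of_nat)
  ultimately have "\<bar>F 1 - F 0\<bar> \<le> (d 1 - d 0) * 0"
    by (intro LIMSEQ_le_const) auto
  then show ?thesis using HK(2) by (simp add: F_def)
qed

text \<open>By continuity the second argument may be rounded down to multiples of \<open>1 / (n + 1)\<close>, which leaves
countably many measurable functions.\<close>

lemma Caratheodory_measurable:
  fixes \<tau> :: "'a \<Rightarrow> real \<Rightarrow> real"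
  assumes meas: "\<And>E. (\<lambda>x. \<tau> x E) \<in> borel_measurable M" and cont: "\<And>x. continuous_on UNIV (\<tau> x)"
  shows "(\<lambda>z. \<tau> (fst z) (snd z)) \<in> borel_measurable (M \<Otimes>\<^sub>M borel)"
proof (rule borel_measurable_LIMSEQ_metric)
  let ?u = "\<lambda>n z. \<tau> (fst z) (real_of_int \<lfloor>real (Suc n) * snd z\<rfloor> / real (Suc n))"
  show "?u n \<in> borel_measurable (M \<Otimes>\<^sub>M borel)" for n
  proof (rule measurable_compose_countable[where f="\<lambda>i z. \<tau> (fst z) (real_of_int i / real (Suc n))"])
    show "(\<lambda>z. \<tau> (fst z) (real_of_int i / real (Suc n))) \<in> borel_measurable (M \<Otimes>\<^sub>M borel)" for i
      by (rule measurable_compose[OF measurable_fst meas])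
    show "(\<lambda>z. \<lfloor>real (Suc n) * snd z\<rfloor>) \<in> measurable (M \<Otimes>\<^sub>M borel) (count_space UNIV)"
      by (rule measurable_compose[OF _ measurable_real_floor]) measurable
  qed
  fix z :: "'a \<times> real" assume "z \<in> space (M \<Otimes>\<^sub>M borel)"
  have "(\<lambda>n. real_of_int \<lfloor>real (Suc n) * snd z\<rfloor> / real (Suc n)) \<longlonglongrightarrow> snd z"
  proof (rule LIM_zero_cancel, rule Lim_null_comparison[OF _ LIMSEQ_inverse_real_of_nat])
    have "norm (real_of_int \<lfloor>real (Suc n) * snd z\<rfloor> / real (Suc n) - snd z) \<le> inverse (real (Suc n))" for n
    proof -
      have "real_of_int \<lfloor>real (Suc n) * snd z\<rfloor> / real (Suc n) - snd z = (real_of_int \<lfloor>real (Suc n) * snd z\<rfloor> - real (Suc n) * snd z) / real (Suc n)"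
        by (simp add: field_simps)
      moreover have "\<bar>real_of_int \<lfloor>real (Suc n) * snd z\<rfloor> - real (Suc n) * snd z\<bar> \<le> 1" by linarith
      ultimately show ?thesis
        by (simp only: real_norm_def abs_divide inverse_eq_divide abs_of_nat divide_right_mono of_nat_0_le_iff)
    qed
    then show "\<forall>\<^sub>F n in sequentially. norm (real_of_int \<lfloor>real (Suc n) * snd z\<rfloor> / real (Suc n) - snd z) \<le> inverse (real (Suc n))"
      by simp
  qed
  moreover have "isCont (\<tau> (fst z)) (snd z)" using cont by (simp add: continuous_on_eq_continuous_at)
  ultimately show "(\<lambda>n. ?u n z) \<longlonglongrightarrow> \<tau> (fst z) (snd z)"
    by (rule isCont_tendsto_compose[rotated])
qed

section \<open>Minimizers with prescribed boundary values\<close>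

locale variational_problem = sobolev_domain \<Omega> p + convex_energy "lebesgue_on \<Omega>" p Q A k C
  for \<Omega> :: "'a::euclidean_space set" and p and Q :: "'a \<Rightarrow> 'a \<Rightarrow> real" and A k C
begin

definition boundary_class :: "('a \<Rightarrow> real) \<Rightarrow> ('a \<Rightarrow> real) set" where
  "boundary_class g = {v \<in> W1p \<Omega> p. (\<lambda>x. g x - v x) \<in> W1p_0 \<Omega> p}"

lemma boundary_class_W1p: "v \<in> boundary_class g \<Longrightarrow> v \<in> W1p \<Omega> p"
  by (simp add: boundary_class_def)

lemma zero_W1p_0: assumes "g \<in> W1p \<Omega> p" shows "(\<lambda>x. 0) \<in> W1p_0 \<Omega> p"
proof (rule W1p_0_closed)
  show z: "(\<lambda>x. 0) \<in> W1p \<Omega> p" using W1p_scale(1)[OF assms, of 0] by simp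
  have "(\<lambda>x. 0) \<in> C1_0 \<Omega>"
    by (auto simp: C1_0_def C1_with_gradient_def compactly_supported_in_def intro!: exI[of _ "\<lambda>x. 0"] GDERIV_const)
  moreover have "W1p_power (\<lambda>x. 0) = 0" using W1p_power_scale[OF z, of 0] by simp
  ultimately show "\<exists>w\<in>W1p_0 \<Omega> p. W1p_power (\<lambda>x. 0 - w x) < \<epsilon>" if "\<epsilon> > 0" for \<epsilon>
    using that C1_0_subset_W1p_0 by (intro bexI[of _ "\<lambda>x. 0"]) auto
qed

lemma boundary_class_self: "g \<in> W1p \<Omega> p \<Longrightarrow> g \<in> boundary_class g"
  using zero_W1p_0 by (auto simp: boundary_class_def)

lemma boundary_class_diff:
  assumes "u \<in> boundary_class g" "v \<in> boundary_class g"
  shows "(\<lambda>x. u x - v x) \<in> W1p_0 \<Omega> p"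
  using W1p_0_combination[of "\<lambda>x. g x - v x" "\<lambda>x. g x - u x" 1 "-1"] assms
  by (simp add: boundary_class_def)

lemma boundary_class_add:
  assumes "u \<in> boundary_class g" "w \<in> W1p_0 \<Omega> p"
  shows "(\<lambda>x. u x + t * w x) \<in> boundary_class g"
proof -
  have "(\<lambda>x. u x + t * w x) \<in> W1p \<Omega> p"
    using W1p_combination(1)[of u w 1 t] assms W1p_0_subset by (auto simp: boundary_class_def)
  moreover have "(\<lambda>x. g x - (u x + t * w x)) \<in> W1p_0 \<Omega> p"
    using W1p_0_combination[of "\<lambda>x. g x - u x" w 1 "-t"] assms by (simp add: boundary_class_def algebra_simps)
  ultimately show ?thesis by (simp add: boundary_class_def)
qed

lemma D_Lp: "u \<in> W1p \<Omega> p \<Longrightarrow> Lp_fun M p (D u)" by (rule W1p_Lp(2))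
lemma D_measurable: "u \<in> W1p \<Omega> p \<Longrightarrow> D u \<in> borel_measurable M" by (rule Lp_fun_measurable[OF D_Lp])

lemma energy_D_add:
  assumes "u \<in> W1p \<Omega> p" "w \<in> W1p \<Omega> p"
  shows "energy (D (\<lambda>x. a * u x + b * w x)) = energy (\<lambda>x. a *\<^sub>R D u x + b *\<^sub>R D w x)"
  using W1p_combination[OF assms, of a b] D_measurable[OF assms(1)] D_measurable[OF assms(2)]
  by (intro energy_cong D_measurable borel_measurable_add borel_measurable_scaleR) (use assms in auto)

text \<open>Midpoints of a minimizing sequence \<open>u n\<close> stay in the class, so uniform convexity makes the gradients Cauchy
in \<open>L\<^sup>p\<close>. The differences \<open>u n - g\<close> lie in \<open>W1p_0\<close>, which supplies a limit in the class.\<close>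

proposition exists_minimizer:
  assumes g: "g \<in> W1p \<Omega> p"
  obtains u where "u \<in> boundary_class g" "\<And>v. v \<in> boundary_class g \<Longrightarrow> energy (D u) \<le> energy (D v)"
proof -
  define I where "I = Inf ((\<lambda>v. energy (D v)) ` boundary_class g)"
  have bdd: "bdd_below ((\<lambda>v. energy (D v)) ` boundary_class g)"
    using energy_nonneg by (intro bdd_belowI[of _ 0]) auto
  have ne: "(\<lambda>v. energy (D v)) ` boundary_class g \<noteq> {}" using boundary_class_self[OF g] by auto
  have I_le: "I \<le> energy (D v)" if "v \<in> boundary_class g" for v
    unfolding I_def using that bdd by (intro cInf_lower) auto
  have "\<exists>v\<in>boundary_class g. energy (D v) < I + inverse (real (Suc n))" for n
  proof -
    have "Inf ((\<lambda>v. energy (D v)) ` boundary_class g) < I + inverse (real (Suc n))" by (simp add: I_def)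
    from cInf_lessD[OF ne this] show ?thesis by blast
  qed
  then obtain u where u: "\<And>n. u n \<in> boundary_class g" "\<And>n. energy (D (u n)) < I + inverse (real (Suc n))"
    by metis
  have uW: "u n \<in> W1p \<Omega> p" for n by (rule boundary_class_W1p[OF u(1)])
  define c where "c = 2 * k * (1/2) powr p"
  have c: "c > 0" using k_pos by (simp add: c_def)
  have near: "c * (LINT x|M. norm (D (u m) x - D (u n) x) powr p) \<le> inverse (real (Suc m)) + inverse (real (Suc n))" for m n
  proof -
    have "(\<lambda>x. (1/2) * u m x + (1/2) * u n x) = (\<lambda>x. u m x + (1/2) * (u n x - u m x))"
      by (simp add: field_simps)
    then have "(\<lambda>x. (1/2) * u m x + (1/2) * u n x) \<in> boundary_class g"
      using boundary_class_add[OF u(1)[of m] boundary_class_diff[OF u(1) u(1)], of "1/2" n m] by simp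
    from I_le[OF this] have "I \<le> energy (\<lambda>x. (1/2) *\<^sub>R D (u m) x + (1/2) *\<^sub>R D (u n) x)"
      by (simp only: energy_D_add[OF uW uW])
    then show ?thesis
      using energy_midpoint[OF D_Lp[OF uW] D_Lp[OF uW], of m n] u(2)[of m] u(2)[of n] unfolding c_def by linarith
  qed
  have cauchy: "\<exists>N. \<forall>m\<ge>N. \<forall>n\<ge>N. (LINT x|M. norm (D (u m) x - D (u n) x) powr p) \<le> e" if "e > 0" for e
  proof -
    have "c * e / 2 > 0" using c that by simp
    then obtain N where N: "inverse (real (Suc N)) < c * e / 2" using reals_Archimedean by blast
    have "(LINT x|M. norm (D (u m) x - D (u n) x) powr p) \<le> e" if mn: "m \<ge> N" "n \<ge> N" for m n
    proof -
      have "inverse (real (Suc m)) \<le> inverse (real (Suc N))" "inverse (real (Suc n)) \<le> inverse (real (Suc N))"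
        using mn by (auto intro!: le_imp_inverse_le)
      then have "c * (LINT x|M. norm (D (u m) x - D (u n) x) powr p) \<le> c * e"
        using near[of m n] N by linarith
      then show ?thesis using c by simp
    qed
    then show ?thesis by blast
  qed
  define w where "w n x = u n x - g x" for n x
  have w0: "w n \<in> W1p_0 \<Omega> p" for n
    unfolding w_def by (rule boundary_class_diff[OF u(1) boundary_class_self[OF g]])
  have Dw: "AE x in M. D (w n) x = D (u n) x - D g x" for n
    unfolding w_def by (rule W1p_diff(2)[OF uW g])
  have wW: "w n \<in> W1p \<Omega> p" for n using w0 W1p_0_subset by blast
  have Dwd: "(LINT x|M. norm (D (w m) x - D (w n) x) powr p) = (LINT x|M. norm (D (u m) x - D (u n) x) powr p)" for m n
  proof (rule integral_cong_AE)
    show "AE x in M. norm (D (w m) x - D (w n) x) powr p = norm (D (u m) x - D (u n) x) powr p"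
      using Dw[of m] Dw[of n] by eventually_elim simp
  qed (use D_measurable[OF wW[of m]] D_measurable[OF wW[of n]] D_measurable[OF uW[of m]] D_measurable[OF uW[of n]] in simp_all)
  have cauchy_w: "\<exists>N. \<forall>m\<ge>N. \<forall>n\<ge>N. (LINT x|M. norm (D (w m) x - D (w n) x) powr p) \<le> e" if "e > 0" for e
    unfolding Dwd by (rule cauchy[OF that])
  obtain w' where w': "w' \<in> W1p_0 \<Omega> p" "(\<lambda>n. LINT x|M. norm (D (w n) x - D w' x) powr p) \<longlonglongrightarrow> 0"
    using W1p_0_complete[OF w0 cauchy_w] by blast
  define v where "v x = g x + 1 * w' x" for x
  have v: "v \<in> boundary_class g"
    unfolding v_def by (rule boundary_class_add[OF boundary_class_self[OF g] w'(1)])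
  have w'W: "w' \<in> W1p \<Omega> p" using w'(1) W1p_0_subset by blast
  have Dv: "AE x in M. D v x = D g x + D w' x"
    using W1p_combination(2)[OF g w'W, of 1 1] unfolding v_def by simp
  have "(LINT x|M. norm (D (u n) x - D v x) powr p) = (LINT x|M. norm (D (w n) x - D w' x) powr p)" for n
  proof (rule integral_cong_AE)
    show "AE x in M. norm (D (u n) x - D v x) powr p = norm (D (w n) x - D w' x) powr p"
      using Dw[of n] Dv
    proof eventually_elim
      case (elim x)
      then have "D (u n) x - D v x = D (w n) x - D w' x" by (simp add: diff_diff_add)
      then show ?case by simp
    qed
  qed (use D_measurable[OF wW[of n]] D_measurable[OF w'W] D_measurable[OF uW[of n]] D_measurable[OF boundary_class_W1p[OF v]] in simp_all)
  then have lim: "(\<lambda>n. LINT x|M. norm (D (u n) x - D v x) powr p) \<longlonglongrightarrow> 0" using w'(2) by simp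
  have "(\<lambda>n. energy (D (u n))) \<longlonglongrightarrow> I"
  proof (rule real_tendsto_sandwich[where f="\<lambda>n. I" and h="\<lambda>n. I + inverse (real (Suc n))"])
    show "(\<lambda>n. I + inverse (real (Suc n))) \<longlonglongrightarrow> I"
      using tendsto_add[OF tendsto_const LIMSEQ_inverse_real_of_nat, of I] by simp
  qed (use I_le[OF u(1)] u(2) in \<open>auto intro!: always_eventually less_imp_le\<close>)
  from energy_lower_semicontinuous[OF D_Lp[OF uW] D_Lp[OF boundary_class_W1p[OF v]] lim this]
  have "energy (D v) \<le> I" .
  then show ?thesis using that[OF v] I_le by (meson order_trans)
qed

text \<open>The Euler-Lagrange equation in weak form: the first variation is nonnegative in the directions \<open>w\<close> and
\<open>-w\<close>.\<close>

lemma pairing_minimizer_W1p_0: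
  assumes u: "u \<in> boundary_class g" and min: "\<And>v. v \<in> boundary_class g \<Longrightarrow> energy (D u) \<le> energy (D v)"
    and w: "w \<in> W1p_0 \<Omega> p"
  shows "pairing (D u) (D w) = 0"
proof -
  have uW: "u \<in> W1p \<Omega> p" and wW: "w \<in> W1p \<Omega> p" using boundary_class_W1p[OF u] w W1p_0_subset by auto
  note L = D_Lp[OF uW] D_Lp[OF wW]
  have le: "energy (D u) \<le> energy (\<lambda>x. D u x + s *\<^sub>R D w x)" for s
    using min[OF boundary_class_add[OF u w, of s]] energy_D_add[OF uW wW, of 1 s] by simp
  have "0 \<le> pairing (D u) (\<lambda>x. c *\<^sub>R D w x)" for c
    by (rule first_variation_nonneg[OF L(1) Lp_fun_scaleR[OF L(2)]]) (use le in simp)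
  moreover have "pairing (D u) (\<lambda>x. c *\<^sub>R D w x) = c * pairing (D u) (D w)" for c
    using pairing_combination[OF L(1) L(2) L(2), of c 0] by simp
  ultimately have "0 \<le> c * pairing (D u) (D w)" for c by simp
  from this[of 1] this[of "-1"] show ?thesis by simp
qed

text \<open>The pairing of a minimizer with the gradient of \<open>v\<close> depends only on the boundary value of \<open>v\<close>; in
particular it is the same for all representatives.\<close>

lemma pairing_minimizer_boundary_class:
  assumes g: "g \<in> W1p \<Omega> p"
    and u: "u \<in> boundary_class h" and min: "\<And>v. v \<in> boundary_class h \<Longrightarrow> energy (D u) \<le> energy (D v)"
    and v: "v \<in> boundary_class (\<lambda>x. \<beta> * g x)"
  shows "pairing (D u) (D v) = \<beta> * pairing (D u) (D g)"
proof -
  note uW = boundary_class_W1p[OF u] and vW = boundary_class_W1p[OF v]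
  define w where "w x = \<beta> * g x - v x" for x
  have w: "w \<in> W1p_0 \<Omega> p" using v by (simp add: boundary_class_def w_def[abs_def])
  have wW: "w \<in> W1p \<Omega> p" using w W1p_0_subset by blast
  have "v = (\<lambda>x. \<beta> * g x + (-1) * w x)" by (simp add: w_def)
  then have "AE x in M. D v x = \<beta> *\<^sub>R D g x + (-1) *\<^sub>R D w x"
    using W1p_combination(2)[OF g wW, of \<beta> "-1"] by simp
  then have "pairing (D u) (D v) = pairing (D u) (\<lambda>x. \<beta> *\<^sub>R D g x + (-1) *\<^sub>R D w x)"
    using D_measurable[OF uW] D_measurable[OF vW] D_measurable[OF g] D_measurable[OF wW]
    by (intro pairing_cong borel_measurable_add borel_measurable_scaleR) auto
  also have "\<dots> = \<beta> * pairing (D u) (D g) + (-1) * pairing (D u) (D w)"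
    by (rule pairing_combination[OF D_Lp[OF uW] D_Lp[OF g] D_Lp[OF wW]])
  finally show ?thesis using pairing_minimizer_W1p_0[OF u min w] by simp
qed

text \<open>The minimal energy at \<open>\<alpha> g\<close>, as a function of \<open>\<alpha>\<close>, has the pairing as a subgradient: the displacement between
the minimizers for \<open>\<beta> g\<close> and \<open>\<alpha> g\<close> has boundary value \<open>(\<beta> - \<alpha>) g\<close>. At \<open>\<alpha> = 0\<close> the zero function is a
competitor, so the energy vanishes there.\<close>

proposition integral_pairing_eq_energy:
  assumes g: "g \<in> W1p \<Omega> p" and r: "r \<in> boundary_class g"
    and u: "\<And>\<alpha>. u \<alpha> \<in> boundary_class (\<lambda>x. \<alpha> * g x)"
    and min: "\<And>\<alpha> v. v \<in> boundary_class (\<lambda>x. \<alpha> * g x) \<Longrightarrow> energy (D (u \<alpha>)) \<le> energy (D v)"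
  shows "(LBINT \<alpha>:{0..1}. pairing (D (u \<alpha>)) (D r)) = energy (D (u 1))"
proof -
  note uW = boundary_class_W1p[OF u]
  have r': "r \<in> boundary_class (\<lambda>x. 1 * g x)" using r by simp
  have sub: "energy (D (u \<alpha>)) + (\<beta> - \<alpha>) * pairing (D (u \<alpha>)) (D r) \<le> energy (D (u \<beta>))" for \<alpha> \<beta>
  proof -
    note P = pairing_minimizer_boundary_class[OF g u min]
    have "pairing (D (u \<alpha>)) (\<lambda>x. D (u \<beta>) x - D (u \<alpha>) x) = pairing (D (u \<alpha>)) (D (u \<beta>)) - pairing (D (u \<alpha>)) (D (u \<alpha>))"
      using pairing_combination[OF D_Lp[OF uW] D_Lp[OF uW] D_Lp[OF uW], of \<alpha> 1 \<beta> "-1" \<alpha>] by simp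
    also have "\<dots> = (\<beta> - \<alpha>) * pairing (D (u \<alpha>)) (D r)"
      using P[OF _ u, of \<alpha> \<beta>] P[OF _ u, of \<alpha> \<alpha>] P[OF _ r', of \<alpha>] by (simp add: algebra_simps)
    finally show ?thesis using energy_subgradient[OF D_Lp[OF uW] D_Lp[OF uW], of \<alpha> \<beta>] by simp
  qed
  have "(LBINT \<alpha>:{0..1}. pairing (D (u \<alpha>)) (D r)) = energy (D (u 1)) - energy (D (u 0))"
    by (rule integral_subgradient_eq) (rule sub)
  moreover have "energy (D (u 0)) = 0"
  proof -
    have zW: "(\<lambda>x. 0) \<in> W1p \<Omega> p" using zero_W1p_0[OF g] W1p_0_subset by blast
    have "AE x in M. D (\<lambda>x. 0) x = 0" using W1p_scale(2)[OF g, of 0] by simp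
    then have "energy (D (\<lambda>x. 0)) = energy (\<lambda>x. 0)"
      by (intro energy_cong D_measurable zW) auto
    then have "energy (D (u 0)) \<le> 0"
      using min[of "\<lambda>x. 0" 0] boundary_class_self[OF zW] by (simp add: energy_zero)
    then show ?thesis using energy_nonneg[of "D (u 0)"] by simp
  qed
  ultimately show ?thesis by simp
qed

end

section \<open>Admissible conductivities\<close>

lemma AE_closure_imp_AE:
  fixes \<Omega> :: "'a::euclidean_space set"
  assumes "open \<Omega>" "AE x in lebesgue_on (closure \<Omega>). P x"
  shows "AE x in lebesgue_on \<Omega>. P x"
proof -
  have "AE x in lebesgue. x \<in> closure \<Omega> \<longrightarrow> P x"
    using assms(2) by (subst (asm) AE_restrict_space_iff) auto
  then have "AE x in lebesgue. x \<in> \<Omega> \<longrightarrow> P x"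
    by eventually_elim (use closure_subset in blast)
  then show ?thesis
    using assms(1) by (subst AE_restrict_space_iff) auto
qed

text \<open>The properties of \<open>E \<mapsto> \<sigma> x E\<close> that hold for almost every \<open>x\<close>. The flux \<open>s r * r\<close> is taken to be monotone
from \<open>r = 0\<close> on, where it vanishes whatever the value \<open>s 0\<close> is.\<close>

definition regular_at :: "(real \<Rightarrow> real) \<Rightarrow> bool" where
  "regular_at s \<longleftrightarrow> continuous_on {0..} s \<and> (\<forall>E>0. 0 \<le> s E) \<and>
     (\<forall>r t. 0 \<le> r \<longrightarrow> r \<le> t \<longrightarrow> s r * r \<le> s t * t)"

definition primitive :: "(real \<Rightarrow> real) \<Rightarrow> real \<Rightarrow> real" where
  "primitive s E = integral {0..E} (\<lambda>\<xi>. s \<xi> * \<xi>)"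

lemma Q_density_primitive: "Q_density \<sigma> x E = primitive (\<sigma> x) E"
  by (simp add: Q_density_def primitive_def)

context
  fixes s :: "real \<Rightarrow> real"
  assumes reg: "regular_at s"
begin

lemma regular_continuous: "continuous_on {0..} s"
  and regular_nonneg: "E > 0 \<Longrightarrow> 0 \<le> s E"
  and regular_flux_mono: "0 \<le> r \<Longrightarrow> r \<le> t \<Longrightarrow> s r * r \<le> s t * t"
  using reg by (auto simp: regular_at_def)

lemma flux_integrable: "0 \<le> r \<Longrightarrow> (\<lambda>\<xi>. s \<xi> * \<xi>) integrable_on {r..t}"
  by (intro integrable_continuous_real continuous_on_mult continuous_on_id continuous_on_subset[OF regular_continuous]) auto

lemma primitive_subgradient:
  assumes "0 \<le> r" "0 \<le> t"
  shows "primitive s r + s r * r * (t - r) \<le> primitive s t"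
proof (cases "r \<le> t")
  case True
  have "primitive s r + integral {r..t} (\<lambda>\<xi>. s \<xi> * \<xi>) = primitive s t"
    unfolding primitive_def
    by (rule Henstock_Kurzweil_Integration.integral_combine) (use assms True flux_integrable in auto)
  moreover have "integral {r..t} (\<lambda>_. s r * r) \<le> integral {r..t} (\<lambda>\<xi>. s \<xi> * \<xi>)"
    by (rule integral_le) (use assms flux_integrable regular_flux_mono in auto)
  ultimately show ?thesis using True by (simp add: algebra_simps)
next
  case False
  have "primitive s t + integral {t..r} (\<lambda>\<xi>. s \<xi> * \<xi>) = primitive s r"
    unfolding primitive_def
    by (rule Henstock_Kurzweil_Integration.integral_combine) (use assms False flux_integrable in auto)
  moreover have "integral {t..r} (\<lambda>\<xi>. s \<xi> * \<xi>) \<le> integral {t..r} (\<lambda>_. s r * r)"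
    by (rule integral_le) (use assms flux_integrable regular_flux_mono in auto)
  ultimately show ?thesis using False by (simp add: algebra_simps)
qed

lemma primitive_nonneg: "0 \<le> E \<Longrightarrow> 0 \<le> primitive s E"
  using primitive_subgradient[of 0 E] by (simp add: primitive_def)

text \<open>By the Cauchy-Schwarz inequality and \<open>s \<ge> 0\<close> this follows from the scalar subgradient inequality between the norms of \<open>a\<close> and
\<open>b\<close>.\<close>

lemma radial_subgradient:
  fixes a b :: "'a::real_inner"
  shows "primitive s (norm a) + (s (norm a) *\<^sub>R a) \<bullet> (b - a) \<le> primitive s (norm b)"
proof -
  have "(s (norm a) *\<^sub>R a) \<bullet> (b - a) \<le> s (norm a) * norm a * (norm b - norm a)"
  proof (cases "a = 0")
    case False
    have "(s (norm a) *\<^sub>R a) \<bullet> (b - a) = s (norm a) * (a \<bullet> b - norm a * norm a)"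
      by (simp add: inner_diff_right power2_norm_eq_inner[symmetric] power2_eq_square right_diff_distrib)
    also have "\<dots> \<le> s (norm a) * (norm a * norm b - norm a * norm a)"
      using regular_nonneg[of "norm a"] False norm_cauchy_schwarz[of a b] by (intro mult_left_mono) auto
    finally show ?thesis by (simp add: algebra_simps)
  qed simp
  then show ?thesis using primitive_subgradient[of "norm a" "norm b"] by simp
qed

text \<open>Going from \<open>a\<close> to \<open>b\<close> in two steps through the midpoint \<open>m\<close>, the subgradient inequalities add up to one
with the excess \<open>(A m - A a) \<bullet> (m - a)\<close>, which the monotonicity hypothesis bounds below. The factor
\<open>(1/2) powr p\<close> comes from \<open>norm (m - a) = norm (b - a) / 2\<close>.\<close>

lemma radial_strongly_convex:
  fixes a b :: "'a::real_inner"
  assumes H5: "\<And>E1 E2 :: 'a. c * norm (E2 - E1) powr p \<le> (s (norm E2) *\<^sub>R E2 - s (norm E1) *\<^sub>R E1) \<bullet> (E2 - E1)"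
  shows "primitive s (norm a) + (s (norm a) *\<^sub>R a) \<bullet> (b - a) + c * (1/2) powr p * norm (b - a) powr p \<le> primitive s (norm b)"
proof -
  define d where "d = (1/2) *\<^sub>R (b - a)"
  define m where "m = a + d"
  have two: "b - a = d + d" by (simp add: d_def flip: scaleR_add_left)
  then have b: "b - m = d" and m: "m - a = d" by (simp_all add: m_def algebra_simps)
  have "primitive s (norm a) + (s (norm a) *\<^sub>R a) \<bullet> (m - a) \<le> primitive s (norm m)"
    by (rule radial_subgradient)
  moreover have "primitive s (norm m) + (s (norm m) *\<^sub>R m) \<bullet> (b - m) \<le> primitive s (norm b)"
    by (rule radial_subgradient)
  moreover have "c * norm (m - a) powr p \<le> (s (norm m) *\<^sub>R m - s (norm a) *\<^sub>R a) \<bullet> (m - a)"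
    by (rule H5)
  moreover have "c * norm (m - a) powr p = c * ((1/2) powr p * norm (b - a) powr p)"
    unfolding m d_def by (simp add: powr_divide)
  moreover have "(s (norm a) *\<^sub>R a) \<bullet> (b - a) = (s (norm a) *\<^sub>R a) \<bullet> d + (s (norm a) *\<^sub>R a) \<bullet> d"
    unfolding two by (rule inner_add_right)
  ultimately show ?thesis unfolding b m inner_diff_left mult.assoc by linarith
qed

lemma radial_continuous:
  "continuous_on UNIV (\<lambda>a::'a::real_inner. s (norm a) *\<^sub>R a)"
  by (intro continuous_on_scaleR continuous_on_compose2[OF regular_continuous] continuous_on_norm continuous_on_id) auto

lemma radial_growth:
  fixes a :: "'a::real_inner"
  assumes p: "p \<ge> 2" and pos: "hi > 0" "E0 > 0"
    and upper: "\<And>E. E > 0 \<Longrightarrow> s E \<le> hi * max 1 ((E / E0) powr (p - 2))"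
  shows "norm (s (norm a) *\<^sub>R a) \<le> hi * (1 + E0 powr (2 - p)) * (1 + norm a powr (p - 1))"
proof (cases "a = 0")
  case True then show ?thesis using pos by simp
next
  case False
  define E where "E = norm a"
  have E: "E > 0" using False by (simp add: E_def)
  have E1: "E \<le> 1 + E powr (p - 1)"
  proof (cases "E \<le> 1")
    case False
    then have "E powr 1 \<le> E powr (p - 1)" using p by (intro powr_mono) auto
    then show ?thesis using E by simp
  qed (simp add: add_increasing2)
  have "(E / E0) powr (p - 2) * E = E0 powr (2 - p) * E powr (p - 1)"
  proof -
    have "(E / E0) powr (p - 2) = E powr (p - 2) * E0 powr (2 - p)"
      using E pos powr_minus_divide[of E0 "p - 2"] by (simp add: powr_divide)
    moreover have "E powr (p - 2) * E = E powr (p - 1)"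
      using powr_mult_base[of E "p - 2"] E by (simp add: mult.commute)
    ultimately show ?thesis by (simp add: algebra_simps)
  qed
  then have max_le: "max 1 ((E / E0) powr (p - 2)) * E \<le> (1 + E0 powr (2 - p)) * (1 + E powr (p - 1))"
  proof -
    assume eq: "(E / E0) powr (p - 2) * E = E0 powr (2 - p) * E powr (p - 1)"
    have "(1 + E0 powr (2 - p)) * (1 + E powr (p - 1))
        = (1 + E powr (p - 1)) + (E0 powr (2 - p) + E0 powr (2 - p) * E powr (p - 1))"
      by (simp add: algebra_simps)
    moreover have "0 \<le> E0 powr (2 - p)" "0 \<le> E0 powr (2 - p) * E powr (p - 1)" "0 \<le> E powr (p - 1)" by simp_all
    ultimately have "E \<le> (1 + E0 powr (2 - p)) * (1 + E powr (p - 1))"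
      "(E / E0) powr (p - 2) * E \<le> (1 + E0 powr (2 - p)) * (1 + E powr (p - 1))"
      using E1 eq by linarith+
    then show ?thesis by (simp add: max_def)
  qed
  have "norm (s (norm a) *\<^sub>R a) = s E * E" using regular_nonneg[OF E] by (simp add: E_def)
  also have "\<dots> \<le> hi * max 1 ((E / E0) powr (p - 2)) * E"
    using upper[OF E] E by (intro mult_right_mono) auto
  also have "\<dots> \<le> hi * ((1 + E0 powr (2 - p)) * (1 + E powr (p - 1)))"
    using max_le pos by (simp add: mult.assoc)
  finally show ?thesis by (simp add: E_def mult.assoc)
qed

end

lemma primitive_mono:
  assumes "regular_at s1" "regular_at s2" "\<And>E. E > 0 \<Longrightarrow> s1 E \<le> s2 E"
  shows "primitive s1 E \<le> primitive s2 E"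
  unfolding primitive_def
proof (rule integral_le)
  fix \<xi> assume "\<xi> \<in> {0..E}"
  then show "s1 \<xi> * \<xi> \<le> s2 \<xi> * \<xi>" using assms(3)[of \<xi>] by (cases "\<xi> = 0") (auto intro: mult_right_mono)
qed (use flux_integrable assms in auto)

context sobolev_domain
begin

lemma admissible_regular_at:
  assumes adm: "admissible \<Omega> p \<sigma>" and p2: "p \<ge> 2"
  shows "AE x in M. regular_at (\<sigma> x)"
proof -
  obtain \<sigma>lo \<sigma>hi E0 where c: "0 < \<sigma>lo" "\<sigma>lo \<le> \<sigma>hi" "0 < E0"
    "AE x in lebesgue_on (closure \<Omega>). \<forall>E>0. \<sigma>lo * (E / E0) powr (p - 2) \<le> \<sigma> x E \<and>
            \<sigma> x E \<le> \<sigma>hi * max 1 ((E / E0) powr (p - 2))"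
    using adm by (auto simp: admissible_def H4_def)
  have "AE x in M. \<forall>E>0. \<sigma>lo * (E / E0) powr (p - 2) \<le> \<sigma> x E \<and> \<sigma> x E \<le> \<sigma>hi * max 1 ((E / E0) powr (p - 2))"
    by (rule AE_closure_imp_AE[OF open_domain c(4)])
  moreover have "AE x in M. strict_mono_on {0<..} (\<lambda>E. \<sigma> x E * E)"
    using adm by (intro AE_closure_imp_AE[OF open_domain]) (simp add: admissible_def H2_def)
  moreover have "AE x in M. continuous_on {0..} (\<sigma> x)"
    using adm by (intro AE_closure_imp_AE[OF open_domain]) (simp add: admissible_def H3_def)
  ultimately show ?thesis
  proof eventually_elim
    case (elim x)
    have nn: "0 \<le> \<sigma> x E" if "E > 0" for E
    proof -
      have "0 \<le> \<sigma>lo * (E / E0) powr (p - 2)" using c(1) by simp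
      then show ?thesis using elim(1) that by force
    qed
    have "\<sigma> x r * r \<le> \<sigma> x t * t" if rt: "0 \<le> r" "r \<le> t" for r t
    proof -
      consider "r = t" | "r = 0" "t > 0" | "0 < r" "r < t" using rt by linarith
      then show ?thesis
      proof cases
        case 2 then show ?thesis using nn[of t] by simp
      next
        case 3 then show ?thesis using strict_mono_onD[OF elim(2), of r t] by simp
      qed simp
    qed
    with nn elim(3) show ?case by (simp add: regular_at_def)
  qed
qed

text \<open>Off a null set \<open>\<sigma> x\<close> is continuous. Redefined as \<open>0\<close> on that null set and extended constantly to
\<open>E < 0\<close> it becomes a Caratheodory function \<open>\<tau>\<close>, which is jointly measurable. Then the composition is measurable, and so is
the primitive, as a parameter integral with measurable upper limit.\<close>

lemma admissible_measurable:
  assumes adm: "admissible \<Omega> p \<sigma>" and p2: "p \<ge> 2" and v: "v \<in> borel_measurable M"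
  shows "(\<lambda>x. \<sigma> x (norm (v x))) \<in> borel_measurable M"
    "(\<lambda>x. primitive (\<sigma> x) (norm (v x))) \<in> borel_measurable M"
proof -
  define G where "G = {x \<in> \<Omega>. regular_at (\<sigma> x)}"
  have reg: "AE x in M. regular_at (\<sigma> x)" by (rule admissible_regular_at[OF adm p2])
  then have "{x \<in> space M. \<not> regular_at (\<sigma> x)} \<in> null_sets M" by (simp only: AE_iff_null_sets)
  then have "space M - {x \<in> space M. \<not> regular_at (\<sigma> x)} \<in> sets M" by (intro sets.compl_sets) auto
  also have "space M - {x \<in> space M. \<not> regular_at (\<sigma> x)} = G" by (auto simp: G_def)
  finally have G: "G \<in> sets M" .
  have AE_G: "AE x in M. x \<in> G" using reg AE_space by eventually_elim (simp add: G_def)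
  define \<tau> where "\<tau> x E = (if x \<in> G then \<sigma> x (max 0 E) else 0)" for x E
  have \<sigma>m: "(\<lambda>x. \<sigma> x E) \<in> borel_measurable M" if "E \<ge> 0" for E
  proof -
    have "(\<lambda>x. \<sigma> x E) \<in> borel_measurable (lebesgue_on (closure \<Omega>))"
      using adm that by (simp add: admissible_def H1_def)
    then show ?thesis by (rule measurable_restrict_mono) (rule closure_subset)
  qed
  have \<tau>m: "(\<lambda>z. \<tau> (fst z) (snd z)) \<in> borel_measurable (M \<Otimes>\<^sub>M borel)"
  proof (rule Caratheodory_measurable)
    show "(\<lambda>x. \<tau> x E) \<in> borel_measurable M" for E
      unfolding \<tau>_def using G by (intro measurable_If_set \<sigma>m) (auto simp: Int_absorb2 dest: sets.sets_into_space)
    show "continuous_on UNIV (\<tau> x)" for x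
    proof (cases "x \<in> G")
      case True
      then have "continuous_on {0..} (\<sigma> x)" by (simp add: G_def regular_at_def)
      then have "continuous_on UNIV (\<lambda>E. \<sigma> x (max 0 E))"
        by (rule continuous_on_compose2) (auto intro!: continuous_on_max continuous_on_const continuous_on_id)
      then show ?thesis using True by (simp add: \<tau>_def[abs_def])
    qed (simp add: \<tau>_def[abs_def])
  qed
  have nv: "(\<lambda>x. norm (v x)) \<in> borel_measurable M" using v by simp
  have "(\<lambda>x. \<tau> (fst (x, norm (v x))) (snd (x, norm (v x)))) \<in> borel_measurable M"
    by (rule measurable_compose[OF _ \<tau>m]) (use nv in simp)
  then have "(\<lambda>x. \<tau> x (norm (v x))) \<in> borel_measurable M" by simp
  then show "(\<lambda>x. \<sigma> x (norm (v x))) \<in> borel_measurable M"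
    by (rule borel_measurable_AE_cong) (use AE_G in eventually_elim, simp add: \<tau>_def)
  have \<tau>l: "(\<lambda>z. \<tau> (fst z) (snd z)) \<in> borel_measurable (M \<Otimes>\<^sub>M lborel)"
    using \<tau>m by (simp cong: measurable_cong_sets sets_pair_measure_cong)
  have nvl: "(\<lambda>z. norm (v (fst z))) \<in> borel_measurable (M \<Otimes>\<^sub>M lborel)"
    by (rule measurable_compose[OF measurable_fst nv])
  have sndm: "(snd :: 'a \<times> real \<Rightarrow> real) \<in> borel_measurable (M \<Otimes>\<^sub>M lborel)"
    using measurable_snd[of M lborel] by (simp cong: measurable_cong_sets)
  have S: "{z \<in> space (M \<Otimes>\<^sub>M lborel). 0 \<le> snd z \<and> snd z \<le> norm (v (fst z))} \<in> sets (M \<Otimes>\<^sub>M lborel)"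
    using nvl sndm by measurable
  have "(\<lambda>z. if 0 \<le> snd z \<and> snd z \<le> norm (v (fst z)) then \<tau> (fst z) (snd z) * snd z else 0) \<in> borel_measurable (M \<Otimes>\<^sub>M lborel)"
    using \<tau>l sndm S by (intro measurable_If borel_measurable_times) auto
  then have "(\<lambda>(x, \<xi>). if 0 \<le> \<xi> \<and> \<xi> \<le> norm (v x) then \<tau> x \<xi> * \<xi> else 0) \<in> borel_measurable (M \<Otimes>\<^sub>M lborel)"
    by (simp add: case_prod_beta')
  then have "(\<lambda>x. LINT \<xi>|lborel. (if 0 \<le> \<xi> \<and> \<xi> \<le> norm (v x) then \<tau> x \<xi> * \<xi> else 0)) \<in> borel_measurable M"
    by (rule lborel.borel_measurable_lebesgue_integral)
  then show "(\<lambda>x. primitive (\<sigma> x) (norm (v x))) \<in> borel_measurable M"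
  proof (rule borel_measurable_AE_cong)
    show "AE x in M. primitive (\<sigma> x) (norm (v x)) = (LINT \<xi>|lborel. (if 0 \<le> \<xi> \<and> \<xi> \<le> norm (v x) then \<tau> x \<xi> * \<xi> else 0))"
      using AE_G
    proof eventually_elim
      case (elim x)
      then have "continuous_on {0..} (\<sigma> x)" by (simp add: G_def regular_at_def)
      then have "continuous_on {0..norm (v x)} (\<lambda>\<xi>. \<sigma> x \<xi> * \<xi>)"
        by (intro continuous_on_mult continuous_on_id) (auto elim: continuous_on_subset)
      then have "set_integrable lborel {0..norm (v x)} (\<lambda>\<xi>. \<sigma> x \<xi> * \<xi>)"
        by (rule borel_integrable_atLeastAtMost')
      then have "primitive (\<sigma> x) (norm (v x)) = (LBINT \<xi>:{0..norm (v x)}. \<sigma> x \<xi> * \<xi>)"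
        unfolding primitive_def by (rule set_borel_integral_eq_integral(2)[symmetric])
      also have "\<dots> = (LINT \<xi>|lborel. (if 0 \<le> \<xi> \<and> \<xi> \<le> norm (v x) then \<tau> x \<xi> * \<xi> else 0))"
        unfolding set_lebesgue_integral_def using elim
        by (intro Bochner_Integration.integral_cong) (auto simp: \<tau>_def indicator_def)
      finally show ?case .
    qed
  qed
qed

proposition admissible_convex_energy:
  assumes adm: "admissible \<Omega> p \<sigma>" and p2: "p \<ge> 2"
  obtains k C where "convex_energy M p (\<lambda>x a::'a. Q_density \<sigma> x (norm a)) (\<lambda>x a::'a. \<sigma> x (norm a) *\<^sub>R a) k C"
proof -
  obtain \<sigma>lo \<sigma>hi E0 where c: "0 < \<sigma>lo" "\<sigma>lo \<le> \<sigma>hi" "0 < E0"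
    "AE x in lebesgue_on (closure \<Omega>). \<forall>E>0. \<sigma>lo * (E / E0) powr (p - 2) \<le> \<sigma> x E \<and>
            \<sigma> x E \<le> \<sigma>hi * max 1 ((E / E0) powr (p - 2))"
    using adm by (auto simp: admissible_def H4_def)
  have H4: "AE x in M. \<forall>E>0. \<sigma>lo * (E / E0) powr (p - 2) \<le> \<sigma> x E \<and> \<sigma> x E \<le> \<sigma>hi * max 1 ((E / E0) powr (p - 2))"
    by (rule AE_closure_imp_AE[OF open_domain c(4)])
  obtain c5 where c5: "c5 > 0" "AE x in lebesgue_on (closure \<Omega>). \<forall>E1 E2 :: 'a.
        c5 * norm (E2 - E1) powr p \<le> (\<sigma> x (norm E2) *\<^sub>R E2 - \<sigma> x (norm E1) *\<^sub>R E1) \<bullet> (E2 - E1)"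
    using adm by (auto simp: admissible_def H5_def)
  have H5: "AE x in M. \<forall>E1 E2 :: 'a.
        c5 * norm (E2 - E1) powr p \<le> (\<sigma> x (norm E2) *\<^sub>R E2 - \<sigma> x (norm E1) *\<^sub>R E1) \<bullet> (E2 - E1)"
    by (rule AE_closure_imp_AE[OF open_domain c5(2)])
  note reg = admissible_regular_at[OF adm p2]
  have "convex_energy M p (\<lambda>x a::'a. Q_density \<sigma> x (norm a)) (\<lambda>x a::'a. \<sigma> x (norm a) *\<^sub>R a)
      (c5 * (1/2) powr p) (\<sigma>hi * (1 + E0 powr (2 - p)))"
    unfolding Q_density_primitive
  proof (intro convex_energy.intro finite_measure_axioms convex_energy_axioms.intro)
    show "1 < p" by (rule p_gt_1)
    show "0 < c5 * (1/2) powr p" using c5(1) by simp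
    show "0 \<le> \<sigma>hi * (1 + E0 powr (2 - p))" using c by simp
    show "(\<lambda>x. primitive (\<sigma> x) (norm (v x))) \<in> borel_measurable M" if "v \<in> borel_measurable M" for v :: "'a \<Rightarrow> 'a"
      by (rule admissible_measurable(2)[OF adm p2 that])
    show "(\<lambda>x. \<sigma> x (norm (v x)) *\<^sub>R v x) \<in> borel_measurable M" if "v \<in> borel_measurable M" for v :: "'a \<Rightarrow> 'a"
      by (intro borel_measurable_scaleR that admissible_measurable(1)[OF adm p2 that])
    show "AE x in M. \<forall>a b::'a. primitive (\<sigma> x) (norm a) + (\<sigma> x (norm a) *\<^sub>R a) \<bullet> (b - a)
        + c5 * (1/2) powr p * norm (b - a) powr p \<le> primitive (\<sigma> x) (norm b)"
      using reg H5 by eventually_elim (use radial_strongly_convex in blast)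
    show "AE x in M. continuous_on UNIV (\<lambda>a::'a. \<sigma> x (norm a) *\<^sub>R a)"
      using reg by eventually_elim (rule radial_continuous)
    show "AE x in M. \<forall>a::'a. 0 \<le> primitive (\<sigma> x) (norm a)"
      using reg by eventually_elim (use primitive_nonneg norm_ge_zero in blast)
    show "AE x in M. primitive (\<sigma> x) (norm (0::'a)) = 0"
      by (simp add: primitive_def)
    show "AE x in M. \<forall>a::'a. norm (\<sigma> x (norm a) *\<^sub>R a) \<le> \<sigma>hi * (1 + E0 powr (2 - p)) * (1 + norm a powr (p - 1))"
      using reg H4
    proof eventually_elim
      case (elim x)
      have "\<sigma>hi > 0" using c(1,2) by linarith
      from radial_growth[OF elim(1) p2 this c(3)] elim(2) show ?case by blast
    qed
  qed
  then show ?thesis by (rule that)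
qed

end

section \<open>The average Dirichlet-to-Neumann operator\<close>

locale conductivity_problem = variational_problem \<Omega> p "\<lambda>x a. Q_density \<sigma> x (norm a)" "\<lambda>x a. \<sigma> x (norm a) *\<^sub>R a" k C
  for \<Omega> :: "'a::euclidean_space set" and p \<sigma> k C
begin

lemma dirichlet_energy_eq: "dirichlet_energy \<Omega> \<sigma> u = energy (D u)"
  by (simp add: dirichlet_energy_def energy_def)

text \<open>A class of the trace space is itself the set of competitors in the minimization problem.\<close>

lemma trace_space_class:
  assumes "f \<in> trace_space \<Omega> p"
  obtains g where "g \<in> W1p \<Omega> p" "f = boundary_class g"
proof -
  obtain g where g: "g \<in> W1p \<Omega> p" "f = same_trace \<Omega> p `` {g}"
    using assms by (auto simp: trace_space_def quotient_def)
  then have "f = boundary_class g" by (auto simp: same_trace_def boundary_class_def)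
  with g(1) show ?thesis by (rule that)
qed

lemma trace_scale_class:
  assumes g: "g \<in> W1p \<Omega> p"
  shows "trace_scale \<Omega> p \<alpha> (boundary_class g) = boundary_class (\<lambda>x. \<alpha> * g x)"
proof (intro subset_antisym subsetI)
  fix v assume "v \<in> trace_scale \<Omega> p \<alpha> (boundary_class g)"
  then obtain u where u: "u \<in> boundary_class g" "v \<in> W1p \<Omega> p" "(\<lambda>x. \<alpha> * u x - v x) \<in> W1p_0 \<Omega> p"
    by (auto simp: trace_scale_def same_trace_def)
  have "(\<lambda>x. \<alpha> * (g x - u x) + 1 * (\<alpha> * u x - v x)) \<in> W1p_0 \<Omega> p"
    using u by (intro W1p_0_combination) (auto simp: boundary_class_def)
  moreover have "(\<lambda>x. \<alpha> * (g x - u x) + 1 * (\<alpha> * u x - v x)) = (\<lambda>x. \<alpha> * g x - v x)"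
    by (simp add: algebra_simps)
  ultimately show "v \<in> boundary_class (\<lambda>x. \<alpha> * g x)" using u(2) by (simp add: boundary_class_def)
next
  fix v assume "v \<in> boundary_class (\<lambda>x. \<alpha> * g x)"
  then show "v \<in> trace_scale \<Omega> p \<alpha> (boundary_class g)"
    using boundary_class_self[OF g] W1p_scale(1)[OF g, of \<alpha>]
    unfolding trace_scale_def same_trace_def boundary_class_def by auto
qed

lemma minimizer_class:
  assumes g: "g \<in> W1p \<Omega> p"
  shows "minimizer \<Omega> \<sigma> (boundary_class g) \<in> boundary_class g"
    "v \<in> boundary_class g \<Longrightarrow> energy (D (minimizer \<Omega> \<sigma> (boundary_class g))) \<le> energy (D v)"
proof -
  have "\<exists>u. u \<in> boundary_class g \<and> (\<forall>v\<in>boundary_class g. energy (D u) \<le> energy (D v))"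
    using exists_minimizer[OF g] by metis
  from someI_ex[OF this]
  show "minimizer \<Omega> \<sigma> (boundary_class g) \<in> boundary_class g"
    "v \<in> boundary_class g \<Longrightarrow> energy (D (minimizer \<Omega> \<sigma> (boundary_class g))) \<le> energy (D v)"
    by (auto simp: minimizer_def dirichlet_energy_eq)
qed

text \<open>The representative picked by \<open>DtN\<close> for its second argument does not depend on \<open>\<alpha>\<close>, so the integral over \<open>\<alpha>\<close> is that
of a subgradient of the minimal energy.\<close>

proposition avg_DtN_eq_energy:
  assumes g: "g \<in> W1p \<Omega> p"
  shows "avg_DtN \<Omega> p \<sigma> (boundary_class g) (boundary_class g) = energy (D (minimizer \<Omega> \<sigma> (boundary_class g)))"
proof -
  define r where "r = (SOME w. w \<in> boundary_class g)"
  have r: "r \<in> boundary_class g" unfolding r_def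
    by (rule someI[of "\<lambda>w. w \<in> boundary_class g"]) (rule boundary_class_self[OF g])
  define u where "u \<alpha> = minimizer \<Omega> \<sigma> (boundary_class (\<lambda>x. \<alpha> * g x))" for \<alpha>
  note gW = W1p_scale(1)[OF g]
  have "avg_DtN \<Omega> p \<sigma> (boundary_class g) (boundary_class g) = (LBINT \<alpha>:{0..1}. pairing (D (u \<alpha>)) (D r))"
    by (simp add: avg_DtN_def DtN_def trace_scale_class[OF g] Let_def pairing_def u_def r_def)
  also have "\<dots> = energy (D (u 1))"
    unfolding u_def by (rule integral_pairing_eq_energy[OF g r minimizer_class(1)[OF gW] minimizer_class(2)[OF gW]])
  finally show ?thesis by (simp add: u_def)
qed

end

theorem theorem4p3:
  fixes \<Omega> :: "(real ^ 'n) set" and p :: real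
    and \<sigma>1 \<sigma>2 :: "real ^ 'n \<Rightarrow> real \<Rightarrow> real"
  assumes "CARD('n) \<ge> 2"
    and "domain \<Omega>" and "bounded \<Omega>" and "lipschitz_boundary \<Omega>"
    and "p \<ge> 2"
    and "admissible \<Omega> p \<sigma>1" and "admissible \<Omega> p \<sigma>2"
    and "AE x in lebesgue_on (closure \<Omega>). \<forall>E>0. \<sigma>1 x E \<le> \<sigma>2 x E"
  shows "\<forall>f \<in> X_diamond \<Omega> p. avg_DtN \<Omega> p \<sigma>1 f f \<le> avg_DtN \<Omega> p \<sigma>2 f f"
proof
  fix f assume "f \<in> X_diamond \<Omega> p"
  then have f: "f \<in> trace_space \<Omega> p" by (simp add: X_diamond_def)
  interpret sobolev_domain \<Omega> p
    by unfold_locales (use assms(2,3,5) in \<open>auto simp: domain_def\<close>)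
  obtain k1 C1 where "convex_energy M p (\<lambda>x a::real ^ 'n. Q_density \<sigma>1 x (norm a)) (\<lambda>x a::real ^ 'n. \<sigma>1 x (norm a) *\<^sub>R a) k1 C1"
    by (rule admissible_convex_energy[OF assms(6,5)])
  then interpret P1: conductivity_problem \<Omega> p \<sigma>1 k1 C1
    by (intro conductivity_problem.intro variational_problem.intro sobolev_domain_axioms)
  obtain k2 C2 where "convex_energy M p (\<lambda>x a::real ^ 'n. Q_density \<sigma>2 x (norm a)) (\<lambda>x a::real ^ 'n. \<sigma>2 x (norm a) *\<^sub>R a) k2 C2"
    by (rule admissible_convex_energy[OF assms(7,5)])
  then interpret P2: conductivity_problem \<Omega> p \<sigma>2 k2 C2
    by (intro conductivity_problem.intro variational_problem.intro sobolev_domain_axioms)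
  obtain g where g: "g \<in> W1p \<Omega> p" "f = P1.boundary_class g"
    by (rule P1.trace_space_class[OF f])
  then have f2: "f = P2.boundary_class g"
    by (simp add: P1.boundary_class_def P2.boundary_class_def)
  define u1 where "u1 = minimizer \<Omega> \<sigma>1 f"
  define u2 where "u2 = minimizer \<Omega> \<sigma>2 f"
  have u2: "u2 \<in> f" using P2.minimizer_class(1)[OF g(1)] unfolding u2_def f2 .
  then have u2W: "u2 \<in> W1p \<Omega> p" unfolding f2 by (rule P2.boundary_class_W1p)
  have "P1.energy (D u2) \<le> P2.energy (D u2)"
    unfolding P1.energy_def P2.energy_def
  proof (rule integral_mono_AE)
    have "AE x in M. \<forall>E>0. \<sigma>1 x E \<le> \<sigma>2 x E" by (rule AE_closure_imp_AE[OF open_domain assms(8)])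
    then show "AE x in M. Q_density \<sigma>1 x (norm (D u2 x)) \<le> Q_density \<sigma>2 x (norm (D u2 x))"
      using admissible_regular_at[OF assms(6,5)] admissible_regular_at[OF assms(7,5)]
      unfolding Q_density_primitive by eventually_elim (use primitive_mono in blast)
  qed (rule P1.Q_integrable[OF P1.D_Lp[OF u2W]] P2.Q_integrable[OF P2.D_Lp[OF u2W]])+
  moreover have "P1.energy (D u1) \<le> P1.energy (D u2)"
    using P1.minimizer_class(2)[OF g(1)] u2 unfolding u1_def g(2) by blast
  moreover have "avg_DtN \<Omega> p \<sigma>1 f f = P1.energy (D u1)"
    using P1.avg_DtN_eq_energy[OF g(1)] unfolding u1_def g(2) .
  moreover have "avg_DtN \<Omega> p \<sigma>2 f f = P2.energy (D u2)"
    using P2.avg_DtN_eq_energy[OF g(1)] unfolding u2_def f2 .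
  ultimately show "avg_DtN \<Omega> p \<sigma>1 f f \<le> avg_DtN \<Omega> p \<sigma>2 f f" by linarith
qed

end
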